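(* Fix $d\in\mathbb{N}$. Let $\{X_n\}$ and $\{Y_n\}$ be sequences of $n\times d$ random matrices, where $Y_n\sim\mathsf{N}(0,\Sigma_n\otimes\mathrm{I}_n)$ (i.e., the rows of $Y_n$ are i.i.d. $\mathsf{N}(0,\Sigma_n)$) for positive semidefinite $d\times d$ matrices $\Sigma_n$ with $\sup_n\|\Sigma_n\|_{op}<\infty$. The following are equivalent: (i) there exists a sequence of couplings of $(X_n,Y_n)$ such that $\frac{\|X_n-Y_n\|_F}{\sqrt n}\xrightarrow[n\to\infty]{\mathrm{p}}0$; (ii) for every $r\ge1$ and every sequence of functions $\psi_n\colon\mathbb{R}^{n\times d}\to\mathbb{R}$ satisfying $$|\psi_n(X)-\psi_n(Y)|\le\frac{\|X-Y\|_F}{\sqrt n}\Big(1+\Big(\frac{\|X\|_F}{\sqrt n}\Big)^{r-1}+\Big(\frac{\|Y\|_F}{\sqrt n}\Big)^{r-1}\Big)\quad\text{for all }X,Y\in\mathbb{R}^{n\times d},$$ one has $|\psi_n(X_n)-\mathbb{E}[\psi_n(Y_n)]|\xrightarrow[n\to\infty]{\mathrm{p}}0$.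
   Context: $\|\cdot\|_F$ is the Frobenius norm. A coupling of $(X_n,Y_n)$ is a joint distribution on a common probability space with the given marginal laws. *)

theory Defs
  imports "HOL-Probability.Probability"
begin

text \<open>An n x d real matrix is represented by its rows: a function
  nat => real^'d, extensional on the row index set {..<n}.  The column
  dimension d is the fixed finite type 'd (d = CARD('d)).\<close>

definition mat_space :: "nat \<Rightarrow> (nat \<Rightarrow> real^'d) measure" where
  "mat_space n = PiM {..<n} (\<lambda>_. borel)"

definition frob :: "nat \<Rightarrow> (nat \<Rightarrow> real^'d) \<Rightarrow> real" where
  "frob n X = sqrt (\<Sum>i<n. (norm (X i))\<^sup>2)"

text \<open>Power with the convention t^0 = 1 (Isabelle's powr has 0 powr 0 = 0).\<close>
definition rpow :: "real \<Rightarrow> real \<Rightarrow> real" where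
  "rpow x a = (if a = 0 then 1 else x powr a)"

definition psd :: "real^'d^'d \<Rightarrow> bool" where
  "psd S \<longleftrightarrow> transpose S = S \<and> (\<forall>v. 0 \<le> v \<bullet> (S *v v))"

definition opnorm :: "real^'d^'d \<Rightarrow> real" where
  "opnorm S = onorm (\<lambda>v. S *v v)"

text \<open>Law of an n x d Gaussian matrix N(0, Sigma (x) I_n): rows i.i.d. N(0,Sigma),
  characterised by its characteristic function.\<close>
definition gauss_matrix :: "nat \<Rightarrow> real^'d^'d \<Rightarrow> (nat \<Rightarrow> real^'d) measure \<Rightarrow> bool" where
  "gauss_matrix n S \<mu> \<longleftrightarrow> prob_space \<mu> \<and> sets \<mu> = sets (mat_space n) \<and>
     (\<forall>T :: nat \<Rightarrow> real^'d.
        (\<integral>X. cis (\<Sum>i<n. T i \<bullet> X i) \<partial>\<mu>)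
          = complex_of_real (exp (- (1/2) * (\<Sum>i<n. T i \<bullet> (S *v T i)))))"

definition coupling :: "nat \<Rightarrow> (nat \<Rightarrow> real^'d) measure \<Rightarrow> (nat \<Rightarrow> real^'d) measure
     \<Rightarrow> ((nat \<Rightarrow> real^'d) \<times> (nat \<Rightarrow> real^'d)) measure \<Rightarrow> bool" where
  "coupling n \<mu> \<nu> C \<longleftrightarrow> prob_space C \<and>
     sets C = sets (mat_space n \<Otimes>\<^sub>M mat_space n) \<and>
     distr C (mat_space n) fst = \<mu> \<and> distr C (mat_space n) snd = \<nu>"

end

theory Submission
  imports Defs
begin

text \<open>
  From couplings to concentration: by the Prekopa-Leindler inequality (only needed in dimension one,
  where the dominating function is the unimodal normal density) the standard normal law satisfies
  Maurey's property \<open>\<tau>\<close>: if \<open>u x * v y \<le> exp ((x - y)\<^sup>2 / 4)\<close> then \<open>(\<integral>u) * (\<integral>v) \<le> 1\<close>. The property passes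
  to products and gives dimension-free bounds on the exponential moments of Lipschitz functions of a Gaussian
  matrix, with no differentiability involved. A pseudo-Lipschitz function is cut off at a fixed radius,
  and the error is controlled by the exponential moments of the normalised Frobenius norm.

  From concentration to couplings: testing with truncated distances to a set \<open>A\<close> shows that if \<open>X\<^sub>n\<close>
  charges \<open>A\<close> with mass at least \<open>\<delta>\<close>, then a set far away from \<open>A\<close> has mass at most \<open>\<delta>\<close> under \<open>Y\<^sub>n\<close>.
  This expansion is much stronger than Hall's condition: after cutting the space into finitely many small
  cells, any maximal partial matching of nearby cells leaves little mass unmatched.
\<close>


section \<open>Property \<open>\<tau>\<close> of the standard normal law\<close>

text \<open>Property tau asks for neither derivatives nor finite integrals, which lets it tensorise
  over all coordinates with one constant. Its cost (x - y)^2 / 4 is the one that turns the product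
  of two normal densities into the squared density at the midpoint. Two obstacles shape this
  direction. The law of Y is known only through its characteristic function and
  \<open>\<Sigma>\<close> may be singular, so there is no density to work with; uniqueness of
  characteristic functions and a sum-of-squares factorisation of \<open>\<Sigma>\<close> exhibit Y
  as a Lipschitz linear image of independent normals. Moreover, the functions in (ii) are not
  assumed measurable, so measurability must come out of the inequality itself. As to scale, a
  function that is L-Lipschitz in \<open>nfrob\<close> is L / sqrt n-Lipschitz in
  \<open>frob\<close>, whence fluctuations of order 1 / sqrt n. In the converse, (ii) speaks of one
  sequence of functions at a time, while matching needs a bound uniform over all sets; picking an
  offending set for every n supplies the uniformity. Couplings of fixed accuracy are finally
  combined by letting the accuracy improve with n.\<close>

lemma nn_integral_min_one_layer_cake:
  fixes F :: "real \<Rightarrow> real"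
  assumes [measurable]: "F \<in> borel_measurable borel" and F: "\<And>x. 0 \<le> F x"
  shows "(\<integral>\<^sup>+x. ennreal (min 1 (F x)) \<partial>lborel)
    = (\<integral>\<^sup>+t. indicator {0<..<1} t * emeasure lborel {x. t < F x} \<partial>lborel)"
proof -
  have "(\<integral>\<^sup>+x. ennreal (min 1 (F x)) \<partial>lborel)
      = (\<integral>\<^sup>+x. (\<integral>\<^sup>+t. indicator {0<..<1} t * indicator {z. t < F z} x \<partial>lborel) \<partial>lborel)"
  proof (rule nn_integral_cong)
    fix x :: real
    have "(\<integral>\<^sup>+t. indicator {0<..<1} t * indicator {z. t < F z} x \<partial>lborel)
        = (\<integral>\<^sup>+t. indicator {0<..<min 1 (F x)} t \<partial>lborel)"
      by (rule nn_integral_cong) (auto simp: indicator_def)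
    also have "\<dots> = ennreal (min 1 (F x))"
      using F[of x] by simp
    finally show "ennreal (min 1 (F x))
      = (\<integral>\<^sup>+t. indicator {0<..<1} t * indicator {z. t < F z} x \<partial>lborel)" ..
  qed
  also have "\<dots> = (\<integral>\<^sup>+t. (\<integral>\<^sup>+x. indicator {0<..<1} t * indicator {z. t < F z} x \<partial>lborel) \<partial>lborel)"
  proof (rule lborel_pair.Fubini')
    have "(\<lambda>(t, x). indicator {0<..<1} t * (if t < F x then 1 else 0) :: ennreal)
        \<in> borel_measurable (lborel \<Otimes>\<^sub>M lborel)"
      by measurable
    then show "(\<lambda>(t, x). indicator {0<..<1} t * indicator {z. t < F z} x :: ennreal)
        \<in> borel_measurable (lborel \<Otimes>\<^sub>M lborel)"
      by (simp add: indicator_def)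
  qed
  also have "\<dots> = (\<integral>\<^sup>+t. indicator {0<..<1} t * emeasure lborel {x. t < F x} \<partial>lborel)"
    by (intro nn_integral_cong) (simp add: nn_integral_cmult)
  finally show ?thesis .
qed

text \<open>One-dimensional Brunn-Minkowski for midpoints. Because \<open>H\<close> is an interval,
  \<open>A\<close> and \<open>B\<close> may be replaced by their convex hulls: the midpoints of the
  hulls still lie in \<open>H\<close>, up to endpoints, and lengths of intervals add.\<close>

lemma emeasure_midpoint_interval:
  fixes A B H :: "real set"
  assumes ne: "A \<noteq> {}" "B \<noteq> {}"
    and [measurable]: "A \<in> sets borel" "B \<in> sets borel" "H \<in> sets borel"
    and H: "bounded H" "is_interval H"
    and mid: "\<And>x y. x \<in> A \<Longrightarrow> y \<in> B \<Longrightarrow> (x + y) / 2 \<in> H"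
  shows "emeasure lborel A + emeasure lborel B \<le> 2 * emeasure lborel H"
proof -
  obtain K where K: "\<And>z. z \<in> H \<Longrightarrow> \<bar>z\<bar> \<le> K"
    using H(1) by (auto simp: bounded_iff)
  obtain a b where ab: "a \<in> A" "b \<in> B" using ne by blast
  have A: "\<bar>x\<bar> \<le> 2 * K + \<bar>b\<bar>" if "x \<in> A" for x
  proof -
    have "\<bar>x + b\<bar> \<le> 2 * K" using K[OF mid[OF that ab(2)]] by simp
    then show ?thesis by linarith
  qed
  have B: "\<bar>y\<bar> \<le> 2 * K + \<bar>a\<bar>" if "y \<in> B" for y
  proof -
    have "\<bar>a + y\<bar> \<le> 2 * K" using K[OF mid[OF ab(1) that]] by simp
    then show ?thesis by linarith
  qed
  have bA: "bdd_above A" "bdd_below A"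
    using A by (force intro!: bdd_aboveI[of _ "2 * K + \<bar>b\<bar>"] bdd_belowI[of _ "- (2 * K + \<bar>b\<bar>)"])+
  have bB: "bdd_above B" "bdd_below B"
    using B by (force intro!: bdd_aboveI[of _ "2 * K + \<bar>a\<bar>"] bdd_belowI[of _ "- (2 * K + \<bar>a\<bar>)"])+
  have leA: "Inf A \<le> Sup A" and leB: "Inf B \<le> Sup B"
    using ne bA bB by (auto intro!: cInf_le_cSup)
  have "emeasure lborel A \<le> emeasure lborel {Inf A..Sup A}"
    using bA by (intro emeasure_mono) (auto intro: cInf_lower cSup_upper)
  then have eA: "emeasure lborel A \<le> ennreal (Sup A - Inf A)" using leA by simp
  have "emeasure lborel B \<le> emeasure lborel {Inf B..Sup B}"
    using bB by (intro emeasure_mono) (auto intro: cInf_lower cSup_upper)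
  then have eB: "emeasure lborel B \<le> ennreal (Sup B - Inf B)" using leB by simp
  have sub: "{(Inf A + Inf B) / 2<..<(Sup A + Sup B) / 2} \<subseteq> H"
  proof
    fix z assume z: "z \<in> {(Inf A + Inf B) / 2<..<(Sup A + Sup B) / 2}"
    \<comment> \<open>Half the smaller distance from \<open>2 * z\<close> to the sums of the infima
      and of the suprema: points within \<open>e\<close> of the infima add up to at most
      \<open>2 * z\<close>, points within \<open>e\<close> of the suprema to at least
      \<open>2 * z\<close>.\<close>
    define e where "e = min (2 * z - (Inf A + Inf B)) (Sup A + Sup B - 2 * z) / 2"
    have e: "e > 0" using z by (auto simp: e_def)
    have e12: "2 * e \<le> 2 * z - (Inf A + Inf B)" "2 * e \<le> Sup A + Sup B - 2 * z"
      by (simp_all add: e_def)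
    obtain x1 where x1: "x1 \<in> A" "x1 < Inf A + e" using ne(1) e
      by (metis cInf_lessD less_add_same_cancel1)
    obtain y1 where y1: "y1 \<in> B" "y1 < Inf B + e" using ne(2) e
      by (metis cInf_lessD less_add_same_cancel1)
    obtain x2 where x2: "x2 \<in> A" "Sup A - e < x2" using ne(1) e less_cSupD[of A "Sup A - e"] by auto
    obtain y2 where y2: "y2 \<in> B" "Sup B - e < y2" using ne(2) e less_cSupD[of B "Sup B - e"] by auto
    have "x1 + y1 \<le> 2 * z" "2 * z \<le> x2 + y2"
      using x1(2) x2(2) y1(2) y2(2) e12 by linarith+
    then have "(x1 + y1) / 2 \<le> z" "z \<le> (x2 + y2) / 2" by simp_all
    then show "z \<in> H"
      using H(2) mid[OF x1(1) y1(1)] mid[OF x2(1) y2(1)] unfolding is_interval_1 by blast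
  qed
  have "ennreal (Sup A - Inf A) + ennreal (Sup B - Inf B)
      = 2 * ennreal ((Sup A + Sup B) / 2 - (Inf A + Inf B) / 2)"
    using leA leB
    by (simp flip: ennreal_plus ennreal_numeral add: ennreal_mult[symmetric] field_simps)
  also have "ennreal ((Sup A + Sup B) / 2 - (Inf A + Inf B) / 2)
      = emeasure lborel {(Inf A + Inf B) / 2<..<(Sup A + Sup B) / 2}"
    using leA leB by simp
  also have "\<dots> \<le> emeasure lborel H" using sub by (intro emeasure_mono) auto
  finally show ?thesis using add_mono[OF eA eB] by (meson mult_left_mono order_trans zero_le)
qed

lemma is_interval_std_normal_superlevel: "is_interval {z. c < std_normal_density z}"
proof -
  have mono: "std_normal_density x \<le> std_normal_density y" if "\<bar>y\<bar> \<le> \<bar>x\<bar>" for x y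
    using that abs_le_square_iff[of y x] by (simp add: normal_density_def divide_right_mono)
  show ?thesis
    unfolding is_interval_1
  proof (intro ballI allI impI)
    fix a b x assume a: "a \<in> {z. c < std_normal_density z}" and b: "b \<in> {z. c < std_normal_density z}" and x: "a \<le> x \<and> x \<le> b"
    have "\<bar>x\<bar> \<le> \<bar>a\<bar> \<or> \<bar>x\<bar> \<le> \<bar>b\<bar>" using x by auto
    then show "x \<in> {z. c < std_normal_density z}" using a b mono[of x a] mono[of x b] by auto
  qed
qed

lemma bounded_std_normal_superlevel:
  assumes "c > 0" shows "bounded {z. c < std_normal_density z}"
proof (rule boundedI)
  fix z assume "z \<in> {z. c < std_normal_density z}"
  then have "c < exp (- z\<^sup>2 / 2) / sqrt (2 * pi)" by (simp add: normal_density_def)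
  also have "\<dots> \<le> exp (- z\<^sup>2 / 2)"
    using pi_ge_two by (simp add: divide_le_eq)
  finally have "c < exp (- z\<^sup>2 / 2)" .
  then have "c * exp (z\<^sup>2 / 2) < 1"
    by (metis add.inverse_inverse exp_minus_inverse exp_gt_zero minus_divide_left mult.commute mult_strict_right_mono)
  moreover have "z\<^sup>2 / 2 \<le> exp (z\<^sup>2 / 2)" using exp_ge_add_one_self[of "z\<^sup>2 / 2"] by linarith
  ultimately have "c * (z\<^sup>2 / 2) < 1" using assms by (smt (verit) mult_left_mono)
  then have "z\<^sup>2 \<le> 2 / c" using assms by (simp add: field_simps)
  then show "norm z \<le> sqrt (2 / c)" by (simp add: real_le_rsqrt)
qed

text \<open>After dividing \<open>f\<close> and \<open>g\<close> by their suprema, all superlevel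
  sets with level in (0,1) are nonempty, and their midpoints fall into a superlevel set of the
  density, which is an interval. Integrating the resulting length inequality over the level bounds
  the sum of the normalised integrals; the arithmetic-geometric mean inequality turns this into the
  product.\<close>

lemma std_normal_prekopa_leindler:
  fixes f g :: "real \<Rightarrow> real"
  assumes [measurable]: "f \<in> borel_measurable borel" "g \<in> borel_measurable borel"
    and nn: "\<And>x. 0 \<le> f x" "\<And>x. 0 \<le> g x"
    and le: "\<And>x y. f x * g y \<le> (std_normal_density ((x + y) / 2))\<^sup>2"
  shows "(\<integral>\<^sup>+x. f x \<partial>lborel) * (\<integral>\<^sup>+x. g x \<partial>lborel) \<le> 1"
proof (cases "(\<exists>x. f x > 0) \<and> (\<exists>x. g x > 0)")
  case False
  then have "(\<forall>x. f x = 0) \<or> (\<forall>x. g x = 0)" using nn by (metis less_eq_real_def)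
  then show ?thesis by auto
next
  case True
  then obtain x0 y0 where x0: "f x0 > 0" and y0: "g y0 > 0" by blast
  \<comment> \<open>A crude bound, used only to see that \<open>f\<close> and \<open>g\<close> are
    bounded and have finite suprema.\<close>
  have d1: "(std_normal_density z)\<^sup>2 \<le> 1" for z
  proof -
    have "exp (- z\<^sup>2 / 2) \<le> 1" by simp
    moreover have "1 \<le> sqrt (2 * pi)" using pi_ge_two by simp
    ultimately have "exp (- z\<^sup>2 / 2) / sqrt (2 * pi) \<le> 1" by (smt (verit) divide_le_eq_1)
    then show ?thesis by (simp add: normal_density_def power_le_one_iff)
  qed
  have fb: "f x \<le> 1 / g y0" for x
    using order_trans[OF le[of x y0] d1] y0 by (simp add: field_simps)
  have gb: "g y \<le> 1 / f x0" for y
    using order_trans[OF le[of x0 y] d1] x0 by (simp add: field_simps)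
  define a b where "a = Sup (range f)" and "b = Sup (range g)"
  have bf: "bdd_above (range f)" "bdd_above (range g)" using fb gb by (auto intro!: bdd_aboveI)
  have fa: "f x \<le> a" and gb: "g x \<le> b" for x
    using bf by (auto simp: a_def b_def intro!: cSup_upper)
  have pos: "a > 0" "b > 0" using fa[of x0] gb[of y0] x0 y0 by auto
  \<comment> \<open>The geometric mean of the suprema, so that the levels \<open>t * a\<close> and
    \<open>t * b\<close> multiply to the square of \<open>t * s\<close>.\<close>
  define s where "s = sqrt (a * b)"
  have s: "s > 0" "s\<^sup>2 = a * b" using pos by (auto simp: s_def)
  define P where "P = (\<integral>\<^sup>+x. f x \<partial>lborel)"
  define Q where "Q = (\<integral>\<^sup>+x. g x \<partial>lborel)"
  have lev: "emeasure lborel {x. t < f x / a} + emeasure lborel {x. t < g x / b}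
      \<le> 2 * emeasure lborel {x. t < std_normal_density x / s}" if t: "t \<in> {0<..<1}" for t
  proof -
    have eq: "{x. t < std_normal_density x / s} = {x. t * s < std_normal_density x}"
      using s by (simp add: field_simps)
    have "t * a < a" "t * b < b" using t pos by auto
    then have ne: "{x. t < f x / a} \<noteq> {}" "{x. t < g x / b} \<noteq> {}"
      using less_cSupD[of "range f" "t * a"] less_cSupD[of "range g" "t * b"] pos
      by (auto simp: a_def[symmetric] b_def[symmetric] field_simps)
    show ?thesis
      unfolding eq
    proof (rule emeasure_midpoint_interval[OF ne])
      show "bounded {x. t * s < std_normal_density x}"
        using t s by (intro bounded_std_normal_superlevel) auto
      show "is_interval {x. t * s < std_normal_density x}"
        by (rule is_interval_std_normal_superlevel)
      fix x y assume "x \<in> {x. t < f x / a}" "y \<in> {x. t < g x / b}"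
      then have "t * a < f x" "t * b < g y" using pos by (auto simp: field_simps)
      then have "(t * a) * (t * b) < f x * g y" using t pos
        by (intro mult_strict_mono) (auto simp: nn intro: order_le_less_trans[of _ "t * a"])
      also note le
      also have "(t * a) * (t * b) = (t * s)\<^sup>2" using s by (simp add: power_mult_distrib power2_eq_square)
      finally have "t * s < std_normal_density ((x + y) / 2)"
        by (rule power_less_imp_less_base) simp
      then show "(x + y) / 2 \<in> {x. t * s < std_normal_density x}" by simp
    qed measurable
  qed
  have scale: "(\<integral>\<^sup>+x. ennreal (h x / c) \<partial>lborel) = (\<integral>\<^sup>+x. ennreal (h x) \<partial>lborel) * ennreal (1 / c)"
    if "c > 0" "\<And>x. 0 \<le> h x" "h \<in> borel_measurable borel" for h :: "real \<Rightarrow> real" and c :: real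
    using that by (subst nn_integral_multc[symmetric]) (auto simp: ennreal_mult[symmetric])
  have one: "(\<integral>\<^sup>+x. ennreal (std_normal_density x) \<partial>lborel) = 1"
    by (subst nn_integral_eq_integral) (auto)
  \<comment> \<open>Truncation at 1 is exact for \<open>f / a\<close> and \<open>g / b\<close>; on
    the side of the density it only loses mass, which is the harmless direction.\<close>
  have "P * ennreal (1 / a) + Q * ennreal (1 / b)
      = (\<integral>\<^sup>+x. ennreal (min 1 (f x / a)) \<partial>lborel) + (\<integral>\<^sup>+x. ennreal (min 1 (g x / b)) \<partial>lborel)"
  proof -
    have "min 1 (f x / a) = f x / a" "min 1 (g x / b) = g x / b" for x
      using pos fa[of x] gb[of x] by (simp_all add: min_absorb2)
    then show ?thesis using pos nn by (simp add: P_def Q_def scale[symmetric])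
  qed
  also have "\<dots> = (\<integral>\<^sup>+t. indicator {0<..<1} t * (emeasure lborel {x. t < f x / a} + emeasure lborel {x. t < g x / b}) \<partial>lborel)"
    using pos nn by (subst (1 2) nn_integral_min_one_layer_cake)
      (auto simp: nn_integral_add[symmetric] distrib_left)
  also have "\<dots> \<le> (\<integral>\<^sup>+t. 2 * (indicator {0<..<1} t * emeasure lborel {x. t < std_normal_density x / s}) \<partial>lborel)"
    using lev by (intro nn_integral_mono) (auto simp: indicator_def)
  also have "\<dots> = 2 * (\<integral>\<^sup>+x. ennreal (min 1 (std_normal_density x / s)) \<partial>lborel)"
    using s by (subst nn_integral_min_one_layer_cake) (auto simp: nn_integral_cmult)
  also have "\<dots> \<le> 2 * (\<integral>\<^sup>+x. ennreal (std_normal_density x / s) \<partial>lborel)"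
    by (intro mult_left_mono nn_integral_mono ennreal_leI) auto
  also have "\<dots> = ennreal (2 / s)"
    using s by (subst scale) (auto simp: one ennreal_mult[symmetric] simp flip: ennreal_numeral)
  finally have main: "P * ennreal (1 / a) + Q * ennreal (1 / b) \<le> ennreal (2 / s)" .
  then have "P * ennreal (1 / a) < \<top>" "Q * ennreal (1 / b) < \<top>"
    by (auto simp: less_top[symmetric] top_unique)
  then have fin: "P < \<top>" "Q < \<top>" using pos by (auto simp: ennreal_mult_less_top)
  then obtain p q where pq: "P = ennreal p" "Q = ennreal q" "0 \<le> p" "0 \<le> q"
    by (metis ennreal_cases less_irrefl)
  have *: "p / a + q / b \<le> 2 / s"
    using main pos s pq by (simp add: ennreal_mult[symmetric] ennreal_plus[symmetric] del: ennreal_plus)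
  have "4 * x * y \<le> (x + y)\<^sup>2" for x y :: real
    using zero_le_power2[of "x - y"] by (simp add: power2_eq_square algebra_simps)
  then have "4 * (p / a) * (q / b) \<le> (p / a + q / b)\<^sup>2" .
  also have "\<dots> \<le> (2 / s)\<^sup>2" using * pq pos by (intro power_mono) auto
  also have "\<dots> = 4 / (a * b)" using s by (simp add: power_divide)
  finally have "p * q \<le> 1" using pos by (simp add: field_simps)
  then show ?thesis using pq by (simp add: P_def[symmetric] Q_def[symmetric] ennreal_mult[symmetric])
qed

text \<open>Multiplying by the densities reduces this to \<open>std_normal_prekopa_leindler\<close>,
  since - x^2/2 - y^2/2 + (x - y)^2/4 = - (x + y)^2/4. Values in \<open>ennreal\<close> are allowed
  because the induction on coordinates applies the lemma to functions not yet known to be finite;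
  one positive value of either function forces the other to be finite.\<close>

lemma std_normal_property_tau:
  fixes u v :: "real \<Rightarrow> ennreal"
  assumes [measurable]: "u \<in> borel_measurable borel" "v \<in> borel_measurable borel"
    and le: "\<And>x y. u x * v y \<le> ennreal (exp ((x - y)\<^sup>2 / 4))"
  shows "(\<integral>\<^sup>+x. u x \<partial>std_normal_distribution) * (\<integral>\<^sup>+x. v x \<partial>std_normal_distribution) \<le> 1"
proof (cases "(\<exists>x. u x > 0) \<and> (\<exists>x. v x > 0)")
  case False
  then have "(\<forall>x. u x = 0) \<or> (\<forall>x. v x = 0)" by (metis not_gr_zero)
  then show ?thesis by auto
next
  case True
  then obtain x0 y0 where x0: "u x0 > 0" and y0: "v y0 > 0" by blast
  have u: "u x < \<top>" for x
    using le_less_trans[OF le[of x y0] ennreal_less_top] y0 by (auto simp: ennreal_mult_less_top)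
  have v: "v x < \<top>" for x
    using le_less_trans[OF le[of x0 x] ennreal_less_top] x0 by (auto simp: ennreal_mult_less_top)
  let ?f = "\<lambda>x. enn2real (u x) * std_normal_density x" and ?g = "\<lambda>x. enn2real (v x) * std_normal_density x"
  have "(\<integral>\<^sup>+x. ?f x \<partial>lborel) * (\<integral>\<^sup>+x. ?g x \<partial>lborel) \<le> 1"
  proof (rule std_normal_prekopa_leindler)
    fix x y
    have "enn2real (u x) * enn2real (v y) \<le> exp ((x - y)\<^sup>2 / 4)"
      using le[of x y] enn2real_mono[OF le[of x y]] by (simp add: enn2real_mult)
    then have "?f x * ?g y \<le> exp ((x - y)\<^sup>2 / 4) * (std_normal_density x * std_normal_density y)"
      by (smt (verit, ccfv_threshold) mult.assoc mult.commute mult_right_mono normal_density_nonneg mult_nonneg_nonneg)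
    also have "\<dots> = (std_normal_density ((x + y) / 2))\<^sup>2"
      by (simp add: normal_density_def power2_eq_square exp_add[symmetric] algebra_simps)
         (simp add: field_simps)
    finally show "?f x * ?g y \<le> (std_normal_density ((x + y) / 2))\<^sup>2" .
  qed auto
  moreover have "(\<integral>\<^sup>+x. ?f x \<partial>lborel) = (\<integral>\<^sup>+x. u x \<partial>std_normal_distribution)"
    using u by (subst nn_integral_density) (auto simp: ennreal_mult mult.commute intro!: nn_integral_cong)
  moreover have "(\<integral>\<^sup>+x. ?g x \<partial>lborel) = (\<integral>\<^sup>+x. v x \<partial>std_normal_distribution)"
    using v by (subst nn_integral_density) (auto simp: ennreal_mult mult.commute intro!: nn_integral_cong)
  ultimately show ?thesis by simp
qed

section \<open>Tensorisation of property tau over independent coordinates\<close>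

abbreviation gauss_product :: "'i set \<Rightarrow> ('i \<Rightarrow> real) measure" where
  "gauss_product J \<equiv> PiM J (\<lambda>_. std_normal_distribution)"

lemma product_sigma_finite_std_normal: "product_sigma_finite (\<lambda>_. std_normal_distribution)"
  by (simp add: product_sigma_finite_def prob_space_imp_sigma_finite prob_space_normal_density)

lemma prob_space_gauss_product: "prob_space (gauss_product J)"
  by (intro prob_space_PiM prob_space_normal_density) simp

text \<open>The cost is a sum over coordinates. With all other coordinates frozen, the
  one-dimensional property shows that the partial integrals over coordinate \<open>j\<close> satisfy
  the hypothesis for \<open>J\<close>.\<close>

lemma gauss_product_property_tau:
  fixes u v :: "('i \<Rightarrow> real) \<Rightarrow> ennreal"
  assumes "finite J" "u \<in> borel_measurable (gauss_product J)" "v \<in> borel_measurable (gauss_product J)"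
    and "\<And>x y. x \<in> space (gauss_product J) \<Longrightarrow> y \<in> space (gauss_product J) \<Longrightarrow>
      u x * v y \<le> ennreal (exp ((\<Sum>j\<in>J. (x j - y j)\<^sup>2) / 4))"
  shows "(\<integral>\<^sup>+x. u x \<partial>gauss_product J) * (\<integral>\<^sup>+x. v x \<partial>gauss_product J) \<le> 1"
  using assms
proof (induction J arbitrary: u v rule: finite_induct)
  case empty
  interpret product_sigma_finite "\<lambda>_::'i. std_normal_distribution" by (rule product_sigma_finite_std_normal)
  show ?case using empty.prems(3)[of "\<lambda>_. undefined" "\<lambda>_. undefined"]
    by (simp add: nn_integral_empty space_PiM)
next
  case (insert j J)
  interpret product_sigma_finite "\<lambda>_::'i. std_normal_distribution" by (rule product_sigma_finite_std_normal)
  note [measurable] = insert.prems(1,2)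
  let ?U = "\<lambda>x. \<integral>\<^sup>+t. u (x(j := t)) \<partial>std_normal_distribution"
  let ?V = "\<lambda>x. \<integral>\<^sup>+t. v (x(j := t)) \<partial>std_normal_distribution"
  have "(\<integral>\<^sup>+x. ?U x \<partial>gauss_product J) * (\<integral>\<^sup>+x. ?V x \<partial>gauss_product J) \<le> 1"
  proof (rule insert.IH)
    show "?U \<in> borel_measurable (gauss_product J)" "?V \<in> borel_measurable (gauss_product J)"
      by measurable
    fix x y assume xy: "x \<in> space (gauss_product J)" "y \<in> space (gauss_product J)"
    define c where "c = (\<Sum>j\<in>J. (x j - y j)\<^sup>2) / 4"
    have m: "(\<lambda>t. x(j := t)) \<in> measurable std_normal_distribution (gauss_product (insert j J))"
      "(\<lambda>t. y(j := t)) \<in> measurable std_normal_distribution (gauss_product (insert j J))"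
      using xy by (auto intro!: measurable_fun_upd[where J=J])
    have mu: "(\<lambda>t. u (x(j := t))) \<in> borel_measurable borel"
      using measurable_compose[OF m(1) insert.prems(1)] by (simp add: fun_upd_def)
    have mv: "(\<lambda>t. v (y(j := t))) \<in> borel_measurable borel"
      using measurable_compose[OF m(2) insert.prems(2)] by (simp add: fun_upd_def)
    have "(\<integral>\<^sup>+t. u (x(j := t)) \<partial>std_normal_distribution)
        * (\<integral>\<^sup>+t. v (y(j := t)) * ennreal (exp (- c)) \<partial>std_normal_distribution) \<le> 1"
    proof (rule std_normal_property_tau)
      fix s t
      have sp: "x(j := s) \<in> space (gauss_product (insert j J))" "y(j := t) \<in> space (gauss_product (insert j J))"
        using measurable_space[OF m(1), of s] measurable_space[OF m(2), of t] by auto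
      have "u (x(j := s)) * v (y(j := t)) \<le>
        ennreal (exp ((\<Sum>i\<in>insert j J. ((x(j := s)) i - (y(j := t)) i)\<^sup>2) / 4))"
        by (rule insert.prems(3)[OF sp])
      also have "(\<Sum>i\<in>insert j J. ((x(j := s)) i - (y(j := t)) i)\<^sup>2)
          = (s - t)\<^sup>2 + (\<Sum>i\<in>J. ((x(j := s)) i - (y(j := t)) i)\<^sup>2)"
        using insert.hyps by simp
      also have "(\<Sum>i\<in>J. ((x(j := s)) i - (y(j := t)) i)\<^sup>2) = (\<Sum>i\<in>J. (x i - y i)\<^sup>2)"
        using insert.hyps by (intro sum.cong) auto
      also have "((s - t)\<^sup>2 + (\<Sum>i\<in>J. (x i - y i)\<^sup>2)) / 4 = (s - t)\<^sup>2 / 4 + c"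
        by (simp add: c_def add_divide_distrib)
      finally have "u (x(j := s)) * v (y(j := t)) * ennreal (exp (- c))
          \<le> ennreal (exp ((s - t)\<^sup>2 / 4 + c)) * ennreal (exp (- c))"
        by (rule mult_right_mono) simp
      also have "\<dots> = ennreal (exp ((s - t)\<^sup>2 / 4))"
        by (simp add: ennreal_mult[symmetric] exp_add[symmetric])
      finally show "u (x(j := s)) * (v (y(j := t)) * ennreal (exp (- c))) \<le> ennreal (exp ((s - t)\<^sup>2 / 4))"
        by (simp add: mult.assoc)
    qed (use mu mv in measurable)
    then have "?U x * ?V y * ennreal (exp (- c)) \<le> 1"
      using mv by (subst (asm) nn_integral_multc) (auto simp: mult.assoc)
    then have "?U x * ?V y * ennreal (exp (- c)) * ennreal (exp c) \<le> 1 * ennreal (exp c)"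
      by (rule mult_right_mono) simp
    then show "?U x * ?V y \<le> ennreal (exp ((\<Sum>j\<in>J. (x j - y j)\<^sup>2) / 4))"
      by (simp add: mult.assoc ennreal_mult[symmetric] exp_add[symmetric] c_def)
  qed
  then show ?case
    using insert.hyps by (simp add: product_nn_integral_insert)
qed


section \<open>Exponential moments of Lipschitz functions\<close>

text \<open>Property tau for exp(F - L^2) and exp(-F): the linear growth allowed by the Lipschitz
  bound is dominated by the quadratic cost, as L s <= s^2/4 + L^2.\<close>

lemma gauss_product_exp_Lipschitz:
  fixes F :: "('i \<Rightarrow> real) \<Rightarrow> real"
  assumes J: "finite J" and F[measurable]: "F \<in> borel_measurable (gauss_product J)" and L: "0 \<le> L"
    and lip: "\<And>x y. x \<in> space (gauss_product J) \<Longrightarrow> y \<in> space (gauss_product J) \<Longrightarrow>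
      F x - F y \<le> L * sqrt (\<Sum>j\<in>J. (x j - y j)\<^sup>2)"
  shows "(\<integral>\<^sup>+x. ennreal (exp (F x)) \<partial>gauss_product J) * (\<integral>\<^sup>+x. ennreal (exp (- F x)) \<partial>gauss_product J)
    \<le> ennreal (exp (L\<^sup>2))"
proof -
  have "(\<integral>\<^sup>+x. ennreal (exp (F x)) * ennreal (exp (- L\<^sup>2)) \<partial>gauss_product J)
      * (\<integral>\<^sup>+x. ennreal (exp (- F x)) \<partial>gauss_product J) \<le> 1"
  proof (rule gauss_product_property_tau[OF J])
    fix x y assume xy: "x \<in> space (gauss_product J)" "y \<in> space (gauss_product J)"
    define s where "s = sqrt (\<Sum>j\<in>J. (x j - y j)\<^sup>2)"
    have s2: "s\<^sup>2 = (\<Sum>j\<in>J. (x j - y j)\<^sup>2)" by (simp add: s_def sum_nonneg)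
    have "L * s - L\<^sup>2 \<le> s\<^sup>2 / 4"
      using zero_le_power2[of "s / 2 - L"] by (simp add: power2_eq_square algebra_simps)
    moreover have "F x - F y \<le> L * s" using lip[OF xy] by (simp add: s_def)
    ultimately have "F x + - L\<^sup>2 + - F y \<le> s\<^sup>2 / 4" by linarith
    then show "ennreal (exp (F x)) * ennreal (exp (- L\<^sup>2)) * ennreal (exp (- F y))
      \<le> ennreal (exp ((\<Sum>j\<in>J. (x j - y j)\<^sup>2) / 4))"
      by (simp add: ennreal_mult[symmetric] exp_add[symmetric] s2)
  qed measurable
  then have "(\<integral>\<^sup>+x. ennreal (exp (F x)) \<partial>gauss_product J) * (\<integral>\<^sup>+x. ennreal (exp (- F x)) \<partial>gauss_product J)
      * ennreal (exp (- L\<^sup>2)) * ennreal (exp (L\<^sup>2)) \<le> 1 * ennreal (exp (L\<^sup>2))"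
    by (intro mult_right_mono) (auto simp: nn_integral_multc mult_ac)
  then show ?thesis
    by (simp add: mult.assoc ennreal_mult[symmetric] exp_add[symmetric])
qed

text \<open>Jensen bounds each of the two exponential moments from below by the exponential of plus
  or minus the mean, so the product bound controls the moments of the centred variable of either
  sign. The mean absolute deviation follows from |t| <= exp t + exp (- t).\<close>

lemma (in prob_space) exp_product_bound:
  fixes F :: "'a \<Rightarrow> real"
  assumes F[measurable]: "random_variable borel F" and C: "0 \<le> C"
    and le: "(\<integral>\<^sup>+x. ennreal (exp (F x)) \<partial>M) * (\<integral>\<^sup>+x. ennreal (exp (- F x)) \<partial>M) \<le> ennreal C"
  shows "integrable M F" "integrable M (\<lambda>x. exp (F x))"
    "expectation (\<lambda>x. exp (F x)) \<le> C * exp (expectation F)"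
    "expectation (\<lambda>x. \<bar>F x - expectation F\<bar>) \<le> 2 * C"
proof -
  \<comment> \<open>In \<open>ennreal\<close> the product of 0 and infinity is 0, so a finite
    product gives finite factors only once both are known to be positive.\<close>
  have pos: "(\<integral>\<^sup>+x. ennreal (exp (f x)) \<partial>M) > 0" if [measurable]: "random_variable borel f" for f :: "'a \<Rightarrow> real"
  proof (rule ccontr)
    assume "\<not> ?thesis"
    then have "(\<integral>\<^sup>+x. ennreal (exp (f x)) \<partial>M) = 0" by simp
    then have "AE x in M. ennreal (exp (f x)) = 0" by (subst (asm) nn_integral_0_iff_AE) auto
    then have "AE x in M. False" by (rule AE_mp) (auto simp: ennreal_eq_0_iff not_le)
    then show False by simp
  qed
  have "(\<integral>\<^sup>+x. ennreal (exp (F x)) \<partial>M) * (\<integral>\<^sup>+x. ennreal (exp (- F x)) \<partial>M) < \<top>"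
    using le_less_trans[OF le] by simp
  then have fin: "(\<integral>\<^sup>+x. ennreal (exp (F x)) \<partial>M) < \<top>" "(\<integral>\<^sup>+x. ennreal (exp (- F x)) \<partial>M) < \<top>"
    using pos[of F] pos[of "\<lambda>x. - F x"] by (auto simp: ennreal_mult_less_top)
  show i1: "integrable M (\<lambda>x. exp (F x))"
    using fin by (intro integrableI_nonneg) auto
  have i2: "integrable M (\<lambda>x. exp (- F x))"
    using fin by (intro integrableI_nonneg) auto
  have ab: "\<bar>x\<bar> \<le> exp x + exp (- x)" for x :: real
  proof -
    have "1 + x \<le> exp x" "1 - x \<le> exp (- x)" "0 < exp x" "0 < exp (- x)"
      using exp_ge_add_one_self[of x] exp_ge_add_one_self[of "- x"] by simp_all
    then show ?thesis by linarith
  qed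
  show iF: "integrable M F"
    by (rule Bochner_Integration.integrable_bound[of M "\<lambda>x. exp (F x) + exp (- F x)"])
      (use i1 i2 ab in \<open>auto intro!: AE_I2\<close>)
  define m where "m = expectation F"
  \<comment> \<open>Jensen by integrating the tangent line of exp at the mean.\<close>
  have jensen: "exp (expectation f) \<le> expectation (\<lambda>x. exp (f x))"
    if [simp]: "integrable M f" "integrable M (\<lambda>x. exp (f x))" for f :: "'a \<Rightarrow> real"
  proof -
    have "expectation (\<lambda>x. exp (expectation f) * (1 + (f x - expectation f))) \<le> expectation (\<lambda>x. exp (f x))"
    proof (rule integral_mono)
      fix x
      have "exp (expectation f) * (1 + (f x - expectation f)) \<le> exp (expectation f) * exp (f x - expectation f)"
        by (intro mult_left_mono exp_ge_add_one_self) auto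
      then show "exp (expectation f) * (1 + (f x - expectation f)) \<le> exp (f x)"
        by (simp add: exp_add[symmetric])
    qed auto
    then show ?thesis by (simp add: prob_space)
  qed
  have prod: "expectation (\<lambda>x. exp (F x)) * expectation (\<lambda>x. exp (- F x)) \<le> C"
    using le i1 i2 C by (simp add: nn_integral_eq_integral ennreal_mult[symmetric])
  have e1: "expectation (\<lambda>x. exp (F x)) * exp (- m) \<le> C"
    using jensen[of "\<lambda>x. - F x"] iF i2
    by (intro order_trans[OF mult_left_mono prod]) (auto simp: m_def)
  have e2: "expectation (\<lambda>x. exp (- F x)) * exp m \<le> C"
    using jensen[of F] iF i1
    by (intro order_trans[OF mult_left_mono prod[unfolded mult.commute[of "expectation (\<lambda>x. exp (F x))"]]]) (auto simp: m_def)
  show "expectation (\<lambda>x. exp (F x)) \<le> C * exp (expectation F)"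
    using mult_right_mono[OF e1, of "exp m"] by (simp add: mult.assoc exp_add[symmetric] m_def)
  have "expectation (\<lambda>x. \<bar>F x - m\<bar>) \<le> expectation (\<lambda>x. exp (F x) * exp (- m) + exp (- F x) * exp m)"
  proof (rule integral_mono)
    show "\<bar>F x - m\<bar> \<le> exp (F x) * exp (- m) + exp (- F x) * exp m" for x
      using ab[of "F x - m"] by (simp add: exp_add[symmetric])
  qed (use i1 i2 iF in auto)
  also have "\<dots> \<le> 2 * C" using e1 e2 i1 i2 by simp
  finally show "expectation (\<lambda>x. \<bar>F x - expectation F\<bar>) \<le> 2 * C" by (simp add: m_def)
qed


section \<open>Uniqueness of multivariate characteristic functions\<close>

text \<open>The weight divided by its total mass is a probability density, and Levy uniqueness
  applies to the image of that law under \<open>X\<close>. The two masses agree by the case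
  \<open>s = 0\<close>; a vanishing mass makes both sides 0.\<close>

lemma weighted_char_eq_imp_eq:
  fixes M N :: "'a measure" and X w :: "'a \<Rightarrow> real"
  assumes M: "prob_space M" and N: "prob_space N" and sets: "sets N = sets M"
    and [measurable]: "X \<in> borel_measurable M" "w \<in> borel_measurable M" "B \<in> sets borel"
    and w: "\<And>x. 0 \<le> w x" "\<And>x. w x \<le> K"
    and eq: "\<And>s. (\<integral>x. w x *\<^sub>R cis (s * X x) \<partial>M) = (\<integral>x. w x *\<^sub>R cis (s * X x) \<partial>N)"
  shows "(\<integral>x. w x * indicator B (X x) \<partial>M) = (\<integral>x. w x * indicator B (X x) \<partial>N)"
proof -
  interpret M: prob_space M by fact
  interpret N: prob_space N by fact
  note [measurable_cong] = sets
  define m where "m = (\<integral>x. w x \<partial>M)"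
  have iM: "integrable M w" by (rule M.integrable_const_bound[where B=K]) (use w in auto)
  have iN: "integrable N w" by (rule N.integrable_const_bound[where B=K]) (use w in auto)
  have mN: "m = (\<integral>x. w x \<partial>N)"
  proof -
    have "complex_of_real m = complex_of_real (\<integral>x. w x \<partial>N)"
      using eq[of 0] by (simp add: m_def scaleR_conv_of_real)
    then show ?thesis by simp
  qed
  show ?thesis
  proof (cases "m = 0")
    case True
    have "AE x in M. w x = 0" "AE x in N. w x = 0"
      using True mN integral_nonneg_eq_0_iff_AE[OF iM] integral_nonneg_eq_0_iff_AE[OF iN] w by (auto simp: m_def)
    then have "(\<integral>x. w x * indicator B (X x) \<partial>M) = 0" "(\<integral>x. w x * indicator B (X x) \<partial>N) = 0"
      by (auto intro!: integral_eq_zero_AE)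
    then show ?thesis by simp
  next
    case False
    have m0: "m > 0" using False w Bochner_Integration.integral_nonneg[of M w] by (simp add: m_def less_le)
    define D where "D P = distr (density P (\<lambda>x. ennreal (w x / m))) borel X" for P
    have rd: "real_distribution (D P)" if P: "prob_space P" and s[measurable_cong]: "sets P = sets M" and m: "(\<integral>x. w x \<partial>P) = m" "integrable P w" for P
    proof -
      have "emeasure (density P (\<lambda>x. ennreal (w x / m))) (space (density P (\<lambda>x. ennreal (w x / m))))
          = (\<integral>\<^sup>+x. ennreal (w x / m) \<partial>P)"
        by (simp add: emeasure_density cong: nn_integral_cong)
      also have "\<dots> = ennreal (\<integral>x. w x / m \<partial>P)"
        using m w m0 by (intro nn_integral_eq_integral) auto
      also have "\<dots> = 1" using m m0 by simp
      finally have "prob_space (density P (\<lambda>x. ennreal (w x / m)))" by (rule prob_spaceI)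
      then show ?thesis unfolding D_def real_distribution_def real_distribution_axioms_def
        by (auto intro!: prob_space.prob_space_distr)
    qed
    have ch: "char (D P) s = (\<integral>x. w x *\<^sub>R cis (s * X x) \<partial>P) / m" if s[measurable_cong]: "sets P = sets M" for P s
    proof -
      have "char (D P) s = (\<integral>x. cis (s * X x) \<partial>density P (\<lambda>x. ennreal (w x / m)))"
        unfolding char_def D_def by (subst integral_distr) (auto simp: cis_conv_exp mult_ac)
      also have "\<dots> = (\<integral>x. (w x / m) *\<^sub>R cis (s * X x) \<partial>P)"
        using w m0 by (subst integral_density) (auto simp: cis_conv_exp)
      also have "\<dots> = (\<integral>x. (w x *\<^sub>R cis (s * X x)) / m \<partial>P)"
        by (simp add: scaleR_conv_of_real)
      finally show ?thesis by simp
    qed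
    have me: "measure (D P) B = (\<integral>x. w x * indicator B (X x) \<partial>P) / m" if P: "prob_space P" and s[measurable_cong]: "sets P = sets M" and m: "(\<integral>x. w x \<partial>P) = m" "integrable P w" for P
    proof -
      interpret D: real_distribution "D P" using rd[OF that] .
      have "measure (D P) B = (\<integral>x. indicator B x \<partial>D P)" by simp
      also have "\<dots> = (\<integral>x. indicator B (X x) \<partial>density P (\<lambda>x. ennreal (w x / m)))"
        unfolding D_def by (subst integral_distr) auto
      also have "\<dots> = (\<integral>x. (w x / m) *\<^sub>R indicator B (X x) \<partial>P)"
        using w m0 by (subst integral_density) auto
      also have "\<dots> = (\<integral>x. (w x * indicator B (X x)) / m \<partial>P)" by simp
      finally show ?thesis by simp
    qed
    have "D M = D N"
      by (rule Levy_uniqueness) (use rd[of M] rd[of N] M N sets iM iN mN eq in \<open>auto simp: ch m_def\<close>)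
    then show ?thesis
      using me[of M] me[of N] M N sets iM iN mN m0 by (simp add: m_def[symmetric])
  qed
qed

text \<open>The characters are traded for indicators one coordinate at a time. The nonnegative weights
  \<open>1 + cos \<theta>\<close> and \<open>1 + sin \<theta>\<close> reduce each step to the uniqueness theorem on the real line.\<close>

lemma char_eq_imp_rectangles_eq:
  fixes M N :: "'a measure" and X :: "'i \<Rightarrow> 'a \<Rightarrow> real"
  assumes M: "prob_space M" and N: "prob_space N" and sets: "sets N = sets M"
    and I: "finite I" and X: "\<And>i. i \<in> I \<Longrightarrow> X i \<in> borel_measurable M"
    and eq: "\<And>t. (\<integral>x. cis (\<Sum>i\<in>I. t i * X i x) \<partial>M) = (\<integral>x. cis (\<Sum>i\<in>I. t i * X i x) \<partial>N)"
    and B: "\<And>i. i \<in> I \<Longrightarrow> B i \<in> sets borel"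
  shows "(\<integral>x. (\<Prod>i\<in>I. indicator (B i) (X i x)) \<partial>M) = (\<integral>x. (\<Prod>i\<in>I. indicator (B i) (X i x)) \<partial>N :: real)"
proof -
  interpret M: prob_space M by fact
  interpret N: prob_space N by fact
  note [measurable_cong] = sets
  define W where "W J x = (\<Prod>i\<in>J. indicator (B i) (X i x) :: real)" for J x
  define \<theta> where "\<theta> t x = (\<Sum>i\<in>I. t i * X i x)" for t x
  have W01: "0 \<le> W J x" "W J x \<le> 1" for J x
    unfolding W_def by (auto intro!: prod_nonneg prod_le_1)
  have [measurable]: "\<theta> t \<in> borel_measurable M" for t
    using X unfolding \<theta>_def by measurable
  have mW: "W J \<in> borel_measurable M" if "J \<subseteq> I" for J
  proof -
    have [measurable]: "(\<lambda>x. indicator (B i) (X i x) :: real) \<in> borel_measurable M" if "i \<in> J" for i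
      using X[of i] B[of i] that \<open>J \<subseteq> I\<close> by (intro measurable_compose[OF X borel_measurable_indicator]) auto
    show ?thesis unfolding W_def by measurable
  qed
  \<comment> \<open>The full family of characters, for every \<open>t\<close>, is kept next to the
    indicators already introduced; otherwise the next coordinate would have nothing to work
    with.\<close>
  have main: "\<forall>t. (\<integral>x. W J x *\<^sub>R cis (\<theta> t x) \<partial>M) = (\<integral>x. W J x *\<^sub>R cis (\<theta> t x) \<partial>N)" if "J \<subseteq> I" for J
    using finite_subset[OF that I] that
  proof (induction J rule: finite_induct)
    case empty
    then show ?case using eq by (simp add: W_def \<theta>_def)
  next
    case (insert j J)
    then have j: "j \<in> I" "j \<notin> J" and JI: "J \<subseteq> I" by auto
    note IH = insert.IH[OF JI, rule_format]
    note [measurable] = mW[OF JI] X[OF j(1)] B[OF j(1)]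
    have WS: "W (insert j J) x = W J x * indicator (B j) (X j x)" for x
      using insert.hyps by (simp add: W_def)
    have add: "\<theta> t x + s * X j x = \<theta> (t(j := t j + s)) x" for t x s
    proof -
      have "\<theta> (t(j := t j + s)) x = (\<Sum>i\<in>I. t i * X i x + (if i = j then s * X j x else 0))"
        unfolding \<theta>_def by (intro sum.cong) (auto simp: algebra_simps)
      then show ?thesis using I j by (simp add: sum.distrib \<theta>_def)
    qed
    have th0: "\<theta> (\<lambda>_. 0) x = 0" for x by (simp add: \<theta>_def)
    have neg: "- \<theta> t x = \<theta> (\<lambda>i. - t i) x" for t x by (simp add: \<theta>_def sum_negf)
    have IH': "(\<integral>x. W J x *\<^sub>R cis (\<theta> t x + s * X j x) \<partial>M) = (\<integral>x. W J x *\<^sub>R cis (\<theta> t x + s * X j x) \<partial>N)" for t s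
      using IH by (simp add: add)
    have ci: "integrable P (\<lambda>x. W J x *\<^sub>R cis (f x))" if "prob_space P" "sets P = sets M" "f \<in> borel_measurable M" for P f
    proof -
      interpret P: prob_space P by fact
      note [measurable_cong] = that(2) note [measurable] = that(3)
      show ?thesis by (rule P.integrable_const_bound[where B=1]) (auto simp: W01 cis_conv_exp)
    qed
    have re: "integrable P (\<lambda>x. W J x * f x)" if "prob_space P" "sets P = sets M" "f \<in> borel_measurable M" "\<And>x. \<bar>f x\<bar> \<le> 1" for P f
    proof -
      interpret P: prob_space P by fact
      note [measurable_cong] = that(2) note [measurable] = that(3)
      show ?thesis by (rule P.integrable_const_bound[where B=1]) (auto simp: W01 that abs_mult intro!: mult_le_one)
    qed
    have step: "(\<integral>x. W J x * (1 + f x) * indicator (B j) (X j x) \<partial>M) = (\<integral>x. W J x * (1 + f x) * indicator (B j) (X j x) \<partial>N)"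
      if f: "f = (\<lambda>_. 0) \<or> f = (\<lambda>x. cos (\<theta> t x)) \<or> f = (\<lambda>x. sin (\<theta> t x))" for f t
    proof (rule weighted_char_eq_imp_eq[OF M N sets])
      show "X j \<in> borel_measurable M" "B j \<in> sets borel" by auto
      have [measurable]: "f \<in> borel_measurable M" using f by (elim disjE) simp_all
      have fb: "\<bar>f x\<bar> \<le> 1" for x using f by auto
      show "(\<lambda>x. W J x * (1 + f x)) \<in> borel_measurable M" by measurable
      show "0 \<le> W J x * (1 + f x)" for x using W01 fb[of x] by (auto intro!: mult_nonneg_nonneg)
      show "W J x * (1 + f x) \<le> 1 * 2" for x using W01 fb[of x] by (intro mult_mono) auto
      fix s
      \<comment> \<open>Each weight is a combination of the characters of t and -t and a constant,
        so its transform in the direction \<open>X j\<close> is again covered by the induction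
        hypothesis.\<close>
      obtain a b :: complex where ab: "\<And>x. complex_of_real (f x) = a * cis (\<theta> t x) + b * cis (- \<theta> t x)"
      proof -
        consider "f = (\<lambda>_. 0)" | "f = (\<lambda>x. cos (\<theta> t x))" | "f = (\<lambda>x. sin (\<theta> t x))" using f by blast
        then show ?thesis
        proof cases
          case 1 then show ?thesis using that[of 0 0] by simp
        next
          case 2 then show ?thesis using that[of "1/2" "1/2"] by (simp add: complex_eq_iff)
        next
          case 3 then show ?thesis using that[of "- \<i>/2" "\<i>/2"] by (simp add: complex_eq_iff)
        qed
      qed
      have expand: "(W J x * (1 + f x)) *\<^sub>R cis (s * X j x) = W J x *\<^sub>R cis (s * X j x)
          + a * (W J x *\<^sub>R cis (\<theta> t x + s * X j x)) + b * (W J x *\<^sub>R cis (- \<theta> t x + s * X j x))" for x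
        unfolding cis_mult[symmetric] by (simp add: scaleR_conv_of_real ab algebra_simps)
      have "(\<integral>x. (W J x * (1 + f x)) *\<^sub>R cis (s * X j x) \<partial>P)
          = (\<integral>x. W J x *\<^sub>R cis (\<theta> (\<lambda>_. 0) x + s * X j x) \<partial>P)
          + a * (\<integral>x. W J x *\<^sub>R cis (\<theta> t x + s * X j x) \<partial>P)
          + b * (\<integral>x. W J x *\<^sub>R cis (\<theta> (\<lambda>i. - t i) x + s * X j x) \<partial>P)"
        if "prob_space P" "sets P = sets M" for P
      proof -
        have i: "integrable P (\<lambda>x. W J x *\<^sub>R cis (s * X j x))"
          "integrable P (\<lambda>x. a * (W J x *\<^sub>R cis (\<theta> t x + s * X j x)))"
          "integrable P (\<lambda>x. b * (W J x *\<^sub>R cis (- \<theta> t x + s * X j x)))"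
          by (intro integrable_mult_right ci that; measurable)+
        show ?thesis
          unfolding expand th0 neg[symmetric]
            Bochner_Integration.integral_add[OF Bochner_Integration.integrable_add[OF i(1,2)] i(3)]
            Bochner_Integration.integral_add[OF i(1,2)]
          by (simp only: integral_mult_right_zero add_0)
      qed
      from this[OF M refl] this[OF N sets]
      show "(\<integral>x. (W J x * (1 + f x)) *\<^sub>R cis (s * X j x) \<partial>M) = (\<integral>x. (W J x * (1 + f x)) *\<^sub>R cis (s * X j x) \<partial>N)"
        by (simp add: IH')
    qed
    have dec: "(\<integral>x. W J x * (1 + f x) * indicator (B j) (X j x) \<partial>P)
        = (\<integral>x. W J x * indicator (B j) (X j x) \<partial>P) + (\<integral>x. W J x * (f x * indicator (B j) (X j x)) \<partial>P)"
      if P: "prob_space P" and s[measurable_cong]: "sets P = sets M" and [measurable]: "f \<in> borel_measurable M" and fb: "\<And>x. \<bar>f x\<bar> \<le> 1" for P f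
    proof -
      have "(\<integral>x. W J x * (1 + f x) * indicator (B j) (X j x) \<partial>P)
        = (\<integral>x. W J x * indicator (B j) (X j x) + W J x * (f x * indicator (B j) (X j x)) \<partial>P)"
        by (simp add: algebra_simps)
      also have "\<dots> = (\<integral>x. W J x * indicator (B j) (X j x) \<partial>P) + (\<integral>x. W J x * (f x * indicator (B j) (X j x)) \<partial>P)"
        by (intro Bochner_Integration.integral_add re P s) (auto simp: abs_mult fb indicator_def)
      finally show ?thesis .
    qed
    have base: "(\<integral>x. W J x * indicator (B j) (X j x) \<partial>M) = (\<integral>x. W J x * indicator (B j) (X j x) \<partial>N)"
      using step[of "\<lambda>_. 0"] by simp
    \<comment> \<open>Subtracting the case of weight 1 leaves the cosine and sine parts, which
      reassemble to the character.\<close>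
    have tr: "(\<integral>x. W J x * (f x * indicator (B j) (X j x)) \<partial>M) = (\<integral>x. W J x * (f x * indicator (B j) (X j x)) \<partial>N)"
      if "f = (\<lambda>x. cos (\<theta> t x)) \<or> f = (\<lambda>x. sin (\<theta> t x))" for f t
    proof -
      have "f \<in> borel_measurable M" "\<And>x. \<bar>f x\<bar> \<le> 1" using that by auto
      then show ?thesis using step[of f t] that base dec[OF M refl, of f] dec[OF N sets, of f] by auto
    qed
    have spl: "(\<integral>x. W (insert j J) x *\<^sub>R cis (\<theta> t x) \<partial>P)
        = complex_of_real (\<integral>x. W J x * (cos (\<theta> t x) * indicator (B j) (X j x)) \<partial>P)
          + \<i> * complex_of_real (\<integral>x. W J x * (sin (\<theta> t x) * indicator (B j) (X j x)) \<partial>P)"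
      if P: "prob_space P" and s[measurable_cong]: "sets P = sets M" for P t
    proof -
      have "(\<integral>x. W (insert j J) x *\<^sub>R cis (\<theta> t x) \<partial>P) =
        (\<integral>x. complex_of_real (W J x * (cos (\<theta> t x) * indicator (B j) (X j x)))
          + \<i> * complex_of_real (W J x * (sin (\<theta> t x) * indicator (B j) (X j x))) \<partial>P)"
        by (intro Bochner_Integration.integral_cong) (auto simp: WS complex_eq_iff)
      also have "\<dots> = (\<integral>x. complex_of_real (W J x * (cos (\<theta> t x) * indicator (B j) (X j x))) \<partial>P)
          + (\<integral>x. \<i> * complex_of_real (W J x * (sin (\<theta> t x) * indicator (B j) (X j x))) \<partial>P)"
        by (intro Bochner_Integration.integral_add integrable_mult_right integrable_of_real re P s)
          (auto simp: abs_mult indicator_def)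
      finally show ?thesis by (simp only: integral_mult_right_zero integral_complex_of_real)
    qed
    show ?case by (simp only: spl[OF M refl] spl[OF N sets] tr[OF disjI1[OF refl]] tr[OF disjI2[OF refl]]) simp
  qed
  have "complex_of_real (\<integral>x. W I x \<partial>M) = complex_of_real (\<integral>x. W I x \<partial>N)"
    using main[OF order_refl, rule_format, of "\<lambda>_. 0"] by (simp add: \<theta>_def scaleR_conv_of_real)
  then show ?thesis by (simp add: W_def)
qed


section \<open>Gaussian matrices as linear images of independent normal variables\<close>

lemma psd_cauchy_schwarz:
  fixes S :: "real^'d^'d"
  assumes "psd S"
  shows "(u \<bullet> (S *v v))\<^sup>2 \<le> (u \<bullet> (S *v u)) * (v \<bullet> (S *v v))"
proof -
  have sym: "v \<bullet> (S *v u) = u \<bullet> (S *v v)" for u v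
    using assms unfolding psd_def by (metis dot_lmul_matrix inner_commute transpose_matrix_vector)
  have nn: "0 \<le> w \<bullet> (S *v w)" for w using assms by (auto simp: psd_def)
  define a b c where "a = u \<bullet> (S *v u)" and "b = u \<bullet> (S *v v)" and "c = v \<bullet> (S *v v)"
  \<comment> \<open>The form at \<open>u - t v\<close> is a nonnegative quadratic in
    \<open>t\<close>. It is minimised at \<open>b / c\<close>; for \<open>c = 0\<close> it is
    affine, so \<open>b\<close> must vanish.\<close>
  have q: "0 \<le> a - 2 * t * b + t\<^sup>2 * c" for t
  proof -
    have "0 \<le> (u - t *\<^sub>R v) \<bullet> (S *v (u - t *\<^sub>R v))" by (rule nn)
    also have "\<dots> = a - 2 * t * b + t\<^sup>2 * c"
      by (simp add: a_def b_def c_def sym[of v u] matrix_vector_mult_diff_distrib matrix_vector_mult_scaleR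
          inner_diff_left inner_diff_right power2_eq_square algebra_simps)
    finally show ?thesis .
  qed
  have "c \<ge> 0" using nn by (simp add: c_def)
  show ?thesis
  proof (cases "c = 0")
    case True
    have "b = 0"
    proof (rule ccontr)
      assume "b \<noteq> 0"
      \<comment> \<open>This choice of \<open>t\<close> gives the value \<open>- 1\<close>.\<close>
      then show False using q[of "(a + 1) / (2 * b)"] True by simp
    qed
    then show ?thesis using True by (simp add: b_def[symmetric] c_def[symmetric])
  next
    case False
    then have "c > 0" using \<open>c \<ge> 0\<close> by simp
    then show ?thesis using q[of "b / c"] False
      by (simp add: b_def[symmetric] c_def[symmetric] a_def[symmetric] power2_eq_square field_simps)
  qed
qed

text \<open>Cauchy-Schwarz with \<open>u = S *v v\<close>. It places \<open>v\<close> in the kernel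
  of the reduced form in the factorisation below.\<close>

lemma psd_eq_0_imp:
  fixes S :: "real^'d^'d"
  assumes "psd S" "v \<bullet> (S *v v) = 0" shows "S *v v = 0"
  using psd_cauchy_schwarz[OF assms(1), of "S *v v" v] assms(2) by simp

text \<open>With \<open>a = S v / sqrt (v \<bullet> S v)\<close>, the form \<open>S - a a\<^sup>T\<close> is still positive semidefinite and its
  kernel contains that of \<open>S\<close> and the vector \<open>v\<close>.\<close>

lemma psd_sum_of_squares_aux:
  fixes S :: "real^'d^'d"
  assumes "psd S" "CARD('d) \<le> dim {v. S *v v = 0} + m"
  shows "\<exists>a :: nat \<Rightarrow> real^'d. \<forall>v. v \<bullet> (S *v v) = (\<Sum>k<m. (a k \<bullet> v)\<^sup>2)"
  using assms
\<comment> \<open>Here \<open>m\<close> bounds the codimension of the kernel; each rank-one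
  subtraction adds a direction to the kernel and lowers the bound by one.\<close>
proof (induction m arbitrary: S)
  case 0
  have sub: "subspace {v. S *v v = 0}"
    by (auto simp: subspace_def matrix_vector_right_distrib matrix_vector_mult_scaleR)
  have "dim {v. S *v v = 0} = DIM(real^'d)" using 0 dim_subset_UNIV[of "{v. S *v v = 0}"] by simp
  then have "span {v. S *v v = 0} = UNIV" by (simp only: dim_eq_full)
  then have "{v. S *v v = 0} = UNIV" using sub by (simp add: span_eq_iff[THEN iffD2])
  then have "S *v v = 0" for v by blast
  then show ?case by simp
next
  case (Suc m)
  have sym: "v \<bullet> (S *v u) = u \<bullet> (S *v v)" for u v
    using Suc.prems(1) unfolding psd_def by (metis dot_lmul_matrix inner_commute transpose_matrix_vector)
  show ?case
  proof (cases "\<exists>v. v \<bullet> (S *v v) \<noteq> 0")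
    case False
    then show ?thesis by (intro exI[of _ "\<lambda>_. 0"]) auto
  next
    case True
    then obtain v where "v \<bullet> (S *v v) \<noteq> 0" by blast
    then have v: "v \<bullet> (S *v v) > 0" using Suc.prems(1) by (auto simp: psd_def less_le)
    define q where "q = v \<bullet> (S *v v)"
    define a where "a = (1 / sqrt q) *\<^sub>R (S *v v)"
    define S' where "S' = S - (\<chi> i j. a $ i * a $ j)"
    have q0: "q > 0" using v by (simp add: q_def)
    have S'v: "S' *v w = S *v w - (a \<bullet> w) *\<^sub>R a" for w
      by (simp add: S'_def matrix_vector_mult_def vec_eq_iff inner_vec_def sum_distrib_left
          sum_distrib_right sum_subtractf algebra_simps)
    have aw: "(a \<bullet> w)\<^sup>2 = (w \<bullet> (S *v v))\<^sup>2 / q" for w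
      using q0 by (simp add: a_def power_mult_distrib power_divide inner_commute)
    have form: "w \<bullet> (S' *v w) = w \<bullet> (S *v w) - (a \<bullet> w)\<^sup>2" for w
      by (simp add: S'v inner_diff_right power2_eq_square inner_commute)
    have "psd S'"
      unfolding psd_def
    proof (intro conjI allI)
      show "transpose S' = S'" using Suc.prems(1)
        by (simp add: S'_def psd_def transpose_def vec_eq_iff mult.commute)
      show "0 \<le> w \<bullet> (S' *v w)" for w
        using psd_cauchy_schwarz[OF Suc.prems(1), of w v] q0
        by (simp add: form aw q_def[symmetric] field_simps)
    qed
    have codim: "CARD('d) \<le> dim {v. S' *v v = 0} + m"
    proof -
      have s: "subspace {v. S *v v = 0}"
        by (auto simp: subspace_def matrix_vector_right_distrib matrix_vector_mult_scaleR)
      have sub: "insert v {v. S *v v = 0} \<subseteq> {v. S' *v v = 0}"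
      proof -
        have "S' *v v = 0"
        proof (rule psd_eq_0_imp[OF \<open>psd S'\<close>])
          have "(a \<bullet> v)\<^sup>2 = q" unfolding aw using q0 by (simp add: q_def[symmetric] power2_eq_square)
          then show "v \<bullet> (S' *v v) = 0" by (simp add: form q_def[symmetric])
        qed
        moreover have "S' *v w = 0" if "S *v w = 0" for w
          using that sym[of w v] by (simp add: S'v a_def inner_commute)
        ultimately show ?thesis by auto
      qed
      have "v \<notin> span {v. S *v v = 0}"
      proof -
        have "v \<notin> {v. S *v v = 0}" using v by auto
        then show ?thesis unfolding span_eq_iff[THEN iffD2, OF s] .
      qed
      then have "dim (insert v {v. S *v v = 0}) = Suc (dim {v. S *v v = 0})"
        by (simp add: dim_insert)
      then show ?thesis using dim_subset[OF sub] Suc.prems(2) by linarith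
    qed
    obtain b where b: "\<And>w. w \<bullet> (S' *v w) = (\<Sum>k<m. (b k \<bullet> w)\<^sup>2)"
      using Suc.IH[OF \<open>psd S'\<close> codim] by auto
    show ?thesis
    proof (intro exI[of _ "b(m := a)"] allI)
      fix w
      have "(\<Sum>k<Suc m. ((b(m := a)) k \<bullet> w)\<^sup>2) = (\<Sum>k<m. (b k \<bullet> w)\<^sup>2) + (a \<bullet> w)\<^sup>2"
        unfolding sum.lessThan_Suc by (intro arg_cong2[where f = "(+)"] sum.cong) auto
      then show "w \<bullet> (S *v w) = (\<Sum>k<Suc m. ((b(m := a)) k \<bullet> w)\<^sup>2)"
        using form[of w] b[of w] by simp
    qed
  qed
qed

text \<open>A substitute for the matrix square root: the characteristic function sees the covariance
  only through its quadratic form, so factoring the form is enough.\<close>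

lemma psd_sum_of_squares:
  fixes S :: "real^'d^'d"
  assumes "psd S"
  shows "\<exists>a :: nat \<Rightarrow> real^'d. \<forall>v. v \<bullet> (S *v v) = (\<Sum>k<CARD('d). (a k \<bullet> v)\<^sup>2)"
  using psd_sum_of_squares_aux[OF assms, of "CARD('d)"] by simp

text \<open>If A has the columns \<open>a k\<close>, then S = A A^T and the squared operator norm of
  A is that of S. Concretely, for u = A g, Cauchy-Schwarz bounds |u|^4 by |g|^2 times the form at
  \<open>u\<close>, which is at most c |u|^2; then |u|^2 cancels.\<close>

lemma norm_sum_of_squares_factor:
  fixes S :: "real^'d^'d" and a :: "nat \<Rightarrow> real^'d"
  assumes a: "\<And>v. v \<bullet> (S *v v) = (\<Sum>k<m. (a k \<bullet> v)\<^sup>2)" and c: "opnorm S \<le> c"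
  shows "(norm (\<Sum>k<m. g k *\<^sub>R a k))\<^sup>2 \<le> c * (\<Sum>k<m. (g k)\<^sup>2)"
proof -
  define u where "u = (\<Sum>k<m. g k *\<^sub>R a k)"
  have "(norm u)\<^sup>2 = (\<Sum>k<m. g k * (a k \<bullet> u))"
    by (simp add: power2_norm_eq_inner) (subst (1) u_def, simp add: inner_sum_left)
  then have "((norm u)\<^sup>2)\<^sup>2 \<le> (\<Sum>k<m. (g k)\<^sup>2) * (\<Sum>k<m. (a k \<bullet> u)\<^sup>2)"
    using Cauchy_Schwarz_ineq_sum[of g "\<lambda>k. a k \<bullet> u" "{..<m}"] by simp
  moreover have "(\<Sum>k<m. (a k \<bullet> u)\<^sup>2) \<le> c * (norm u)\<^sup>2"
  proof -
    have "u \<bullet> (S *v u) \<le> norm u * norm (S *v u)" by (rule norm_cauchy_schwarz)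
    also have "\<dots> \<le> norm u * (opnorm S * norm u)" unfolding opnorm_def
      by (intro mult_left_mono onorm matrix_vector_mul_bounded_linear) auto
    also have "\<dots> \<le> norm u * (c * norm u)" using c by (intro mult_left_mono mult_right_mono) auto
    finally show ?thesis by (simp add: a power2_eq_square mult_ac)
  qed
  ultimately have "((norm u)\<^sup>2)\<^sup>2 \<le> (\<Sum>k<m. (g k)\<^sup>2) * (c * (norm u)\<^sup>2)"
    by (meson mult_left_mono order_trans sum_nonneg zero_le_power2)
  then have "(norm u)\<^sup>2 * (norm u)\<^sup>2 \<le> (c * (\<Sum>k<m. (g k)\<^sup>2)) * (norm u)\<^sup>2"
    unfolding power2_eq_square[of "(norm u)\<^sup>2"] by (simp only: mult_ac)
  moreover have "c \<ge> 0" using c onorm_pos_le[OF matrix_vector_mul_bounded_linear, of S] by (simp add: opnorm_def)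
  ultimately show ?thesis
    using mult_right_le_imp_le[of "(norm u)\<^sup>2" "(norm u)\<^sup>2" "c * (\<Sum>k<m. (g k)\<^sup>2)"]
    by (cases "u = 0") (auto simp: u_def[symmetric] sum_nonneg)
qed


text \<open>Rows are vectors, whereas the rectangle lemma speaks of scalar coordinates. The
  flattening \<open>\<Phi>\<close> reads off the n d entries, where rectangles generate the
  sigma-algebra, and \<open>\<Psi>\<close> inverts it on extensional matrices and carries the
  equality back.\<close>

lemma mat_space_char_unique:
  fixes M N :: "(nat \<Rightarrow> real^'d) measure"
  assumes M: "prob_space M" and N: "prob_space N"
    and sM: "sets M = sets (mat_space n)" and sN: "sets N = sets (mat_space n)"
    and eq: "\<And>T. (\<integral>X. cis (\<Sum>i<n. T i \<bullet> X i) \<partial>M) = (\<integral>X. cis (\<Sum>i<n. T i \<bullet> X i) \<partial>N)"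
  shows "M = N"
proof -
  let ?I = "{..<n} \<times> (UNIV :: 'd set)"
  let ?P = "PiM ?I (\<lambda>_. borel :: real measure)"
  define \<Phi> :: "(nat \<Rightarrow> real^'d) \<Rightarrow> nat \<times> 'd \<Rightarrow> real" where "\<Phi> = (\<lambda>X. \<lambda>p\<in>?I. X (fst p) $ snd p)"
  define \<Psi> :: "(nat \<times> 'd \<Rightarrow> real) \<Rightarrow> nat \<Rightarrow> real^'d" where "\<Psi> = (\<lambda>y. \<lambda>i\<in>{..<n}. \<chi> k. y (i, k))"
  have comp: "(\<lambda>X. X (fst p) $ snd p) \<in> borel_measurable (mat_space n)" if "p \<in> ?I" for p
  proof -
    have "(\<lambda>X. X (fst p) :: real^'d) \<in> borel_measurable (mat_space n)"
      unfolding mat_space_def using that by (intro measurable_component_singleton) auto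
    moreover have "(\<lambda>v. v $ snd p :: real) \<in> borel_measurable borel"
      by (intro borel_measurable_continuous_onI continuous_intros)
    ultimately show ?thesis by (rule measurable_compose)
  qed
  have \<Phi>: "\<Phi> \<in> measurable (mat_space n) ?P"
    unfolding \<Phi>_def by (intro measurable_restrict comp) auto
  have \<Psi>: "\<Psi> \<in> measurable ?P (mat_space n)"
    unfolding \<Psi>_def mat_space_def
  proof (intro measurable_restrict)
    fix i assume "i \<in> {..<n}"
    then have "(\<lambda>y. y (i, k)) \<in> borel_measurable ?P" for k :: 'd
      by (intro measurable_component_singleton) auto
    then show "(\<lambda>y. \<chi> k. y (i, k)) \<in> borel_measurable ?P"
      by (subst borel_measurable_euclidean_space) (auto simp: Basis_vec_def inner_axis)
  qed
  have inv: "\<Psi> (\<Phi> X) = X" if "X \<in> space (mat_space n)" for X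
    using that by (auto simp: \<Psi>_def \<Phi>_def mat_space_def space_PiM fun_eq_iff vec_eq_iff PiE_def extensional_def)
  have "distr M ?P \<Phi> = distr N ?P \<Phi>"
  proof (rule measure_eqI_PiM_finite[of ?I])
    fix A :: "nat \<times> 'd \<Rightarrow> real set" assume A: "\<And>i. i \<in> ?I \<Longrightarrow> A i \<in> sets borel"
    have em: "emeasure (distr Q ?P \<Phi>) (PiE ?I A) = ennreal (\<integral>X. (\<Prod>p\<in>?I. indicator (A p) (X (fst p) $ snd p)) \<partial>Q)"
      if Q: "prob_space Q" "sets Q = sets (mat_space n)" for Q
    proof -
      interpret Q: prob_space Q by fact
      have sp: "space Q = space (mat_space n)" using Q(2) by (rule sets_eq_imp_space_eq)
      have m: "\<Phi> \<in> measurable Q ?P" using \<Phi> by (simp add: measurable_cong_sets[OF Q(2)])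
      have A': "PiE ?I A \<in> sets ?P" using A by (intro sets_PiM_I_finite) auto
      have "emeasure (distr Q ?P \<Phi>) (PiE ?I A) = emeasure Q (\<Phi> -` PiE ?I A \<inter> space Q)"
        by (rule emeasure_distr[OF m A'])
      also have "\<dots> = ennreal (\<integral>X. indicator (\<Phi> -` PiE ?I A \<inter> space Q) X \<partial>Q)"
        using measurable_sets[OF m A'] by (simp add: Q.emeasure_eq_measure)
      also have "(\<integral>X. indicator (\<Phi> -` PiE ?I A \<inter> space Q) X \<partial>Q) = (\<integral>X. (\<Prod>p\<in>?I. indicator (A p) (X (fst p) $ snd p)) \<partial>Q :: real)"
      proof (rule Bochner_Integration.integral_cong[OF refl])
        fix X assume X: "X \<in> space Q"
        have "(\<Prod>p\<in>?I. indicator (A p) (X (fst p) $ snd p) :: real) = (if \<forall>p\<in>?I. X (fst p) $ snd p \<in> A p then 1 else 0)"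
          by (auto simp: indicator_def intro!: prod_zero prod.neutral)
        also have "\<dots> = indicator (\<Phi> -` PiE ?I A \<inter> space Q) X"
          using X by (auto simp: \<Phi>_def indicator_def PiE_iff)
        finally show "indicator (\<Phi> -` PiE ?I A \<inter> space Q) X = (\<Prod>p\<in>?I. indicator (A p) (X (fst p) $ snd p) :: real)" ..
      qed
      finally show ?thesis .
    qed
    have "(\<integral>X. (\<Prod>p\<in>?I. indicator (A p) (X (fst p) $ snd p)) \<partial>M :: real) = (\<integral>X. (\<Prod>p\<in>?I. indicator (A p) (X (fst p) $ snd p)) \<partial>N)"
    proof (rule char_eq_imp_rectangles_eq[OF M N])
      show "sets N = sets M" using sM sN by simp
      show "(\<lambda>X. X (fst p) $ snd p) \<in> borel_measurable M" if "p \<in> ?I" for p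
        using comp[OF that] by (simp add: measurable_cong_sets[OF sM])
      fix t :: "nat \<times> 'd \<Rightarrow> real"
      have "(\<Sum>p\<in>?I. t p * X (fst p) $ snd p) = (\<Sum>i<n. (\<chi> k. t (i, k)) \<bullet> X i)" for X :: "nat \<Rightarrow> real^'d"
        by (simp add: sum.cartesian_product[symmetric] inner_vec_def case_prod_beta')
          (subst sum.cartesian_product, auto intro!: sum.cong)
      then show "(\<integral>X. cis (\<Sum>p\<in>?I. t p * X (fst p) $ snd p) \<partial>M) = (\<integral>X. cis (\<Sum>p\<in>?I. t p * X (fst p) $ snd p) \<partial>N)"
        using eq[of "\<lambda>i. \<chi> k. t (i, k)"] by simp
    qed (use A in auto)
    then show "emeasure (distr M ?P \<Phi>) (PiE ?I A) = emeasure (distr N ?P \<Phi>) (PiE ?I A)"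
      using em[OF M sM] em[OF N sN] by simp
  next
    interpret M: prob_space M by fact
    interpret D: prob_space "distr M ?P \<Phi>"
      using \<Phi> by (intro M.prob_space_distr) (simp add: measurable_cong_sets[OF sM])
    show "range (\<lambda>_::nat. space ?P) \<subseteq> prod_algebra ?I (\<lambda>_. borel)"
      using space_in_prod_algebra[of ?I "\<lambda>_. borel :: real measure"] by (auto simp: space_PiM)
    show "emeasure (distr M ?P \<Phi>) (space ?P) \<noteq> \<infinity>"
      using D.emeasure_finite[of "space ?P"] unfolding infinity_ennreal_def .
  qed auto
  moreover have "distr (distr Q ?P \<Phi>) (mat_space n) \<Psi> = Q" if "sets Q = sets (mat_space n)" for Q
  proof -
    have m: "\<Phi> \<in> measurable Q ?P" using \<Phi> by (simp add: measurable_cong_sets[OF that])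
    have "distr (distr Q ?P \<Phi>) (mat_space n) \<Psi> = distr Q (mat_space n) (\<lambda>X. \<Psi> (\<Phi> X))"
      using \<Psi> m by (subst distr_distr) (auto simp: comp_def)
    also have "\<dots> = distr Q Q (\<lambda>X. X)"
      using that sets_eq_imp_space_eq[OF that] by (intro distr_cong) (auto simp: inv)
    finally show ?thesis by (simp add: distr_id2)
  qed
  ultimately show ?thesis using sM sN by metis
qed

text \<open>The matrix product G A, where \<open>g\<close> lists the entries of the n x m matrix G
  and the vectors \<open>a k\<close> are the rows of A.\<close>

definition lin_rows :: "nat \<Rightarrow> nat \<Rightarrow> (nat \<Rightarrow> real^'d) \<Rightarrow> (nat \<times> nat \<Rightarrow> real) \<Rightarrow> nat \<Rightarrow> real^'d" where
  "lin_rows n m a g = (\<lambda>i\<in>{..<n}. \<Sum>k<m. g (i, k) *\<^sub>R a k)"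

lemma measurable_lin_rows:
  "lin_rows n m a \<in> measurable (gauss_product ({..<n} \<times> {..<m})) (mat_space n)"
  unfolding lin_rows_def mat_space_def
proof (intro measurable_restrict borel_measurable_sum borel_measurable_scaleR borel_measurable_const)
  fix i k assume "i \<in> {..<n}" "k \<in> {..<m}"
  then have "(\<lambda>g. g (i, k)) \<in> measurable (gauss_product ({..<n} \<times> {..<m})) std_normal_distribution"
    by (intro measurable_component_singleton) auto
  then show "(\<lambda>g. g (i, k)) \<in> borel_measurable (gauss_product ({..<n} \<times> {..<m}))"
    by (simp add: measurable_cong_sets[OF refl, of std_normal_distribution borel])
qed

text \<open>Independence factors the characteristic function of the image into one-dimensional
  normal ones, whose exponents add up to the quadratic form of \<open>S\<close>. This gives the law,
  possibly without density, a concrete source of independent normals to which concentration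
  applies.\<close>

lemma gauss_matrix_eq_distr:
  fixes S :: "real^'d^'d"
  assumes \<nu>: "gauss_matrix n S \<nu>" and a: "\<And>v. v \<bullet> (S *v v) = (\<Sum>k<m. (a k \<bullet> v)\<^sup>2)"
  shows "\<nu> = distr (gauss_product ({..<n} \<times> {..<m})) (mat_space n) (lin_rows n m a)"
proof (rule mat_space_char_unique)
  let ?J = "{..<n} \<times> {..<m}"
  interpret G: prob_space "gauss_product ?J" by (rule prob_space_gauss_product)
  interpret product_sigma_finite "\<lambda>_::nat \<times> nat. std_normal_distribution" by (rule product_sigma_finite_std_normal)
  interpret N: real_distribution std_normal_distribution by (rule real_dist_normal_dist)
  show "prob_space \<nu>" "sets \<nu> = sets (mat_space n)" using \<nu> by (auto simp: gauss_matrix_def)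
  show "prob_space (distr (gauss_product ?J) (mat_space n) (lin_rows n m a))"
    by (rule G.prob_space_distr[OF measurable_lin_rows])
  fix T :: "nat \<Rightarrow> real^'d"
  have "(\<lambda>X. T i \<bullet> X i) \<in> borel_measurable (mat_space n)" if "i < n" for i
    using that unfolding mat_space_def by (intro borel_measurable_inner measurable_component_singleton) auto
  then have m: "(\<lambda>X. \<Sum>i<n. T i \<bullet> X i) \<in> borel_measurable (mat_space n)"
    by (intro borel_measurable_sum) auto
  have cm: "cis \<in> borel_measurable borel"
    by (intro borel_measurable_continuous_onI continuous_intros)
  have "(\<integral>X. cis (\<Sum>i<n. T i \<bullet> X i) \<partial>distr (gauss_product ?J) (mat_space n) (lin_rows n m a))
      = (\<integral>g. cis (\<Sum>i<n. T i \<bullet> lin_rows n m a g i) \<partial>gauss_product ?J)"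
    by (rule integral_distr[OF measurable_lin_rows measurable_compose[OF m cm]])
  also have "\<dots> = (\<integral>g. (\<Prod>p\<in>?J. iexp ((T (fst p) \<bullet> a (snd p)) * g p)) \<partial>gauss_product ?J)"
  proof (rule Bochner_Integration.integral_cong[OF refl])
    fix g :: "nat \<times> nat \<Rightarrow> real"
    have "(\<Sum>i<n. T i \<bullet> lin_rows n m a g i) = (\<Sum>i<n. \<Sum>k<m. g (i, k) * (T i \<bullet> a k))"
      by (simp add: lin_rows_def inner_sum_right)
    also have "\<dots> = (\<Sum>p\<in>?J. (T (fst p) \<bullet> a (snd p)) * g p)"
      by (simp add: sum.cartesian_product case_prod_beta mult.commute)
    finally show "cis (\<Sum>i<n. T i \<bullet> lin_rows n m a g i) = (\<Prod>p\<in>?J. iexp ((T (fst p) \<bullet> a (snd p)) * g p))"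
      by (simp add: cis_conv_exp exp_sum[symmetric] sum_distrib_left)
  qed
  also have "\<dots> = (\<Prod>p\<in>?J. char std_normal_distribution (T (fst p) \<bullet> a (snd p)))"
    unfolding char_def
    by (rule product_integral_prod) (auto intro!: N.integrable_iexp)
  also have "\<dots> = complex_of_real (\<Prod>p\<in>?J. exp (- ((T (fst p) \<bullet> a (snd p))\<^sup>2) / 2))"
    by (simp add: char_std_normal_distribution del: of_real_exp)
  also have "(\<Prod>p\<in>?J. exp (- ((T (fst p) \<bullet> a (snd p))\<^sup>2) / 2)) = exp (\<Sum>p\<in>?J. - ((T (fst p) \<bullet> a (snd p))\<^sup>2) / 2)"
    by (simp add: exp_sum)
  also have "(\<Sum>p\<in>?J. - ((T (fst p) \<bullet> a (snd p))\<^sup>2) / 2) = - (1/2) * (\<Sum>p\<in>?J. (T (fst p) \<bullet> a (snd p))\<^sup>2)"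
    by (simp add: sum_distrib_left sum_negf sum_divide_distrib)
  also have "(\<Sum>p\<in>?J. (T (fst p) \<bullet> a (snd p))\<^sup>2) = (\<Sum>i<n. T i \<bullet> (S *v T i))"
    by (simp add: a sum.cartesian_product case_prod_beta inner_commute)
  finally show "(\<integral>X. cis (\<Sum>i<n. T i \<bullet> X i) \<partial>\<nu>)
     = (\<integral>X. cis (\<Sum>i<n. T i \<bullet> X i) \<partial>distr (gauss_product ?J) (mat_space n) (lin_rows n m a))"
    using \<nu> by (simp add: gauss_matrix_def)
qed simp


section \<open>The Frobenius norm\<close>

lemma frob_eq_L2_set: "frob n X = L2_set (\<lambda>i. norm (X i)) {..<n}"
  by (simp add: frob_def L2_set_def)

lemma frob_nonneg [simp]: "0 \<le> frob n X"
  by (simp add: frob_def sum_nonneg)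

lemma frob_minus_commute: "frob n (X - Y) = frob n (Y - X)"
  by (simp add: frob_def norm_minus_commute)

lemma frob_triangle: "frob n (X - Z) \<le> frob n (X - Y) + frob n (Y - Z)"
proof -
  have "frob n (X - Z) \<le> L2_set (\<lambda>i. norm ((X - Y) i) + norm ((Y - Z) i)) {..<n}"
    unfolding frob_eq_L2_set
  proof (rule L2_set_mono)
    show "norm ((X - Z) i) \<le> norm ((X - Y) i) + norm ((Y - Z) i)" for i
      using norm_triangle_ineq[of "(X - Y) i" "(Y - Z) i"] by simp
  qed simp
  also have "\<dots> \<le> frob n (X - Y) + frob n (Y - Z)"
    unfolding frob_eq_L2_set by (rule L2_set_triangle_ineq)
  finally show ?thesis .
qed

lemma frob_le_add_diff: "frob n X \<le> frob n Y + frob n (X - Y)"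
proof -
  have "frob n X = frob n (X - (\<lambda>_. 0))" "frob n Y = frob n (Y - (\<lambda>_. 0))" by (simp_all add: frob_def)
  then show ?thesis using frob_triangle[of n X "\<lambda>_. 0" Y] by linarith
qed

section \<open>Measurability of functions of a matrix\<close>

lemma measurable_mat_component: "i < n \<Longrightarrow> (\<lambda>X. X i) \<in> measurable (mat_space n) borel"
  unfolding mat_space_def by (intro measurable_component_singleton) auto

lemma measurable_frob_diff:
  assumes f: "f \<in> measurable M (mat_space n)" and g: "g \<in> measurable M (mat_space n)"
  shows "(\<lambda>x. frob n (f x - g x)) \<in> borel_measurable M"
proof -
  have "(\<lambda>x. f x i - g x i) \<in> borel_measurable M" if "i < n" for i
    using measurable_compose[OF f measurable_mat_component[OF that]]
      measurable_compose[OF g measurable_mat_component[OF that]] by simp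
  then show ?thesis unfolding frob_def minus_apply
    by (intro measurable_compose[OF _ borel_measurable_sqrt] borel_measurable_sum borel_measurable_power borel_measurable_norm) auto
qed

lemma measurable_frob: "frob n \<in> borel_measurable (mat_space n)"
  unfolding frob_def[abs_def]
  by (intro measurable_compose[OF _ borel_measurable_sqrt] borel_measurable_sum borel_measurable_power
      measurable_compose[OF measurable_mat_component borel_measurable_norm]) auto

text \<open>The product topology lives on all functions, the sigma-algebra \<open>mat_space\<close>
  on extensional ones. Composing \<open>f\<close> with restriction gives a continuous, hence Borel,
  function on the whole function space, and extension by zero is a measurable way to get there from
  \<open>mat_space\<close>.\<close>

lemma measurable_mat_space_continuous:
  fixes f :: "(nat \<Rightarrow> real^'d) \<Rightarrow> real"
  assumes cont: "\<And>X \<epsilon>. X \<in> space (mat_space n) \<Longrightarrow> \<epsilon> > 0 \<Longrightarrow>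
    \<exists>\<delta>>0. \<forall>Y\<in>space (mat_space n). frob n (Y - X) < \<delta> \<longrightarrow> \<bar>f Y - f X\<bar> < \<epsilon>"
  shows "f \<in> borel_measurable (mat_space n)"
proof -
  define g where "g X = f (restrict X {..<n})" for X
  have rs: "restrict X {..<n} \<in> space (mat_space n)" for X :: "nat \<Rightarrow> real^'d"
    by (auto simp: mat_space_def space_PiM)
  have fr: "frob n (restrict X {..<n} - restrict Y {..<n}) = frob n (X - Y)" for X Y :: "nat \<Rightarrow> real^'d"
    by (simp add: frob_def)
  have "continuous_on UNIV g"
    unfolding continuous_on
  proof
    fix X0 :: "nat \<Rightarrow> real^'d"
    have "((\<lambda>X. X i) \<longlongrightarrow> X0 i) (at X0)" for i
    proof -
      have "continuous_on UNIV (\<lambda>X :: nat \<Rightarrow> real^'d. X i)" by (rule continuous_on_product_coordinates)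
      then show ?thesis by (simp add: continuous_on)
    qed
    then have "((\<lambda>X. frob n (X - X0)) \<longlongrightarrow> sqrt (\<Sum>i<n. (norm (X0 i - X0 i))\<^sup>2)) (at X0)"
      unfolding frob_def minus_apply by (intro tendsto_intros)
    then have lim: "((\<lambda>X. frob n (X - X0)) \<longlongrightarrow> 0) (at X0)" by simp
    show "(g \<longlongrightarrow> g X0) (at X0)"
    proof (rule tendstoI)
      fix \<epsilon> :: real assume "\<epsilon> > 0"
      then obtain \<delta> where \<delta>: "\<delta> > 0" "\<And>Y. Y \<in> space (mat_space n) \<Longrightarrow> frob n (Y - restrict X0 {..<n}) < \<delta>
          \<Longrightarrow> \<bar>f Y - f (restrict X0 {..<n})\<bar> < \<epsilon>"
        using cont[OF rs, of \<epsilon> X0] by blast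
      have "eventually (\<lambda>X. frob n (X - X0) < \<delta>) (at X0)"
        using order_tendstoD(2)[OF lim \<delta>(1)] .
      then show "eventually (\<lambda>X. dist (g X) (g X0) < \<epsilon>) (at X0)"
        by eventually_elim (auto simp: g_def dist_real_def fr intro!: \<delta>(2) rs)
    qed
  qed
  then have g: "g \<in> borel_measurable (PiM UNIV (\<lambda>_. borel))"
    using borel_measurable_continuous_onI by (simp add: measurable_cong_sets[OF sets_PiM_equal_borel refl])
  define e :: "(nat \<Rightarrow> real^'d) \<Rightarrow> nat \<Rightarrow> real^'d" where "e X = (\<lambda>i. if i < n then X i else 0)" for X
  have "e \<in> measurable (mat_space n) (PiM UNIV (\<lambda>_. borel))"
  proof (rule measurable_PiM_single')
    show "(\<lambda>X. e X i) \<in> borel_measurable (mat_space n)" for i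
      by (cases "i < n") (auto simp: e_def intro!: measurable_mat_component)
  qed auto
  from measurable_compose[OF this g] have "(\<lambda>X. g (e X)) \<in> borel_measurable (mat_space n)" .
  moreover have "g (e X) = f X" if "X \<in> space (mat_space n)" for X
  proof -
    have "restrict (e X) {..<n} = X"
      using that by (auto simp: e_def mat_space_def space_PiM fun_eq_iff PiE_def extensional_def)
    then show ?thesis by (simp add: g_def)
  qed
  ultimately show ?thesis by (simp cong: measurable_cong)
qed

definition nfrob :: "nat \<Rightarrow> (nat \<Rightarrow> real^'d) \<Rightarrow> real" where
  "nfrob n X = frob n X / sqrt n"

lemma nfrob_nonneg [simp]: "0 \<le> nfrob n X"
  by (simp add: nfrob_def)

lemma nfrob_minus_commute: "nfrob n (X - Y) = nfrob n (Y - X)"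
  by (simp add: nfrob_def frob_minus_commute)

lemma nfrob_triangle: "nfrob n (X - Z) \<le> nfrob n (X - Y) + nfrob n (Y - Z)"
  unfolding nfrob_def add_divide_distrib[symmetric] by (intro divide_right_mono frob_triangle) simp

lemma nfrob_le_add_diff: "nfrob n X \<le> nfrob n Y + nfrob n (X - Y)"
  unfolding nfrob_def add_divide_distrib[symmetric] by (intro divide_right_mono frob_le_add_diff) simp

lemma abs_nfrob_diff_le: "\<bar>nfrob n X - nfrob n Y\<bar> \<le> nfrob n (X - Y)"
  using nfrob_le_add_diff[of n X Y] nfrob_le_add_diff[of n Y X] by (simp add: nfrob_minus_commute[of n Y X])

lemma measurable_nfrob_diff:
  "f \<in> measurable M (mat_space n) \<Longrightarrow> g \<in> measurable M (mat_space n) \<Longrightarrow> (\<lambda>x. nfrob n (f x - g x)) \<in> borel_measurable M"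
  unfolding nfrob_def by (intro borel_measurable_divide measurable_frob_diff) auto

lemma measurable_nfrob: "nfrob n \<in> borel_measurable (mat_space n)"
  unfolding nfrob_def[abs_def] by (intro borel_measurable_divide measurable_frob) auto

text \<open>A pseudo-Lipschitz function is locally Lipschitz, hence continuous; so test functions
  are measurable without further assumption.\<close>

lemma measurable_pseudo_Lipschitz:
  fixes f :: "(nat \<Rightarrow> real^'d) \<Rightarrow> real"
  assumes "n > 0" and K: "0 \<le> K"
    and lip: "\<And>X Y. X \<in> space (mat_space n) \<Longrightarrow> Y \<in> space (mat_space n) \<Longrightarrow>
      \<bar>f X - f Y\<bar> \<le> nfrob n (X - Y) * (K + nfrob n X ^ k + nfrob n Y ^ k)"
  shows "f \<in> borel_measurable (mat_space n)"
proof (rule measurable_mat_space_continuous)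
  fix X :: "nat \<Rightarrow> real^'d" and \<epsilon> :: real assume X: "X \<in> space (mat_space n)" and \<epsilon>: "\<epsilon> > 0"
  \<comment> \<open>Bounds the growth factor for all \<open>Y\<close> within
    \<open>nfrob\<close>-distance 1 of \<open>X\<close>; the last summand keeps it positive.\<close>
  define B where "B = K + (nfrob n X + 1) ^ k + nfrob n X ^ k + 1"
  have B: "B > 0" using K by (simp add: B_def add_nonneg_pos)
  have sn: "sqrt n > 0" using \<open>n > 0\<close> by simp
  show "\<exists>\<delta>>0. \<forall>Y\<in>space (mat_space n). frob n (Y - X) < \<delta> \<longrightarrow> \<bar>f Y - f X\<bar> < \<epsilon>"
  proof (intro exI[of _ "sqrt n * min 1 (\<epsilon> / B)"] conjI ballI impI)
    show "0 < sqrt n * min 1 (\<epsilon> / B)" using sn \<epsilon> B by auto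
    fix Y assume Y: "Y \<in> space (mat_space n)" and "frob n (Y - X) < sqrt n * min 1 (\<epsilon> / B)"
    then have "nfrob n (Y - X) < min 1 (\<epsilon> / B)"
      unfolding nfrob_def using sn by (simp only: divide_less_eq mult.commute if_True)
    then have le: "nfrob n (Y - X) \<le> 1" "nfrob n (Y - X) < \<epsilon> / B" by auto
    have "nfrob n Y \<le> nfrob n X + 1" using nfrob_le_add_diff[of n Y X] le by simp
    then have "nfrob n Y ^ k \<le> (nfrob n X + 1) ^ k" by (intro power_mono) auto
    then have "\<bar>f Y - f X\<bar> \<le> nfrob n (Y - X) * B"
      by (intro order_trans[OF lip[OF Y X]] mult_left_mono) (auto simp: B_def)
    also have "\<dots> < \<epsilon>" using le B by (simp add: field_simps)
    finally show "\<bar>f Y - f X\<bar> < \<epsilon>" .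
  qed
qed


section \<open>Concentration of pseudo-Lipschitz functions of Gaussian matrices\<close>

text \<open>Pulled back along \<open>lin_rows\<close>, which is sqrt c-Lipschitz row by row and
  hence for the Frobenius norm whatever \<open>n\<close> is, \<open>f\<close> has Lipschitz constant
  \<open>L * sqrt c\<close> on independent normals.\<close>

lemma gauss_matrix_exp_Lipschitz:
  fixes S :: "real^'d^'d"
  assumes \<nu>: "gauss_matrix n S \<nu>" and S: "psd S" "opnorm S \<le> c"
    and f: "f \<in> borel_measurable (mat_space n)" and L: "0 \<le> L"
    and lip: "\<And>X Y. X \<in> space (mat_space n) \<Longrightarrow> Y \<in> space (mat_space n) \<Longrightarrow> \<bar>f X - f Y\<bar> \<le> L * frob n (X - Y)"
  shows "(\<integral>\<^sup>+X. ennreal (exp (f X)) \<partial>\<nu>) * (\<integral>\<^sup>+X. ennreal (exp (- f X)) \<partial>\<nu>) \<le> ennreal (exp (c * L\<^sup>2))"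
proof -
  let ?d = "CARD('d)"
  let ?J = "{..<n} \<times> {..<?d}"
  obtain a :: "nat \<Rightarrow> real^'d" where "\<forall>v. v \<bullet> (S *v v) = (\<Sum>k<?d. (a k \<bullet> v)\<^sup>2)"
    using psd_sum_of_squares[OF S(1)] ..
  note a = this[rule_format]
  note m = measurable_lin_rows[of n ?d a]
  have c0: "c \<ge> 0" using S(2) onorm_pos_le[OF matrix_vector_mul_bounded_linear, of S] by (simp add: opnorm_def)
  have d: "(\<integral>\<^sup>+X. g X \<partial>\<nu>) = (\<integral>\<^sup>+x. g (lin_rows n ?d a x) \<partial>gauss_product ?J)" if "g \<in> borel_measurable (mat_space n)" for g
    using gauss_matrix_eq_distr[OF \<nu> a] nn_integral_distr[OF m, of g] that by simp
  have fm: "(\<lambda>x. f (lin_rows n ?d a x)) \<in> borel_measurable (gauss_product ?J)"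
    by (rule measurable_compose[OF m f])
  have "(\<integral>\<^sup>+x. ennreal (exp (f (lin_rows n ?d a x))) \<partial>gauss_product ?J)
    * (\<integral>\<^sup>+x. ennreal (exp (- f (lin_rows n ?d a x))) \<partial>gauss_product ?J) \<le> ennreal (exp ((L * sqrt c)\<^sup>2))"
  proof (rule gauss_product_exp_Lipschitz[OF _ fm])
    fix x y assume xy: "x \<in> space (gauss_product ?J)" "y \<in> space (gauss_product ?J)"
    have "f (lin_rows n ?d a x) - f (lin_rows n ?d a y) \<le> L * frob n (lin_rows n ?d a x - lin_rows n ?d a y)"
      using lip[OF measurable_space[OF m xy(1)] measurable_space[OF m xy(2)]] by simp
    also have "frob n (lin_rows n ?d a x - lin_rows n ?d a y) \<le> sqrt (c * (\<Sum>j\<in>?J. (x j - y j)\<^sup>2))"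
    proof -
      have "(norm ((lin_rows n ?d a x - lin_rows n ?d a y) i))\<^sup>2 \<le> c * (\<Sum>k<?d. (x (i, k) - y (i, k))\<^sup>2)" if "i < n" for i
        using norm_sum_of_squares_factor[OF a S(2), of "\<lambda>k. x (i, k) - y (i, k)"] that
        by (simp add: lin_rows_def sum_subtractf scaleR_left_diff_distrib)
      then have "(\<Sum>i<n. (norm ((lin_rows n ?d a x - lin_rows n ?d a y) i))\<^sup>2) \<le> (\<Sum>i<n. c * (\<Sum>k<?d. (x (i, k) - y (i, k))\<^sup>2))"
        by (intro sum_mono) auto
      also have "\<dots> = c * (\<Sum>j\<in>?J. (x j - y j)\<^sup>2)"
        by (simp add: sum_distrib_left[symmetric] sum.cartesian_product case_prod_beta)
      finally show ?thesis unfolding frob_def by (rule real_sqrt_le_mono)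
    qed
    finally show "f (lin_rows n ?d a x) - f (lin_rows n ?d a y) \<le> L * sqrt c * sqrt (\<Sum>j\<in>?J. (x j - y j)\<^sup>2)"
      using L by (simp add: real_sqrt_mult mult.assoc mult_left_mono)
  qed (use L c0 in auto)
  then show ?thesis using f c0 by (simp add: d power_mult_distrib mult.commute)
qed

lemma nn_integral_gauss_product_square:
  assumes "finite J" "j \<in> J"
  shows "(\<integral>\<^sup>+x. ennreal ((x j)\<^sup>2) \<partial>gauss_product J) = 1"
proof -
  have p: "prob_space std_normal_distribution" by (rule prob_space_normal_density) simp
  have "(\<integral>\<^sup>+x. ennreal ((x j)\<^sup>2) \<partial>gauss_product J)
      = (\<integral>\<^sup>+t. ennreal (t\<^sup>2) \<partial>distr (gauss_product J) std_normal_distribution (\<lambda>x. x j))"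
    using assms by (subst nn_integral_distr) auto
  also have "\<dots> = (\<integral>\<^sup>+t. ennreal (t\<^sup>2) \<partial>std_normal_distribution)"
    using distr_PiM_component[of J "\<lambda>_. std_normal_distribution" j] p assms by simp
  also have "\<dots> = 1"
    using std_normal_distribution_even_moments[of 1] by (subst nn_integral_eq_integral) (auto simp: fact_numeral)
  finally show ?thesis .
qed

lemma gauss_matrix_second_moment:
  fixes S :: "real^'d^'d"
  assumes \<nu>: "gauss_matrix n S \<nu>" and S: "psd S" "opnorm S \<le> c"
  shows "(\<integral>\<^sup>+X. ennreal ((frob n X)\<^sup>2) \<partial>\<nu>) \<le> ennreal (c * n * CARD('d))"
proof -
  let ?d = "CARD('d)"
  let ?J = "{..<n} \<times> {..<?d}"
  obtain a :: "nat \<Rightarrow> real^'d" where "\<forall>v. v \<bullet> (S *v v) = (\<Sum>k<?d. (a k \<bullet> v)\<^sup>2)"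
    using psd_sum_of_squares[OF S(1)] ..
  note a = this[rule_format]
  note m = measurable_lin_rows[of n ?d a]
  have c0: "c \<ge> 0" using S(2) onorm_pos_le[OF matrix_vector_mul_bounded_linear, of S] by (simp add: opnorm_def)
  have "(\<integral>\<^sup>+X. ennreal ((frob n X)\<^sup>2) \<partial>\<nu>) = (\<integral>\<^sup>+x. ennreal ((frob n (lin_rows n ?d a x))\<^sup>2) \<partial>gauss_product ?J)"
    unfolding gauss_matrix_eq_distr[OF \<nu> a] by (intro nn_integral_distr[OF m]) (simp add: borel_measurable_power measurable_frob)
  also have "\<dots> \<le> (\<integral>\<^sup>+x. ennreal c * (\<Sum>j\<in>?J. ennreal ((x j)\<^sup>2)) \<partial>gauss_product ?J)"
  proof (rule nn_integral_mono)
    fix x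
    have "(norm (lin_rows n ?d a x i))\<^sup>2 \<le> c * (\<Sum>k<?d. (x (i, k))\<^sup>2)" if "i < n" for i
      using norm_sum_of_squares_factor[OF a S(2), of "\<lambda>k. x (i, k)"] that
      by (simp add: lin_rows_def)
    then have "(\<Sum>i<n. (norm (lin_rows n ?d a x i))\<^sup>2) \<le> (\<Sum>i<n. c * (\<Sum>k<?d. (x (i, k))\<^sup>2))"
      by (intro sum_mono) auto
    also have "\<dots> = c * (\<Sum>j\<in>?J. (x j)\<^sup>2)"
      by (simp add: sum_distrib_left[symmetric] sum.cartesian_product case_prod_beta)
    finally have "(frob n (lin_rows n ?d a x))\<^sup>2 \<le> c * (\<Sum>j\<in>?J. (x j)\<^sup>2)"
      by (simp add: frob_def sum_nonneg)
    then have "ennreal ((frob n (lin_rows n ?d a x))\<^sup>2) \<le> ennreal (c * (\<Sum>j\<in>?J. (x j)\<^sup>2))" by (rule ennreal_leI)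
    also have "\<dots> = ennreal c * (\<Sum>j\<in>?J. ennreal ((x j)\<^sup>2))"
      using c0 by (simp add: ennreal_mult sum_nonneg sum_ennreal)
    finally show "ennreal ((frob n (lin_rows n ?d a x))\<^sup>2) \<le> ennreal c * (\<Sum>j\<in>?J. ennreal ((x j)\<^sup>2))" .
  qed
  also have "\<dots> = ennreal c * (\<Sum>j\<in>?J. (\<integral>\<^sup>+x. ennreal ((x j)\<^sup>2) \<partial>gauss_product ?J))"
  proof -
    have [measurable]: "(\<lambda>x. x j) \<in> borel_measurable (gauss_product ?J)" if "j \<in> ?J" for j
      using measurable_component_singleton[OF that, of "\<lambda>_. std_normal_distribution"]
      by (simp add: measurable_cong_sets[OF refl, of std_normal_distribution borel])
    have mm: "(\<lambda>x. ennreal ((x j)\<^sup>2)) \<in> borel_measurable (gauss_product ?J)" if "j \<in> ?J" for j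
      using that by measurable
    have sm: "(\<lambda>x. \<Sum>j\<in>?J. ennreal ((x j)\<^sup>2)) \<in> borel_measurable (gauss_product ?J)"
      by (rule borel_measurable_sum[OF mm])
    show ?thesis by (simp only: nn_integral_cmult[OF sm] nn_integral_sum[OF mm])
  qed
  also have "\<dots> = ennreal c * (\<Sum>j\<in>?J. 1)"
    by (intro arg_cong2[where f = times] sum.cong refl nn_integral_gauss_product_square) auto
  also have "\<dots> = ennreal (c * n * ?d)"
    using c0 by (simp add: ennreal_of_nat_eq_real_of_nat ennreal_mult[symmetric] mult.assoc)
  finally show ?thesis .
qed

text \<open>Scaling by sqrt n / L makes \<open>f\<close> 1-Lipschitz for \<open>frob\<close>, with
  mean absolute deviation at most \<open>2 * exp c\<close>; undoing the scaling produces the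
  rate.\<close>

lemma gauss_matrix_concentration:
  fixes S :: "real^'d^'d"
  assumes \<nu>: "gauss_matrix n S \<nu>" and S: "psd S" "opnorm S \<le> c" and n: "n > 0"
    and f: "f \<in> borel_measurable (mat_space n)" and L: "0 < L"
    and lip: "\<And>X Y. X \<in> space (mat_space n) \<Longrightarrow> Y \<in> space (mat_space n) \<Longrightarrow> \<bar>f X - f Y\<bar> \<le> L * nfrob n (X - Y)"
  shows "integrable \<nu> f" "(\<integral>X. \<bar>f X - (\<integral>Y. f Y \<partial>\<nu>)\<bar> \<partial>\<nu>) \<le> 2 * exp c * L / sqrt n"
proof -
  interpret prob_space \<nu> using \<nu> by (simp add: gauss_matrix_def)
  have sets: "sets \<nu> = sets (mat_space n)" using \<nu> by (simp add: gauss_matrix_def)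
  define t where "t = sqrt n / L"
  have t: "t > 0" using n L by (simp add: t_def)
  have fm: "(\<lambda>X. t * f X) \<in> borel_measurable \<nu>" using f by (simp add: measurable_cong_sets[OF sets])
  have "(\<integral>\<^sup>+X. ennreal (exp (t * f X)) \<partial>\<nu>) * (\<integral>\<^sup>+X. ennreal (exp (- (t * f X))) \<partial>\<nu>) \<le> ennreal (exp (c * 1\<^sup>2))"
  proof (rule gauss_matrix_exp_Lipschitz[OF \<nu> S])
    fix X Y :: "nat \<Rightarrow> real^'d" assume XY: "X \<in> space (mat_space n)" "Y \<in> space (mat_space n)"
    have "\<bar>t * f X - t * f Y\<bar> = t * \<bar>f X - f Y\<bar>" using t by (simp add: right_diff_distrib[symmetric] abs_mult)
    also have "\<dots> \<le> t * (L * nfrob n (X - Y))" using t lip[OF XY] by (intro mult_left_mono) auto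
    also have "\<dots> = 1 * frob n (X - Y)" using n L by (simp add: t_def nfrob_def)
    finally show "\<bar>t * f X - t * f Y\<bar> \<le> 1 * frob n (X - Y)" .
  qed (use f in auto)
  then have le: "(\<integral>\<^sup>+X. ennreal (exp (t * f X)) \<partial>\<nu>) * (\<integral>\<^sup>+X. ennreal (exp (- (t * f X))) \<partial>\<nu>) \<le> ennreal (exp c)" by simp
  note b = exp_product_bound[OF fm _ le]
  show i: "integrable \<nu> f" using b(1) t by simp
  have "t * (\<integral>X. \<bar>f X - (\<integral>Y. f Y \<partial>\<nu>)\<bar> \<partial>\<nu>) = (\<integral>X. \<bar>t * f X - (\<integral>Y. t * f Y \<partial>\<nu>)\<bar> \<partial>\<nu>)"
    using t by (simp add: right_diff_distrib[symmetric] abs_mult)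
  also have "\<dots> \<le> 2 * exp c" using b(4) by simp
  finally show "(\<integral>X. \<bar>f X - (\<integral>Y. f Y \<partial>\<nu>)\<bar> \<partial>\<nu>) \<le> 2 * exp c * L / sqrt n"
    using n L by (simp add: t_def field_simps)
qed

text \<open>The norm \<open>nfrob\<close> has Lipschitz constant 1 / sqrt n, giving a product bound
  exp(c / n) <= exp c. Its mean is at most 1 + c d, from x <= 1 + x^2 and the second moment; the
  exponent in the claim is the sum of the two.\<close>

lemma gauss_matrix_exp_nfrob:
  fixes S :: "real^'d^'d"
  assumes \<nu>: "gauss_matrix n S \<nu>" and S: "psd S" "opnorm S \<le> c" and n: "n > 0"
  shows "integrable \<nu> (\<lambda>X. exp (nfrob n X))" "(\<integral>X. exp (nfrob n X) \<partial>\<nu>) \<le> exp (c + 1 + c * CARD('d))"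
proof -
  interpret prob_space \<nu> using \<nu> by (simp add: gauss_matrix_def)
  have sets: "sets \<nu> = sets (mat_space n)" using \<nu> by (simp add: gauss_matrix_def)
  have c0: "c \<ge> 0" using S(2) onorm_pos_le[OF matrix_vector_mul_bounded_linear, of S] by (simp add: opnorm_def)
  have fm: "nfrob n \<in> borel_measurable \<nu>" using measurable_nfrob by (simp add: measurable_cong_sets[OF sets])
  have "(\<integral>\<^sup>+X. ennreal (exp (nfrob n X)) \<partial>\<nu>) * (\<integral>\<^sup>+X. ennreal (exp (- (nfrob n X))) \<partial>\<nu>) \<le> ennreal (exp (c * (1 / sqrt n)\<^sup>2))"
  proof (rule gauss_matrix_exp_Lipschitz[OF \<nu> S measurable_nfrob])
    fix X Y :: "nat \<Rightarrow> real^'d"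
    show "\<bar>nfrob n X - nfrob n Y\<bar> \<le> 1 / sqrt n * frob n (X - Y)"
      using abs_nfrob_diff_le[of n X Y] by (simp add: nfrob_def)
  qed simp
  also have "\<dots> \<le> ennreal (exp c)"
  proof -
    have "c / n \<le> c" using n c0 by (simp add: divide_le_eq mult_le_cancel_left1)
    then show ?thesis by (intro ennreal_leI) (simp add: power_divide)
  qed
  finally have le: "(\<integral>\<^sup>+X. ennreal (exp (nfrob n X)) \<partial>\<nu>) * (\<integral>\<^sup>+X. ennreal (exp (- (nfrob n X))) \<partial>\<nu>) \<le> ennreal (exp c)" .
  note b = exp_product_bound[OF fm _ le]
  show "integrable \<nu> (\<lambda>X. exp (nfrob n X))" using b(2) by simp
  have "expectation (nfrob n) \<le> 1 + c * CARD('d)"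
  proof -
    have "ennreal (expectation (nfrob n)) = (\<integral>\<^sup>+X. ennreal (nfrob n X) \<partial>\<nu>)"
      using b(1) by (intro nn_integral_eq_integral[symmetric]) auto
    also have "\<dots> \<le> (\<integral>\<^sup>+X. 1 + ennreal (1 / n) * ennreal ((frob n X)\<^sup>2) \<partial>\<nu>)"
    proof (rule nn_integral_mono)
      fix X
      have "x \<le> 1 + x\<^sup>2" for x :: real
      proof -
        have "x + x \<le> 1 + x\<^sup>2" using zero_le_power2[of "x - 1"] by (simp add: power2_diff)
        moreover have "0 \<le> 1 + x\<^sup>2" by simp
        ultimately show ?thesis by linarith
      qed
      then have "nfrob n X \<le> 1 + (nfrob n X)\<^sup>2" .
      also have "\<dots> = 1 + 1 / n * (frob n X)\<^sup>2" by (simp add: nfrob_def power_divide)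
      finally have "ennreal (nfrob n X) \<le> ennreal (1 + 1 / n * (frob n X)\<^sup>2)" by (rule ennreal_leI)
      then show "ennreal (nfrob n X) \<le> 1 + ennreal (1 / n) * ennreal ((frob n X)\<^sup>2)"
        by (simp add: ennreal_mult[symmetric])
    qed
    also have "\<dots> = 1 + ennreal (1 / n) * (\<integral>\<^sup>+X. ennreal ((frob n X)\<^sup>2) \<partial>\<nu>)"
    proof -
      have [measurable]: "frob n \<in> borel_measurable \<nu>"
        using measurable_frob by (simp add: measurable_cong_sets[OF sets])
      show ?thesis by (simp add: nn_integral_add nn_integral_cmult emeasure_space_1)
    qed
    also have "\<dots> \<le> 1 + ennreal (1 / n) * ennreal (c * n * CARD('d))"
      by (intro add_left_mono mult_left_mono gauss_matrix_second_moment[OF \<nu> S]) auto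
    also have "\<dots> = ennreal (1 + c * CARD('d))"
      using n c0 by (simp add: ennreal_mult[symmetric])
    finally show ?thesis using c0 ennreal_le_iff[of "1 + c * CARD('d)" "expectation (nfrob n)"] by (simp del: ennreal_plus)
  qed
  then have "exp c * exp (expectation (nfrob n)) \<le> exp (c + 1 + c * CARD('d))"
    by (simp add: exp_add[symmetric])
  then show "(\<integral>X. exp (nfrob n X) \<partial>\<nu>) \<le> exp (c + 1 + c * CARD('d))" using b(3) by simp
qed


lemma power_le_fact_exp:
  fixes t :: real
  assumes "0 \<le> t" shows "t ^ j \<le> fact j * exp t"
proof -
  have "(\<Sum>i\<in>{j}. t ^ i /\<^sub>R fact i) \<le> (\<Sum>i. t ^ i /\<^sub>R fact i)"
    using assms by (intro sum_le_suminf summable_exp_generic) auto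
  then have "t ^ j / fact j \<le> exp t"
    by (simp add: exp_def divide_inverse mult.commute)
  then show ?thesis by (simp add: field_simps)
qed

text \<open>A cutoff between the radii \<open>R\<close> and \<open>2 * R\<close> makes the function
  globally Lipschitz, which gives the first term. The second is the price of the cutoff, paid once
  pointwise and once in the mean. For fixed \<open>R\<close> the first vanishes as n grows; the
  second is uniform in n and small for large \<open>R\<close>.\<close>

lemma gauss_matrix_pseudo_Lipschitz_concentration:
  fixes S :: "real^'d^'d" and f :: "(nat \<Rightarrow> real^'d) \<Rightarrow> real"
  assumes \<nu>: "gauss_matrix n S \<nu>" and S: "psd S" "opnorm S \<le> c" and n: "n > 0"
    and lip: "\<And>X Y. X \<in> space (mat_space n) \<Longrightarrow> Y \<in> space (mat_space n) \<Longrightarrow>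
      \<bar>f X - f Y\<bar> \<le> nfrob n (X - Y) * (3 + nfrob n X ^ k + nfrob n Y ^ k)"
    and R: "R \<ge> 1"
  shows "integrable \<nu> f"
    "(\<integral>X. \<bar>f X - (\<integral>Y. f Y \<partial>\<nu>)\<bar> \<partial>\<nu>) \<le> 2 * exp c * (11 + 4 * (2 * R) ^ k) / sqrt n
      + 2 * ((8 + fact (k + 2)) * exp (c + 1 + c * CARD('d))) / R"
proof -
  interpret prob_space \<nu> using \<nu> by (simp add: gauss_matrix_def)
  have sets: "sets \<nu> = sets (mat_space n)" using \<nu> by (simp add: gauss_matrix_def)
  have R0: "R > 0" using R by simp
  \<comment> \<open>The zero matrix in extensional form, as the constant function 0 is not in
    general a point of \<open>mat_space\<close>. Subtracting \<open>f Z\<close> makes the size of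
    the function controllable by its Lipschitz bound.\<close>
  define Z :: "nat \<Rightarrow> real^'d" where "Z = (\<lambda>i\<in>{..<n}. 0)"
  have Z: "Z \<in> space (mat_space n)" by (auto simp: Z_def mat_space_def space_PiM)
  have NZ: "nfrob n Z = 0" "nfrob n (X - Z) = nfrob n X" for X by (simp_all add: nfrob_def frob_def Z_def)
  define f0 where "f0 X = f X - f Z" for X
  define \<rho> :: "(nat \<Rightarrow> real^'d) \<Rightarrow> real" where "\<rho> X = max 0 (min 1 (2 - nfrob n X / R))" for X
  define h where "h X = f0 X * \<rho> X" for X
  \<comment> \<open>The sum of \<open>8 + 2 * (2 * R) ^ k\<close>, from varying the cutoff, and
    \<open>3 + 2 * (2 * R) ^ k\<close>, from varying the function.\<close>
  define \<Lambda> where "\<Lambda> = 11 + 4 * (2 * R) ^ k"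
  have fm: "f \<in> borel_measurable (mat_space n)" by (rule measurable_pseudo_Lipschitz[OF n _ lip]) auto
  have f0b: "\<bar>f0 X\<bar> \<le> nfrob n X * (4 + nfrob n X ^ k)" if "X \<in> space (mat_space n)" for X
  proof -
    \<comment> \<open>For \<open>k = 0\<close> the power is 1, so the constant 3 grows to 4.\<close>
    have "(0::real) ^ k \<le> 1" by (simp add: power_le_one_iff)
    then show ?thesis using lip[OF that Z]
      by (auto simp: f0_def NZ intro!: order_trans[OF lip[OF that Z]] mult_left_mono)
  qed
  have f0l: "\<bar>f0 X - f0 Y\<bar> \<le> nfrob n (X - Y) * (3 + nfrob n X ^ k + nfrob n Y ^ k)"
    if "X \<in> space (mat_space n)" "Y \<in> space (mat_space n)" for X Y
    using lip[OF that] by (simp add: f0_def)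
  have \<rho>01: "0 \<le> \<rho> X" "\<rho> X \<le> 1" for X by (auto simp: \<rho>_def)
  have \<rho>0: "\<rho> X = 0" if "nfrob n X \<ge> 2 * R" for X
    using that R0 by (simp add: \<rho>_def field_simps)
  have \<rho>1: "\<rho> X = 1" if "nfrob n X \<le> R" for X
    using that R0 by (simp add: \<rho>_def field_simps)
  have \<rho>l: "\<bar>\<rho> X - \<rho> Y\<bar> \<le> nfrob n (X - Y) / R" for X Y
  proof -
    have "\<bar>\<rho> X - \<rho> Y\<bar> \<le> \<bar>nfrob n X / R - nfrob n Y / R\<bar>"
      by (simp add: \<rho>_def max_def min_def abs_minus_commute)
    also have "\<dots> = \<bar>nfrob n X - nfrob n Y\<bar> / R" using R0 by (simp add: diff_divide_distrib[symmetric])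
    also have "\<dots> \<le> nfrob n (X - Y) / R" using R0 by (intro divide_right_mono abs_nfrob_diff_le) auto
    finally show ?thesis .
  qed
  \<comment> \<open>The slope 1 / R of the cutoff compensates the factor 2 R in the size of
    \<open>f0\<close> on the ball of radius 2 R.\<close>
  have part: "\<bar>f0 X\<bar> * \<bar>\<rho> X - \<rho> Y\<bar> \<le> nfrob n (X - Y) * (8 + 2 * (2 * R) ^ k)"
    if X: "X \<in> space (mat_space n)" "nfrob n X \<le> 2 * R" for X Y
  proof -
    have "nfrob n X ^ k \<le> (2 * R) ^ k" using X by (intro power_mono) auto
    then have "\<bar>f0 X\<bar> \<le> (2 * R) * (4 + (2 * R) ^ k)"
      using R0 X by (intro order_trans[OF f0b[OF X(1)]] mult_mono) auto
    then have "\<bar>f0 X\<bar> * \<bar>\<rho> X - \<rho> Y\<bar> \<le> ((2 * R) * (4 + (2 * R) ^ k)) * (nfrob n (X - Y) / R)"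
      using R0 \<rho>l by (intro mult_mono) auto
    also have "\<dots> = nfrob n (X - Y) * (8 + 2 * (2 * R) ^ k)" using R0 by (simp add: field_simps)
    finally show ?thesis .
  qed
  have one: "\<bar>h X - h Y\<bar> \<le> \<Lambda> * nfrob n (X - Y)"
    if X: "X \<in> space (mat_space n)" and Y: "Y \<in> space (mat_space n)" and XR: "nfrob n X \<le> 2 * R" for X Y
  proof (cases "nfrob n Y \<le> 2 * R")
    case False
    then have "\<bar>h X - h Y\<bar> = \<bar>f0 X\<bar> * \<bar>\<rho> X - \<rho> Y\<bar>" using \<rho>0[of Y] \<rho>01[of X] by (simp add: h_def abs_mult)
    also note part[OF X XR]
    also have "nfrob n (X - Y) * (8 + 2 * (2 * R) ^ k) \<le> nfrob n (X - Y) * \<Lambda>"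
      using R0 by (intro mult_left_mono) (auto simp: \<Lambda>_def)
    finally show ?thesis by (simp add: mult.commute)
  next
    case True
    have p: "nfrob n X ^ k \<le> (2 * R) ^ k" "nfrob n Y ^ k \<le> (2 * R) ^ k"
      using XR True by (intro power_mono; simp)+
    have "h X - h Y = f0 X * (\<rho> X - \<rho> Y) + (f0 X - f0 Y) * \<rho> Y" by (simp add: h_def algebra_simps)
    then have "\<bar>h X - h Y\<bar> \<le> \<bar>f0 X\<bar> * \<bar>\<rho> X - \<rho> Y\<bar> + \<bar>f0 X - f0 Y\<bar> * \<rho> Y"
      using \<rho>01[of Y] by (metis abs_mult abs_of_nonneg abs_triangle_ineq)
    also have "\<bar>f0 X - f0 Y\<bar> * \<rho> Y \<le> \<bar>f0 X - f0 Y\<bar> * 1" using \<rho>01 by (intro mult_left_mono) auto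
    also have "\<bar>f0 X - f0 Y\<bar> * 1 \<le> nfrob n (X - Y) * (3 + 2 * (2 * R) ^ k)"
      using p by (intro order_trans[OF _ order_trans[OF f0l[OF X Y] mult_left_mono]]) auto
    also note part[OF X XR]
    also have "N * (8 + 2 * p) + N * (3 + 2 * p) = (11 + 4 * p) * N" for N p :: real
      by (simp add: algebra_simps)
    finally show ?thesis unfolding \<Lambda>_def by simp_all
  qed
  have hl: "\<bar>h X - h Y\<bar> \<le> \<Lambda> * nfrob n (X - Y)"
    if X: "X \<in> space (mat_space n)" and Y: "Y \<in> space (mat_space n)" for X Y
  proof (cases "nfrob n X \<le> 2 * R \<or> nfrob n Y \<le> 2 * R")
    case True
    then show ?thesis using one[OF X Y] one[OF Y X] by (auto simp: nfrob_minus_commute[of n Y X] abs_minus_commute)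
  next
    case False
    then have "h X = 0" "h Y = 0" by (auto simp: h_def \<rho>0)
    then show ?thesis using R0 by (simp add: \<Lambda>_def)
  qed
  have \<Lambda>: "\<Lambda> > 0" using R0 by (simp add: \<Lambda>_def add_pos_nonneg)
  have hm: "h \<in> borel_measurable (mat_space n)"
  proof -
    note [measurable] = fm measurable_nfrob[of n]
    show ?thesis unfolding h_def f0_def \<rho>_def by measurable
  qed
  note hc = gauss_matrix_concentration[OF \<nu> S n hm \<Lambda> hl]
  note em = gauss_matrix_exp_nfrob[OF \<nu> S n]
  define B where "B = (8 + fact (k + 2)) * exp (c + 1 + c * CARD('d))"
  have dm: "(\<lambda>X. f0 X - h X) \<in> borel_measurable \<nu>"
    using hm fm by (simp add: measurable_cong_sets[OF sets] f0_def)
  \<comment> \<open>The error lives where \<open>nfrob n X\<close> exceeds \<open>R\<close>. There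
    the factor \<open>nfrob n X / R\<close> is at least 1 and can be inserted, gaining 1 / R; the
    polynomial that remains is absorbed by the exponential, with 4 * 2! = 8 and (k + 2)!.\<close>
  have db: "\<bar>f0 X - h X\<bar> \<le> (8 + fact (k + 2)) / R * exp (nfrob n X)" if X: "X \<in> space \<nu>" for X
  proof -
    have X': "X \<in> space (mat_space n)" using X sets_eq_imp_space_eq[OF sets] by simp
    have "\<bar>f0 X - h X\<bar> \<le> \<bar>f0 X\<bar> * (nfrob n X / R)"
    proof (cases "nfrob n X \<le> R")
      case True
      then show ?thesis using R0 by (simp add: h_def \<rho>1)
    next
      case False
      have "f0 X - h X = f0 X * (1 - \<rho> X)" by (simp add: h_def algebra_simps)
      then have "\<bar>f0 X - h X\<bar> = \<bar>f0 X\<bar> * (1 - \<rho> X)" using \<rho>01[of X] by (simp add: abs_mult)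
      also have "\<dots> \<le> \<bar>f0 X\<bar> * (nfrob n X / R)"
      proof (rule mult_left_mono)
        have "1 \<le> nfrob n X / R" using False R0 by simp
        then show "1 - \<rho> X \<le> nfrob n X / R" using \<rho>01[of X] by linarith
      qed simp
      finally show ?thesis .
    qed
    also have "\<dots> \<le> (nfrob n X * (4 + nfrob n X ^ k)) * (nfrob n X / R)"
      using R0 by (intro mult_right_mono f0b[OF X']) auto
    also have "\<dots> = (4 * nfrob n X ^ 2 + nfrob n X ^ (k + 2)) / R"
      by (simp add: power_add power2_eq_square algebra_simps add_divide_distrib)
    also have "\<dots> \<le> (4 * (fact 2 * exp (nfrob n X)) + fact (k + 2) * exp (nfrob n X)) / R"
      using R0 by (intro divide_right_mono add_mono mult_left_mono power_le_fact_exp) auto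
    also have "\<dots> = (8 + fact (k + 2)) / R * exp (nfrob n X)" by (simp add: fact_numeral algebra_simps add_divide_distrib)
    finally show ?thesis .
  qed
  have di: "integrable \<nu> (\<lambda>X. f0 X - h X)"
    by (rule Bochner_Integration.integrable_bound[of _ "\<lambda>X. (8 + fact (k + 2)) / R * exp (nfrob n X)"])
      (use em dm db R0 in \<open>auto intro!: AE_I2\<close>)
  have dE: "(\<integral>X. \<bar>f0 X - h X\<bar> \<partial>\<nu>) \<le> B / R"
  proof -
    have "(\<integral>X. \<bar>f0 X - h X\<bar> \<partial>\<nu>) \<le> (\<integral>X. (8 + fact (k + 2)) / R * exp (nfrob n X) \<partial>\<nu>)"
      using di em db by (intro integral_mono) auto
    also have "\<dots> \<le> (8 + fact (k + 2)) / R * exp (c + 1 + c * CARD('d))"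
      unfolding integral_mult_right_zero using R0 by (intro mult_left_mono em) auto
    finally show ?thesis by (simp add: B_def)
  qed
  have f0i: "integrable \<nu> f0" using Bochner_Integration.integrable_add[OF di hc(1)] by simp
  then have "integrable \<nu> (\<lambda>X. f0 X + f Z)" by simp
  then show fi: "integrable \<nu> f" by (simp add: f0_def)
  have Ef: "(\<integral>Y. f Y \<partial>\<nu>) = (\<integral>Y. f0 Y \<partial>\<nu>) + f Z"
    using fi by (simp add: f0_def[abs_def] prob_space)
  have Ed: "\<bar>(\<integral>Y. h Y \<partial>\<nu>) - (\<integral>Y. f0 Y \<partial>\<nu>)\<bar> \<le> B / R"
  proof -
    have "(\<integral>Y. h Y \<partial>\<nu>) - (\<integral>Y. f0 Y \<partial>\<nu>) = - (\<integral>Y. f0 Y - h Y \<partial>\<nu>)" using f0i hc(1) by simp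
    then show ?thesis using integral_abs_bound[of \<nu> "\<lambda>Y. f0 Y - h Y"] dE by linarith
  qed
  have "(\<integral>X. \<bar>f X - (\<integral>Y. f Y \<partial>\<nu>)\<bar> \<partial>\<nu>)
      \<le> (\<integral>X. \<bar>h X - (\<integral>Y. h Y \<partial>\<nu>)\<bar> + \<bar>f0 X - h X\<bar> + B / R \<partial>\<nu>)"
  proof (rule integral_mono)
    show "\<bar>f X - (\<integral>Y. f Y \<partial>\<nu>)\<bar> \<le> \<bar>h X - (\<integral>Y. h Y \<partial>\<nu>)\<bar> + \<bar>f0 X - h X\<bar> + B / R" for X
      using Ed unfolding Ef f0_def[of X] by linarith
  qed (use fi hc(1) di in auto)
  also have "\<dots> = (\<integral>X. \<bar>h X - (\<integral>Y. h Y \<partial>\<nu>)\<bar> \<partial>\<nu>) + (\<integral>X. \<bar>f0 X - h X\<bar> \<partial>\<nu>) + B / R"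
    using hc(1) di by (simp add: prob_space)
  also have "\<dots> \<le> 2 * exp c * \<Lambda> / sqrt n + 2 * B / R"
    using hc(2) dE by simp
  finally show "(\<integral>X. \<bar>f X - (\<integral>Y. f Y \<partial>\<nu>)\<bar> \<partial>\<nu>) \<le> 2 * exp c * (11 + 4 * (2 * R) ^ k) / sqrt n
      + 2 * ((8 + fact (k + 2)) * exp (c + 1 + c * CARD('d))) / R"
    by (simp only: \<Lambda>_def B_def)
qed


section \<open>Couplings from expansion\<close>

text \<open>Greedy filling: edges are treated one at a time and each receives all the mass its two
  ends can still take. A saturated end stays saturated, because row and column sums only grow and
  never pass their caps. Maximality suffices here; no optimal flow is sought.\<close>

lemma maximal_partial_plan:
  fixes p q :: "nat \<Rightarrow> real"
  assumes "finite E" "E \<subseteq> {..K} \<times> {..K}" "\<And>i. 0 \<le> p i" "\<And>j. 0 \<le> q j"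
  shows "\<exists>\<pi>. (\<forall>i j. 0 \<le> \<pi> i j) \<and> (\<forall>i j. (i, j) \<notin> E \<longrightarrow> \<pi> i j = 0) \<and>
    (\<forall>i\<le>K. (\<Sum>j\<le>K. \<pi> i j) \<le> p i) \<and> (\<forall>j\<le>K. (\<Sum>i\<le>K. \<pi> i j) \<le> q j) \<and>
    (\<forall>i j. (i, j) \<in> E \<longrightarrow> (\<Sum>j\<le>K. \<pi> i j) = p i \<or> (\<Sum>i\<le>K. \<pi> i j) = q j)"
  using assms(1,2)
proof (induction E rule: finite_induct)
  case empty
  show ?case by (intro exI[of _ "\<lambda>_ _. 0"]) (auto simp: assms(3,4))
next
  case (insert e E)
  obtain a b where e: "e = (a, b)" by (cases e)
  have ab: "a \<le> K" "b \<le> K" "(a, b) \<notin> E" using insert.prems insert.hyps e by auto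
  obtain \<pi> where \<pi>: "\<And>i j. 0 \<le> \<pi> i j" "\<And>i j. (i, j) \<notin> E \<Longrightarrow> \<pi> i j = 0"
    "\<And>i. i \<le> K \<Longrightarrow> (\<Sum>j\<le>K. \<pi> i j) \<le> p i" "\<And>j. j \<le> K \<Longrightarrow> (\<Sum>i\<le>K. \<pi> i j) \<le> q j"
    "\<And>i j. (i, j) \<in> E \<Longrightarrow> (\<Sum>j\<le>K. \<pi> i j) = p i \<or> (\<Sum>i\<le>K. \<pi> i j) = q j"
    using insert.IH[OF order_trans[OF subset_insertI insert.prems]] by metis
  define m where "m = min (p a - (\<Sum>j\<le>K. \<pi> a j)) (q b - (\<Sum>i\<le>K. \<pi> i b))"
  have m: "0 \<le> m" using \<pi>(3)[OF ab(1)] \<pi>(4)[OF ab(2)] by (simp add: m_def)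
  define \<pi>' where "\<pi>' i j = \<pi> i j + (if i = a \<and> j = b then m else 0)" for i j
  have row: "(\<Sum>j\<le>K. \<pi>' i j) = (\<Sum>j\<le>K. \<pi> i j) + (if i = a then m else 0)" for i
    using ab by (auto simp: \<pi>'_def sum.distrib)
  have col: "(\<Sum>i\<le>K. \<pi>' i j) = (\<Sum>i\<le>K. \<pi> i j) + (if j = b then m else 0)" for j
    using ab by (auto simp: \<pi>'_def sum.distrib)
  have r: "(\<Sum>j\<le>K. \<pi>' i j) \<le> p i" if "i \<le> K" for i
    using \<pi>(3)[OF that] unfolding row by (auto simp: m_def)
  have c: "(\<Sum>i\<le>K. \<pi>' i j) \<le> q j" if "j \<le> K" for j
    using \<pi>(4)[OF that] unfolding col by (auto simp: m_def)
  have sat: "(\<Sum>j\<le>K. \<pi>' i j) = p i \<or> (\<Sum>i\<le>K. \<pi>' i j) = q j" if "(i, j) \<in> insert e E" for i j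
  proof (cases "(i, j) = e")
    case True
    then show ?thesis unfolding row col by (auto simp: e m_def min_def)
  next
    case False
    then have "(i, j) \<in> E" "i \<le> K" "j \<le> K" using that insert.prems by auto
    then show ?thesis using \<pi>(5)[of i j] r[of i] c[of j] m unfolding row col by (auto split: if_splits)
  qed
  show ?case
  proof (intro exI[of _ \<pi>'] conjI allI impI)
    show "0 \<le> \<pi>' i j" for i j using \<pi>(1)[of i j] m by (simp add: \<pi>'_def)
    show "\<pi>' i j = 0" if "(i, j) \<notin> insert e E" for i j using that \<pi>(2)[of i j] by (auto simp: \<pi>'_def e)
  qed (use r c sat in auto)
qed

lemma nn_integral_finite_index:
  fixes f :: "nat \<Rightarrow> ennreal"
  assumes c: "c \<in> measurable M (count_space UNIV)" and K: "\<And>x. x \<in> space M \<Longrightarrow> c x \<le> K"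
  shows "(\<integral>\<^sup>+x. f (c x) \<partial>M) = (\<Sum>i\<le>K. f i * emeasure M {x \<in> space M. c x = i})"
proof -
  have [measurable]: "{x \<in> space M. c x = i} \<in> sets M" for i
    using measurable_sets[OF c, of "{i}"] by (simp add: vimage_def Int_def conj_commute)
  have "(\<integral>\<^sup>+x. f (c x) \<partial>M) = (\<integral>\<^sup>+x. (\<Sum>i\<le>K. f i * indicator {x \<in> space M. c x = i} x) \<partial>M)"
  proof (rule nn_integral_cong)
    fix x assume x: "x \<in> space M"
    have "(\<Sum>i\<le>K. f i * indicator {x \<in> space M. c x = i} x) = (\<Sum>i\<le>K. if i = c x then f (c x) else 0)"
      using x by (intro sum.cong) (auto simp: indicator_def)
    then show "f (c x) = (\<Sum>i\<le>K. f i * indicator {x \<in> space M. c x = i} x)"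
      using K[OF x] by simp
  qed
  also have "\<dots> = (\<Sum>i\<le>K. f i * emeasure M {x \<in> space M. c x = i})"
    by (subst nn_integral_sum) (auto simp: nn_integral_cmult)
  finally show ?thesis .
qed

lemma prob_space_sum_finite_index:
  assumes "prob_space M" and c: "c \<in> measurable M (count_space UNIV)" and K: "\<And>x. x \<in> space M \<Longrightarrow> c x \<le> K"
  shows "(\<Sum>i\<le>K. measure M {x \<in> space M. c x = (i::nat)}) = 1"
    "A \<subseteq> {..K} \<Longrightarrow> (\<Sum>i\<in>A. measure M {x \<in> space M. c x = i}) = measure M {x \<in> space M. c x \<in> A}"
proof -
  interpret prob_space M by fact
  have m: "{x \<in> space M. c x = i} \<in> sets M" for i
    using measurable_sets[OF c, of "{i}"] by (simp add: vimage_def Int_def conj_commute)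
  show *: "(\<Sum>i\<in>A. measure M {x \<in> space M. c x = i}) = measure M {x \<in> space M. c x \<in> A}" if "A \<subseteq> {..K}" for A
  proof -
    have "measure M (\<Union>i\<in>A. {x \<in> space M. c x = i}) = (\<Sum>i\<in>A. measure M {x \<in> space M. c x = i})"
      using m finite_subset[OF that] by (intro finite_measure_finite_Union) (auto simp: disjoint_family_on_def)
    also have "(\<Union>i\<in>A. {x \<in> space M. c x = i}) = {x \<in> space M. c x \<in> A}" by auto
    finally show ?thesis ..
  qed
  have "{x \<in> space M. c x \<in> {..K}} = space M" using K by auto
  then show "(\<Sum>i\<le>K. measure M {x \<in> space M. c x = i}) = 1" using *[of "{..K}"] by (simp add: prob_space)
qed

text \<open>A maximal partial matching of the cells along the edges \<open>E\<close> is completed by the product of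
  the two residuals. By maximality no edge joins the rows \<open>A\<close> and the columns \<open>B\<close> with positive residual,
  and the mass outside \<open>E\<close> is at most the total residual.\<close>

lemma greedy_coupling:
  fixes M :: "'a measure" and N :: "'b measure" and c :: "'a \<Rightarrow> nat" and e :: "'b \<Rightarrow> nat"
  assumes M: "prob_space M" and N: "prob_space N"
    and c: "c \<in> measurable M (count_space UNIV)" "\<And>x. x \<in> space M \<Longrightarrow> c x \<le> K"
    and e: "e \<in> measurable N (count_space UNIV)" "\<And>y. y \<in> space N \<Longrightarrow> e y \<le> K"
    and E: "E \<subseteq> {..K} \<times> {..K}"
  obtains C A B where "prob_space C" "sets C = sets (M \<Otimes>\<^sub>M N)" "distr C M fst = M" "distr C N snd = N"
    "A \<subseteq> {..K}" "B \<subseteq> {..K}" "A \<times> B \<inter> E = {}"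
    "measure C {z \<in> space C. (c (fst z), e (snd z)) \<notin> E} \<le> measure M {x \<in> space M. c x \<in> A}"
    "measure C {z \<in> space C. (c (fst z), e (snd z)) \<notin> E} \<le> measure N {y \<in> space N. e y \<in> B}"
proof -
  interpret M: prob_space M by fact
  interpret N: prob_space N by fact
  interpret MN: pair_prob_space M N ..
  note [measurable] = c(1) e(1)
  define p where "p i = measure M {x \<in> space M. c x = i}" for i
  define q where "q j = measure N {y \<in> space N. e y = j}" for j
  have p1: "(\<Sum>i\<le>K. p i) = 1" unfolding p_def by (rule prob_space_sum_finite_index[OF M c])
  have q1: "(\<Sum>i\<le>K. q i) = 1" unfolding q_def by (rule prob_space_sum_finite_index[OF N e])
  have pq: "0 \<le> p i" "0 \<le> q i" for i by (auto simp: p_def q_def)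
  obtain \<pi> where \<pi>: "\<And>i j. 0 \<le> \<pi> i j" "\<And>i j. (i, j) \<notin> E \<Longrightarrow> \<pi> i j = 0"
    "\<And>i. i \<le> K \<Longrightarrow> (\<Sum>j\<le>K. \<pi> i j) \<le> p i" "\<And>j. j \<le> K \<Longrightarrow> (\<Sum>i\<le>K. \<pi> i j) \<le> q j"
    "\<And>i j. (i, j) \<in> E \<Longrightarrow> (\<Sum>j\<le>K. \<pi> i j) = p i \<or> (\<Sum>i\<le>K. \<pi> i j) = q j"
    using maximal_partial_plan[OF finite_subset[OF E] E, of p q] pq by auto
  define p' where "p' i = p i - (\<Sum>j\<le>K. \<pi> i j)" for i
  define q' where "q' j = q j - (\<Sum>i\<le>K. \<pi> i j)" for j
  define m where "m = (\<Sum>i\<le>K. p' i)"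
  have mq: "m = (\<Sum>j\<le>K. q' j)"
    unfolding m_def p'_def q'_def sum_subtractf p1 q1 by (subst sum.swap) simp
  have p'0: "i \<le> K \<Longrightarrow> 0 \<le> p' i" and q'0: "i \<le> K \<Longrightarrow> 0 \<le> q' i" for i
    using \<pi>(3,4) by (auto simp: p'_def q'_def)
  have m0: "0 \<le> m" unfolding m_def using p'0 by (intro sum_nonneg) auto
  have pz: "p' i = 0" if "m = 0" "i \<le> K" for i
    using that sum_nonneg_eq_0_iff[of "{..K}" p'] p'0 unfolding m_def by auto
  have qz: "q' i = 0" if "m = 0" "i \<le> K" for i
    using that sum_nonneg_eq_0_iff[of "{..K}" q'] q'0 unfolding mq by auto
  \<comment> \<open>If \<open>m = 0\<close>, all residuals vanish and division by zero yields 0, so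
    the formula still has the right marginals.\<close>
  define \<kappa> where "\<kappa> i j = \<pi> i j + p' i * q' j / m" for i j
  have \<kappa>0: "0 \<le> \<kappa> i j" if "i \<le> K" "j \<le> K" for i j
    using \<pi>(1)[of i j] p'0[OF that(1)] q'0[OF that(2)] m0 by (simp add: \<kappa>_def)
  have row: "(\<Sum>j\<le>K. \<kappa> i j) = p i" if "i \<le> K" for i
  proof -
    have "(\<Sum>j\<le>K. \<kappa> i j) = (\<Sum>j\<le>K. \<pi> i j) + p' i * m / m"
      by (simp add: \<kappa>_def sum.distrib sum_distrib_left[symmetric] sum_divide_distrib[symmetric] mq)
    then show ?thesis using pz[OF _ that] by (cases "m = 0") (auto simp: p'_def)
  qed
  have col: "(\<Sum>i\<le>K. \<kappa> i j) = q j" if "j \<le> K" for j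
  proof -
    have "(\<Sum>i\<le>K. \<kappa> i j) = (\<Sum>i\<le>K. \<pi> i j) + m * q' j / m"
      by (simp add: \<kappa>_def sum.distrib sum_distrib_right[symmetric] sum_divide_distrib[symmetric] m_def)
    then show ?thesis using qz[OF _ that] by (cases "m = 0") (auto simp: q'_def)
  qed
  have \<kappa>p: "\<kappa> i j = 0" if "i \<le> K" "j \<le> K" "p i = 0" for i j
    using row[OF that(1)] that \<kappa>0[OF that(1)] sum_nonneg_eq_0_iff[of "{..K}" "\<kappa> i"] by auto
  have \<kappa>q: "\<kappa> i j = 0" if "i \<le> K" "j \<le> K" "q j = 0" for i j
    using col[OF that(2)] that \<kappa>0[OF _ that(2)] sum_nonneg_eq_0_iff[of "{..K}" "\<lambda>i. \<kappa> i j"] by auto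
  \<comment> \<open>Within a pair of cells the mass \<open>\<kappa>\<close> is spread like the
    product of the two conditional laws, so the coupling has a density with respect to the product
    measure.\<close>
  define D where "D z = ennreal (\<kappa> (c (fst z)) (e (snd z)) / (p (c (fst z)) * q (e (snd z))))" for z
  define C where "C = density (M \<Otimes>\<^sub>M N) D"
  have Dm[measurable]: "D \<in> borel_measurable (M \<Otimes>\<^sub>M N)"
    unfolding D_def
    by (rule measurable_compose[of "\<lambda>z. (c (fst z), e (snd z))" _ "count_space UNIV" "\<lambda>(i, j). ennreal (\<kappa> i j / (p i * q j))" borel, simplified])
      measurable
  have emp: "emeasure M {x \<in> space M. c x = i} = ennreal (p i)" for i by (simp add: p_def M.emeasure_eq_measure)
  have emq: "emeasure N {y \<in> space N. e y = i} = ennreal (q i)" for i by (simp add: q_def N.emeasure_eq_measure)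
  have intN: "(\<integral>\<^sup>+y. ennreal (\<kappa> i (e y) / (p i * q (e y))) \<partial>N) = 1" if i: "i \<le> K" "p i \<noteq> 0" for i
  proof -
    have "(\<integral>\<^sup>+y. ennreal (\<kappa> i (e y) / (p i * q (e y))) \<partial>N) = (\<Sum>j\<le>K. ennreal (\<kappa> i j / (p i * q j)) * ennreal (q j))"
      by (subst nn_integral_finite_index[OF e]) (auto simp: emq)
    also have "\<dots> = (\<Sum>j\<le>K. ennreal (\<kappa> i j / p i))"
      using i pq \<kappa>0[OF i(1)] \<kappa>q[OF i(1)] by (intro sum.cong) (auto simp: ennreal_mult[symmetric])
    also have "\<dots> = ennreal (\<Sum>j\<le>K. \<kappa> i j / p i)"
      using i pq \<kappa>0[OF i(1)] by (intro sum_ennreal) auto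
    also have "(\<Sum>j\<le>K. \<kappa> i j / p i) = 1"
      using row[OF i(1)] i by (simp add: sum_divide_distrib[symmetric])
    finally show ?thesis by simp
  qed
  have intM: "(\<integral>\<^sup>+x. ennreal (\<kappa> (c x) j / (p (c x) * q j)) \<partial>M) = 1" if j: "j \<le> K" "q j \<noteq> 0" for j
  proof -
    have "(\<integral>\<^sup>+x. ennreal (\<kappa> (c x) j / (p (c x) * q j)) \<partial>M) = (\<Sum>i\<le>K. ennreal (\<kappa> i j / (p i * q j)) * ennreal (p i))"
      by (subst nn_integral_finite_index[OF c]) (auto simp: emp)
    also have "\<dots> = (\<Sum>i\<le>K. ennreal (\<kappa> i j / q j))"
      using j pq \<kappa>0[OF _ j(1)] \<kappa>p[OF _ j(1)] by (intro sum.cong) (auto simp: ennreal_mult[symmetric])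
    also have "\<dots> = ennreal (\<Sum>i\<le>K. \<kappa> i j / q j)"
      using j pq \<kappa>0[OF _ j(1)] by (intro sum_ennreal) auto
    also have "(\<Sum>i\<le>K. \<kappa> i j / q j) = 1"
      using col[OF j(1)] j by (simp add: sum_divide_distrib[symmetric])
    finally show ?thesis by simp
  qed
  \<comment> \<open>Cells of mass 0, where the quotient in \<open>D\<close> takes its default value,
    form a null set.\<close>
  have aeM: "AE x in M. p (c x) \<noteq> 0"
  proof -
    have "AE x in M. \<forall>i\<in>{..K}. \<not> (c x = i \<and> p i = 0)"
    proof (rule AE_ball_countable[THEN iffD2], simp, rule ballI)
      fix i
      show "AE x in M. \<not> (c x = i \<and> p i = 0)"
      proof (cases "p i = 0")
        case True
        then have "emeasure M {x \<in> space M. c x = i} = 0" by (simp add: emp)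
        then show ?thesis using True by (subst AE_iff_measurable[OF _ refl]) auto
      qed simp
    qed
    then show ?thesis using c(2) by (auto elim!: AE_mp intro!: AE_I2)
  qed
  have aeN: "AE y in N. q (e y) \<noteq> 0"
  proof -
    have "AE x in N. \<forall>i\<in>{..K}. \<not> (e x = i \<and> q i = 0)"
    proof (rule AE_ball_countable[THEN iffD2], simp, rule ballI)
      fix i
      show "AE x in N. \<not> (e x = i \<and> q i = 0)"
      proof (cases "q i = 0")
        case True
        then have "emeasure N {x \<in> space N. e x = i} = 0" by (simp add: emq)
        then show ?thesis using True by (subst AE_iff_measurable[OF _ refl]) auto
      qed simp
    qed
    then show ?thesis using e(2) by (auto elim!: AE_mp intro!: AE_I2)
  qed
  have setsC: "sets C = sets (M \<Otimes>\<^sub>M N)" by (simp add: C_def)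
  have spC: "space C = space M \<times> space N" by (simp add: C_def space_pair_measure)
  have f: "fst \<in> measurable C M" and s: "snd \<in> measurable C N"
    by (auto simp: measurable_cong_sets[OF setsC refl])
  have d1: "distr C M fst = M"
  proof (rule measure_eqI)
    fix U assume "U \<in> sets (distr C M fst)"
    then have U[measurable]: "U \<in> sets M" by simp
    have "emeasure (distr C M fst) U = emeasure C (fst -` U \<inter> space C)" by (rule emeasure_distr[OF f U])
    also have "\<dots> = (\<integral>\<^sup>+z. D z * indicator (fst -` U \<inter> space C) z \<partial>(M \<Otimes>\<^sub>M N))"
      using measurable_sets[OF f U] unfolding C_def by (subst emeasure_density) (auto simp: C_def[symmetric] setsC)
    also have "\<dots> = (\<integral>\<^sup>+z. D z * indicator U (fst z) \<partial>(M \<Otimes>\<^sub>M N))"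
      by (intro nn_integral_cong) (auto simp: spC space_pair_measure indicator_def)
    also have "\<dots> = (\<integral>\<^sup>+x. (\<integral>\<^sup>+y. D (x, y) * indicator U x \<partial>N) \<partial>M)"
      by (subst N.nn_integral_fst[symmetric]) auto
    also have "\<dots> = (\<integral>\<^sup>+x. indicator U x \<partial>M)"
    proof (rule nn_integral_cong_AE, use aeM in \<open>rule AE_mp\<close>, rule AE_I2, rule impI)
      fix x assume x: "x \<in> space M" and px: "p (c x) \<noteq> 0"
      have "(\<lambda>y. D (x, y)) \<in> borel_measurable N" using x by measurable
      then have "(\<integral>\<^sup>+y. D (x, y) * indicator U x \<partial>N) = (\<integral>\<^sup>+y. D (x, y) \<partial>N) * indicator U x"
        by (rule nn_integral_multc)
      also have "(\<integral>\<^sup>+y. D (x, y) \<partial>N) = 1" using intN[OF c(2)[OF x] px] by (simp add: D_def)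
      finally show "(\<integral>\<^sup>+y. D (x, y) * indicator U x \<partial>N) = indicator U x" by simp
    qed
    finally show "emeasure (distr C M fst) U = emeasure M U" by simp
  qed simp
  have d2: "distr C N snd = N"
  proof (rule measure_eqI)
    fix U assume "U \<in> sets (distr C N snd)"
    then have U[measurable]: "U \<in> sets N" by simp
    have "emeasure (distr C N snd) U = emeasure C (snd -` U \<inter> space C)" by (rule emeasure_distr[OF s U])
    also have "\<dots> = (\<integral>\<^sup>+z. D z * indicator (snd -` U \<inter> space C) z \<partial>(M \<Otimes>\<^sub>M N))"
      using measurable_sets[OF s U] unfolding C_def by (subst emeasure_density) (auto simp: C_def[symmetric] setsC)
    also have "\<dots> = (\<integral>\<^sup>+z. D z * indicator U (snd z) \<partial>(M \<Otimes>\<^sub>M N))"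
      by (intro nn_integral_cong) (auto simp: spC space_pair_measure indicator_def)
    also have "\<dots> = (\<integral>\<^sup>+y. (\<integral>\<^sup>+x. D (x, y) * indicator U y \<partial>M) \<partial>N)"
      by (subst MN.nn_integral_snd[symmetric]) (auto simp: case_prod_beta')
    also have "\<dots> = (\<integral>\<^sup>+y. indicator U y \<partial>N)"
    proof (rule nn_integral_cong_AE, use aeN in \<open>rule AE_mp\<close>, rule AE_I2, rule impI)
      fix y assume y: "y \<in> space N" and qy: "q (e y) \<noteq> 0"
      have "(\<lambda>x. D (x, y)) \<in> borel_measurable M" using y by measurable
      then have "(\<integral>\<^sup>+x. D (x, y) * indicator U y \<partial>M) = (\<integral>\<^sup>+x. D (x, y) \<partial>M) * indicator U y"
        by (rule nn_integral_multc)
      also have "(\<integral>\<^sup>+x. D (x, y) \<partial>M) = 1" using intM[OF e(2)[OF y] qy] by (simp add: D_def)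
      finally show "(\<integral>\<^sup>+x. D (x, y) * indicator U y \<partial>M) = indicator U y" by simp
    qed
    finally show "emeasure (distr C N snd) U = emeasure N U" by simp
  qed simp
  have pC: "prob_space C"
  proof
    have "emeasure C (space C) = emeasure (distr C M fst) (space M)"
      using f by (subst emeasure_distr) (auto simp: spC intro!: arg_cong[where f = "emeasure C"])
    then show "emeasure C (space C) = 1" by (simp add: d1 M.emeasure_space_1)
  qed
  interpret C: prob_space C by (rule pC)
  let ?Q = "{z \<in> space C. (c (fst z), e (snd z)) \<notin> E}"
  have Qs: "?Q \<in> sets (M \<Otimes>\<^sub>M N)"
  proof -
    have "{z \<in> space (M \<Otimes>\<^sub>M N). (c (fst z), e (snd z)) \<notin> E} \<in> sets (M \<Otimes>\<^sub>M N)" by measurable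
    then show ?thesis by (simp add: C_def)
  qed
  \<comment> \<open>Outside \<open>E\<close> the matched part is 0, so \<open>D\<close> is a product
    of residual factors with integrals at most \<open>m\<close> and 1.\<close>
  have off: "measure C ?Q \<le> m"
  proof -
    let ?r = "\<lambda>i. ennreal (p' i / p i)" and ?s = "\<lambda>j. ennreal (q' j / (m * q j))"
    have "emeasure C ?Q = (\<integral>\<^sup>+z. D z * indicator ?Q z \<partial>(M \<Otimes>\<^sub>M N))"
      unfolding C_def by (subst emeasure_density) (use Qs in \<open>auto simp: C_def\<close>)
    also have "\<dots> \<le> (\<integral>\<^sup>+z. ?r (c (fst z)) * ?s (e (snd z)) \<partial>(M \<Otimes>\<^sub>M N))"
    proof (rule nn_integral_mono)
      fix z assume z: "z \<in> space (M \<Otimes>\<^sub>M N)"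
      then have le: "c (fst z) \<le> K" "e (snd z) \<le> K" using c(2) e(2) by (auto simp: space_pair_measure)
      show "D z * indicator ?Q z \<le> ?r (c (fst z)) * ?s (e (snd z))"
        using \<pi>(2)[of "c (fst z)" "e (snd z)"] p'0[OF le(1)] q'0[OF le(2)] pq m0
        by (auto simp: indicator_def D_def \<kappa>_def ennreal_mult[symmetric] mult_ac)
    qed
    also have "\<dots> = (\<integral>\<^sup>+x. (\<integral>\<^sup>+y. ?r (c x) * ?s (e y) \<partial>N) \<partial>M)"
      by (subst N.nn_integral_fst[symmetric]) auto
    also have "\<dots> = (\<integral>\<^sup>+x. ?r (c x) \<partial>M) * (\<integral>\<^sup>+y. ?s (e y) \<partial>N)"
      by (simp add: nn_integral_cmult nn_integral_multc)
    also have "(\<integral>\<^sup>+x. ?r (c x) \<partial>M) \<le> ennreal m"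
    proof -
      have "(\<integral>\<^sup>+x. ?r (c x) \<partial>M) = (\<Sum>i\<le>K. ?r i * ennreal (p i))"
        by (subst nn_integral_finite_index[OF c, of ?r]) (auto simp: emp)
      also have "\<dots> \<le> (\<Sum>i\<le>K. ennreal (p' i))"
        using p'0 pq by (intro sum_mono) (auto simp: ennreal_mult[symmetric] intro!: ennreal_leI)
      also have "\<dots> = ennreal m" unfolding m_def using p'0 by (intro sum_ennreal) auto
      finally show ?thesis .
    qed
    also have "(\<integral>\<^sup>+y. ?s (e y) \<partial>N) \<le> 1"
    proof -
      have "(\<integral>\<^sup>+y. ?s (e y) \<partial>N) = (\<Sum>j\<le>K. ?s j * ennreal (q j))"
        by (subst nn_integral_finite_index[OF e, of ?s]) (auto simp: emq)
      also have "\<dots> \<le> (\<Sum>j\<le>K. ennreal (q' j / m))"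
        using q'0 pq m0 by (intro sum_mono) (auto simp: ennreal_mult[symmetric] intro!: ennreal_leI)
      also have "\<dots> = ennreal (m / m)" unfolding mq sum_divide_distrib using q'0 m0 mq by (intro sum_ennreal) auto
      also have "\<dots> \<le> 1" by (cases "m = 0") auto
      finally show ?thesis .
    qed
    finally have "emeasure C ?Q \<le> ennreal m" by (simp add: mult_mono)
    then show ?thesis using m0 by (simp add: C.emeasure_eq_measure)
  qed
  define A where "A = {i. i \<le> K \<and> p' i > 0}"
  define B where "B = {j. j \<le> K \<and> q' j > 0}"
  have AB: "A \<subseteq> {..K}" "B \<subseteq> {..K}" by (auto simp: A_def B_def)
  \<comment> \<open>An edge of \<open>E\<close> has a saturated end, whose residual would be
    0.\<close>
  have "A \<times> B \<inter> E = {}" using \<pi>(5) by (fastforce simp: A_def B_def p'_def q'_def)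
  moreover have "m \<le> measure M {x \<in> space M. c x \<in> A}"
  proof -
    have "m = (\<Sum>i\<in>A. p' i)" unfolding m_def using p'0 by (intro sum.mono_neutral_right) (force simp: A_def less_le)+
    also have "\<dots> \<le> (\<Sum>i\<in>A. p i)" using \<pi>(1) by (intro sum_mono) (simp add: p'_def sum_nonneg)
    also have "\<dots> = measure M {x \<in> space M. c x \<in> A}"
      unfolding p_def by (rule prob_space_sum_finite_index(2)[OF M c AB(1)])
    finally show ?thesis .
  qed
  moreover have "m \<le> measure N {y \<in> space N. e y \<in> B}"
  proof -
    have "m = (\<Sum>i\<in>B. q' i)" unfolding mq using q'0 by (intro sum.mono_neutral_right) (force simp: B_def less_le)+
    also have "\<dots> \<le> (\<Sum>i\<in>B. q i)" using \<pi>(1) by (intro sum_mono) (simp add: q'_def sum_nonneg)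
    also have "\<dots> = measure N {y \<in> space N. e y \<in> B}"
      unfolding q_def by (rule prob_space_sum_finite_index(2)[OF N e AB(2)])
    finally show ?thesis .
  qed
  ultimately show ?thesis using that[OF pC setsC d1 d2 AB] off by (meson order_trans)
qed


section \<open>Discretisation into small cells and construction of near couplings\<close>

lemma mat_space_countable_net:
  "\<exists>z :: nat \<Rightarrow> nat \<Rightarrow> real^'d. (\<forall>i. z i \<in> space (mat_space n)) \<and>
    (\<forall>X\<in>space (mat_space n). \<forall>\<eta>>0. \<exists>i. nfrob n (X - z i) \<le> \<eta>)"
proof -
  obtain D :: "(real^'d) set" where D: "countable D" "\<And>U. open U \<Longrightarrow> U \<noteq> {} \<Longrightarrow> \<exists>d\<in>D. d \<in> U"
    using countable_dense_exists by blast
  let ?P = "PiE {..<n} (\<lambda>_. D)"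
  have cP: "countable ?P" using D(1) by (intro countable_PiE) auto
  have "D \<noteq> {}" using D(2)[of UNIV] by auto
  then have neP: "?P \<noteq> {}" by (simp add: PiE_eq_empty_iff)
  have rng: "range (from_nat_into ?P) = ?P" by (rule range_from_nat_into[OF neP cP])
  show ?thesis
  proof (intro exI[of _ "from_nat_into ?P"] conjI allI ballI impI)
    show "from_nat_into ?P i \<in> space (mat_space n)" for i
      using from_nat_into[OF neP, of i] by (auto simp: mat_space_def space_PiM PiE_def)
    fix X :: "nat \<Rightarrow> real^'d" and \<eta> :: real assume \<eta>: "0 < \<eta>"
    \<comment> \<open>Rows are approximated separately: an error \<eta> in every row gives a
      Frobenius error of at most sqrt n \<eta>, hence \<eta> after normalisation.\<close>
    have "\<exists>w. w \<in> D \<and> norm (X i - w) \<le> \<eta>" for i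
      using D(2)[of "ball (X i) \<eta>"] \<eta> by (force simp: dist_norm)
    then obtain w where w: "\<And>i. w i \<in> D" "\<And>i. norm (X i - w i) \<le> \<eta>" by metis
    have "restrict w {..<n} \<in> ?P" using w by auto
    then obtain i where i: "from_nat_into ?P i = restrict w {..<n}" using rng by (metis imageE)
    have "(\<Sum>i<n. (norm ((X - restrict w {..<n}) i))\<^sup>2) \<le> (\<Sum>i<n. \<eta>\<^sup>2)"
      using w \<eta> by (intro sum_mono power_mono) auto
    then have "frob n (X - restrict w {..<n}) \<le> sqrt (n * \<eta>\<^sup>2)"
      unfolding frob_def by (intro real_sqrt_le_mono) simp
    also have "\<dots> = sqrt n * \<eta>" using \<eta> by (simp add: real_sqrt_mult)
    finally have "nfrob n (X - restrict w {..<n}) \<le> \<eta>"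
      using \<eta> by (cases "n = 0") (auto simp: nfrob_def divide_le_eq mult.commute)
    then show "\<exists>i. nfrob n (X - from_nat_into ?P i) \<le> \<eta>" using i by metis
  qed
qed

text \<open>The points not \<eta>-close to any of the first k net points form sets decreasing to the
  empty set, so by continuity from above one \<open>K\<close> leaves little mass under both laws.
  Index \<open>K\<close> is the waste cell; every other cell lies around its net point.\<close>

lemma finite_cells:
  fixes \<mu> \<nu> :: "(nat \<Rightarrow> real^'d) measure"
  assumes \<mu>: "prob_space \<mu>" "sets \<mu> = sets (mat_space n)" and \<nu>: "prob_space \<nu>" "sets \<nu> = sets (mat_space n)"
    and \<eta>: "\<eta> > 0" and \<delta>: "\<delta> > 0"
  shows "\<exists>(c :: (nat \<Rightarrow> real^'d) \<Rightarrow> nat) z K.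
    c \<in> measurable (mat_space n) (count_space UNIV) \<and> (\<forall>X. c X \<le> K) \<and>
    (\<forall>X. c X < K \<longrightarrow> nfrob n (X - z (c X)) \<le> \<eta>) \<and>
    measure \<mu> {X \<in> space \<mu>. c X = K} \<le> \<delta> \<and> measure \<nu> {X \<in> space \<nu>. c X = K} \<le> \<delta>"
proof -
  obtain z :: "nat \<Rightarrow> nat \<Rightarrow> real^'d" where z: "\<And>i. z i \<in> space (mat_space n)"
    "\<And>X. X \<in> space (mat_space n) \<Longrightarrow> \<exists>i. nfrob n (X - z i) \<le> \<eta>"
    using mat_space_countable_net[of n] \<eta> by blast
  define U where "U k = {X \<in> space (mat_space n). \<forall>i<k. \<eta> < nfrob n (X - z i)}" for k
  have mz: "(\<lambda>X. nfrob n (X - z i)) \<in> borel_measurable (mat_space n)" for i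
    using z(1)[of i] by (intro measurable_nfrob_diff) auto
  have mU: "U k \<in> sets (mat_space n)" for k
  proof -
    have "U k = space (mat_space n) \<inter> (\<Inter>i\<in>{..<k}. {X \<in> space (mat_space n). \<eta> < nfrob n (X - z i)})"
      by (auto simp: U_def)
    moreover have "{X \<in> space (mat_space n). \<eta> < nfrob n (X - z i)} \<in> sets (mat_space n)" for i
      using mz[of i] by measurable
    ultimately show ?thesis by (cases "k = 0") (auto intro!: sets.Int sets.finite_INT)
  qed
  have dec: "decseq U" by (auto simp: decseq_def U_def)
  have emp: "(\<Inter>k. U k) = {}"
  proof -
    have "X \<notin> U (Suc i)" if "nfrob n (X - z i) \<le> \<eta>" for X i using that by (force simp: U_def)
    then show ?thesis using z(2) by (fastforce simp: U_def)
  qed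
  have lim: "(\<lambda>k. measure P (U k)) \<longlonglongrightarrow> 0" if "prob_space P" "sets P = sets (mat_space n)" for P
  proof -
    interpret P: prob_space P by fact
    show ?thesis using P.finite_Lim_measure_decseq[of U] mU dec that(2) emp by auto
  qed
  have "eventually (\<lambda>k. measure \<mu> (U k) < \<delta> \<and> measure \<nu> (U k) < \<delta>) sequentially"
    using order_tendstoD(2)[OF lim[OF \<mu>] \<delta>] order_tendstoD(2)[OF lim[OF \<nu>] \<delta>] by eventually_elim simp
  then obtain K where K: "measure \<mu> (U K) < \<delta>" "measure \<nu> (U K) < \<delta>"
    by (auto simp: eventually_sequentially)
  \<comment> \<open>The alternative \<open>i = K\<close> makes the minimum exist and never exceed
    \<open>K\<close>.\<close>
  define c where "c X = (LEAST i. i = K \<or> nfrob n (X - z i) \<le> \<eta>)" for X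
  have c_prop: "c X = K \<or> nfrob n (X - z (c X)) \<le> \<eta>" for X
    unfolding c_def by (rule LeastI[of "\<lambda>i. i = K \<or> nfrob n (X - z i) \<le> \<eta>" K]) simp
  have c_le: "c X \<le> K" for X unfolding c_def by (rule Least_le) simp
  have cK: "{X \<in> space (mat_space n). c X = K} \<subseteq> U K"
  proof
    fix X assume X: "X \<in> {X \<in> space (mat_space n). c X = K}"
    have "\<eta> < nfrob n (X - z i)" if "i < K" for i
      using not_less_Least[of i "\<lambda>i. i = K \<or> nfrob n (X - z i) \<le> \<eta>"] that X by (simp add: c_def)
    then show "X \<in> U K" using X by (simp add: U_def)
  qed
  show ?thesis
  proof (intro exI[of _ c] exI[of _ z] exI[of _ K] conjI allI impI)
    show "c \<in> measurable (mat_space n) (count_space UNIV)"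
      unfolding c_def using mz by measurable
    show "nfrob n (X - z (c X)) \<le> \<eta>" if "c X < K" for X using c_prop[of X] that by auto
    have "measure P {X \<in> space P. c X = K} \<le> measure P (U K)"
      if "prob_space P" "sets P = sets (mat_space n)" for P
    proof -
      interpret P: prob_space P by fact
      show ?thesis
        using cK mU that(2) sets_eq_imp_space_eq[OF that(2)] by (intro P.finite_measure_mono) auto
    qed
    from this[OF \<mu>] this[OF \<nu>]
    show "measure \<mu> {X \<in> space \<mu>. c X = K} \<le> \<delta>" "measure \<nu> {X \<in> space \<nu>. c X = K} \<le> \<delta>"
      using K by linarith+
  qed (rule c_le)
qed

lemma couplingI:
  assumes "prob_space C" "sets \<mu> = sets (mat_space n)" "sets \<nu> = sets (mat_space n)"
    "sets C = sets (\<mu> \<Otimes>\<^sub>M \<nu>)" "distr C \<mu> fst = \<mu>" "distr C \<nu> snd = \<nu>"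
  shows "coupling n \<mu> \<nu> C"
proof -
  have "distr C (mat_space n) fst = distr C \<mu> fst" "distr C (mat_space n) snd = distr C \<nu> snd"
    using distr_cong[OF refl assms(2)[symmetric] refl] distr_cong[OF refl assms(3)[symmetric] refl] by blast+
  moreover have "sets C = sets (mat_space n \<Otimes>\<^sub>M mat_space n)"
    using assms(4) sets_pair_measure_cong[OF assms(2,3)] by simp
  ultimately show ?thesis using assms by (simp add: coupling_def)
qed

text \<open>Unmatched rows and columns of a greedy matching span no edge, so, apart from the waste
  cell, they form sets more than \<epsilon> apart. By expansion one of the two has mass at most
  \<delta>; the waste cell adds another \<delta>.\<close>

lemma expansion_imp_coupling:
  fixes \<mu> \<nu> :: "(nat \<Rightarrow> real^'d) measure"
  assumes \<mu>: "prob_space \<mu>" "sets \<mu> = sets (mat_space n)" and \<nu>: "prob_space \<nu>" "sets \<nu> = sets (mat_space n)"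
    and \<epsilon>: "\<epsilon> > 0" and \<delta>: "\<delta> > 0"
    and expn: "\<And>A B. A \<in> sets (mat_space n) \<Longrightarrow> B \<in> sets (mat_space n) \<Longrightarrow>
      (\<And>X Y. X \<in> A \<Longrightarrow> Y \<in> B \<Longrightarrow> \<epsilon> < nfrob n (X - Y)) \<Longrightarrow> \<delta> \<le> measure \<mu> A \<Longrightarrow> measure \<nu> B \<le> \<delta>"
  shows "\<exists>C. coupling n \<mu> \<nu> C \<and>
    measure C {p \<in> space C. nfrob n (fst p - snd p) > 2 * \<epsilon>} \<le> 2 * \<delta>"
proof -
  interpret M: prob_space \<mu> by fact
  interpret N: prob_space \<nu> by fact
  have e4: "\<epsilon> / 4 > 0" using \<epsilon> by simp
  obtain c :: "(nat \<Rightarrow> real^'d) \<Rightarrow> nat" and z K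
    where c: "c \<in> measurable (mat_space n) (count_space UNIV)" "\<forall>X. c X \<le> K"
    "\<forall>X. c X < K \<longrightarrow> nfrob n (X - z (c X)) \<le> \<epsilon> / 4"
    "measure \<mu> {X \<in> space \<mu>. c X = K} \<le> \<delta>" "measure \<nu> {X \<in> space \<nu>. c X = K} \<le> \<delta>"
    using finite_cells[OF \<mu> \<nu> e4 \<delta>] by blast
  note c = c(1) c(2,3)[rule_format] c(4,5)
  \<comment> \<open>With cells of radius \<epsilon>/4, the threshold 3/2 \<epsilon> fits both needs:
    adjacent cells contain only points within 3/2 + 1/4 + 1/4 = 2 times \<epsilon>, and points
    within \<epsilon> lie in adjacent cells, as 1 + 1/4 + 1/4 = 3/2.\<close>
  define E where "E = {(i, j). i < K \<and> j < K \<and> nfrob n (z i - z j) \<le> 3 / 2 * \<epsilon>}"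
  have sp: "space \<mu> = space (mat_space n)" "space \<nu> = space (mat_space n)"
    using \<mu>(2) \<nu>(2) by (auto dest: sets_eq_imp_space_eq)
  have cm: "c \<in> measurable \<mu> (count_space UNIV)" "c \<in> measurable \<nu> (count_space UNIV)"
    using c(1) by (simp_all add: measurable_cong_sets[OF \<mu>(2) refl] measurable_cong_sets[OF \<nu>(2) refl])
  have E: "E \<subseteq> {..K} \<times> {..K}" by (auto simp: E_def)
  obtain C A B where C: "prob_space C" "sets C = sets (\<mu> \<Otimes>\<^sub>M \<nu>)" "distr C \<mu> fst = \<mu>" "distr C \<nu> snd = \<nu>"
    and AB: "A \<subseteq> {..K}" "B \<subseteq> {..K}" "A \<times> B \<inter> E = {}"
    and le: "measure C {p \<in> space C. (c (fst p), c (snd p)) \<notin> E} \<le> measure \<mu> {X \<in> space \<mu>. c X \<in> A}"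
      "measure C {p \<in> space C. (c (fst p), c (snd p)) \<notin> E} \<le> measure \<nu> {X \<in> space \<nu>. c X \<in> B}"
    by (rule greedy_coupling[OF \<mu>(1) \<nu>(1) cm(1) c(2) cm(2) c(2) E]) blast
  interpret C: prob_space C by fact
  have near: "nfrob n (X - Y) \<le> 2 * \<epsilon>" if "(c X, c Y) \<in> E" for X Y
  proof -
    have "c X < K" "c Y < K" "nfrob n (z (c X) - z (c Y)) \<le> 3 / 2 * \<epsilon>" using that by (auto simp: E_def)
    then show ?thesis
      using nfrob_triangle[of n X Y "z (c X)"] nfrob_triangle[of n "z (c X)" Y "z (c Y)"] c(3)[of X] c(3)[of Y]
      by (simp add: nfrob_minus_commute[of n "z (c Y)" Y])
  qed
  have far: "\<epsilon> < nfrob n (X - Y)" if "c X \<in> A" "c X < K" "c Y \<in> B" "c Y < K" for X Y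
  proof (rule ccontr)
    assume "\<not> \<epsilon> < nfrob n (X - Y)"
    then have "nfrob n (z (c X) - z (c Y)) \<le> 3 / 2 * \<epsilon>"
      using nfrob_triangle[of n "z (c X)" "z (c Y)" X] nfrob_triangle[of n X "z (c Y)" Y] c(3)[of X] c(3)[of Y] that
      by (simp add: nfrob_minus_commute[of n "z (c X)" X])
    then have "(c X, c Y) \<in> E" using that by (simp add: E_def)
    then show False using that AB(3) by blast
  qed
  define A' where "A' = {X \<in> space (mat_space n). c X \<in> A \<and> c X < K}"
  define B' where "B' = {X \<in> space (mat_space n). c X \<in> B \<and> c X < K}"
  have cms: "{X \<in> space (mat_space n). P (c X)} \<in> sets (mat_space n)" for P
    using measurable_sets[OF c(1), of "Collect P"] by (simp add: vimage_def Int_def conj_commute)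
  have m: "A' \<in> sets (mat_space n)" "B' \<in> sets (mat_space n)"
    unfolding A'_def B'_def by (rule cms)+
  have mK: "{X \<in> space (mat_space n). c X = K} \<in> sets (mat_space n)" by (rule cms)
  have a: "measure \<mu> {X \<in> space \<mu>. c X \<in> A} \<le> measure \<mu> A' + \<delta>"
  proof -
    have "measure \<mu> {X \<in> space \<mu>. c X \<in> A} \<le> measure \<mu> (A' \<union> {X \<in> space \<mu>. c X = K})"
      using m mK \<mu>(2) sp AB(1) by (intro M.finite_measure_mono) (auto simp: A'_def le_less)
    also have "\<dots> \<le> measure \<mu> A' + measure \<mu> {X \<in> space \<mu>. c X = K}"
      using m mK \<mu>(2) sp by (intro measure_Un_le) auto
    finally show ?thesis using c(4) by simp
  qed
  have b: "measure \<nu> {X \<in> space \<nu>. c X \<in> B} \<le> measure \<nu> B' + \<delta>"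
  proof -
    have "measure \<nu> {X \<in> space \<nu>. c X \<in> B} \<le> measure \<nu> (B' \<union> {X \<in> space \<nu>. c X = K})"
      using m mK \<nu>(2) sp AB(2) by (intro N.finite_measure_mono) (auto simp: B'_def le_less)
    also have "\<dots> \<le> measure \<nu> B' + measure \<nu> {X \<in> space \<nu>. c X = K}"
      using m mK \<nu>(2) sp by (intro measure_Un_le) auto
    finally show ?thesis using c(5) by simp
  qed
  have "measure C {p \<in> space C. (c (fst p), c (snd p)) \<notin> E} \<le> 2 * \<delta>"
  proof (cases "\<delta> \<le> measure \<mu> A'")
    case True
    then have "measure \<nu> B' \<le> \<delta>"
      by (intro expn[OF m]) (auto simp: A'_def B'_def intro: far)
    then show ?thesis using b le(2) by simp
  next
    case False
    then show ?thesis using a le(1) by simp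
  qed
  moreover have "measure C {p \<in> space C. nfrob n (fst p - snd p) > 2 * \<epsilon>}
      \<le> measure C {p \<in> space C. (c (fst p), c (snd p)) \<notin> E}"
  proof (rule C.finite_measure_mono)
    show "{p \<in> space C. nfrob n (fst p - snd p) > 2 * \<epsilon>} \<subseteq> {p \<in> space C. (c (fst p), c (snd p)) \<notin> E}"
      using near by force
    note [measurable] = cm and [measurable_cong] = C(2)
    show "{p \<in> space C. (c (fst p), c (snd p)) \<notin> E} \<in> sets C" by measurable
  qed
  ultimately show ?thesis using couplingI[OF C(1) \<mu>(2) \<nu>(2) C(2-4)] by (meson order_trans)
qed

text \<open>The test functions are the truncated distances to the sets \<open>A\<close>: they vanish on \<open>A\<close> but have mean
  bounded away from zero if a set \<open>B\<close> far from \<open>A\<close> carries mass.\<close>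

lemma Lipschitz_concentration_imp_expansion:
  fixes \<mu> \<nu> :: "nat \<Rightarrow> (nat \<Rightarrow> real^'d) measure"
  assumes \<mu>: "\<And>n. prob_space (\<mu> n)" "\<And>n. sets (\<mu> n) = sets (mat_space n)"
    and \<nu>: "\<And>n. prob_space (\<nu> n)" "\<And>n. sets (\<nu> n) = sets (mat_space n)"
    and conc: "\<And>\<psi> \<tau>. (\<And>n X Y. X \<in> space (mat_space n) \<Longrightarrow> Y \<in> space (mat_space n) \<Longrightarrow>
        \<bar>\<psi> n X - \<psi> n Y\<bar> \<le> nfrob n (X - Y)) \<Longrightarrow> 0 < \<tau> \<Longrightarrow>
        (\<lambda>n. measure (\<mu> n) {X \<in> space (\<mu> n). \<bar>\<psi> n X - (\<integral>Y. \<psi> n Y \<partial>\<nu> n)\<bar> > \<tau>}) \<longlonglongrightarrow> 0"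
    and \<epsilon>: "\<epsilon> > 0" and \<delta>: "\<delta> > 0"
  shows "eventually (\<lambda>n. \<forall>A\<in>sets (mat_space n). \<forall>B\<in>sets (mat_space n).
    (\<forall>X\<in>A. \<forall>Y\<in>B. \<epsilon> < nfrob n (X - Y)) \<longrightarrow> \<delta> \<le> measure (\<mu> n) A \<longrightarrow> measure (\<nu> n) B \<le> \<delta>) sequentially"
proof -
  define bad where "bad n A B \<longleftrightarrow> A \<in> sets (mat_space n) \<and> B \<in> sets (mat_space n) \<and>
    (\<forall>X\<in>A. \<forall>Y\<in>B. \<epsilon> < nfrob n (X - Y)) \<and> \<delta> \<le> measure (\<mu> n) A \<and> \<delta> < measure (\<nu> n) B" for n A B
  \<comment> \<open>One violating set is chosen for each n, so a single sequence of test functions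
    refutes all violations at once. The default \<open>space (mat_space n)\<close> keeps the set
    nonempty, as the infimum below requires.\<close>
  define A where "A n = (if \<exists>A B. bad n A B then SOME A. \<exists>B. bad n A B else space (mat_space n))" for n
  have badA: "\<exists>B. bad n (A n) B" if "\<exists>A B. bad n A B" for n
    using someI_ex[OF that] that by (simp add: A_def)
  have Ane: "A n \<noteq> {}" for n
  proof (cases "\<exists>A B. bad n A B")
    case True
    then show ?thesis using badA[OF True] \<delta> by (auto simp: bad_def)
  next
    case False
    have "space (\<mu> n) \<noteq> {}" using \<mu>(1) by (rule prob_space.not_empty)
    then show ?thesis using False sets_eq_imp_space_eq[OF \<mu>(2)] by (simp add: A_def)
  qed
  define d where "d n X = (INF a\<in>A n. nfrob n (X - a))" for n X
  have bb: "bdd_below ((\<lambda>a. nfrob n (X - a)) ` A n)" for n X by (auto intro!: bdd_belowI[of _ 0])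
  have d0: "0 \<le> d n X" for n X unfolding d_def using Ane by (intro cINF_greatest) auto
  have dA: "d n X = 0" if "X \<in> A n" for n X
  proof -
    have "d n X \<le> nfrob n (X - X)" unfolding d_def using that bb by (intro cINF_lower) auto
    also have "nfrob n (X - X) = 0" by (simp add: nfrob_def frob_def)
    finally show ?thesis using d0[of n X] by simp
  qed
  have dl: "d n X \<le> nfrob n (X - Y) + d n Y" for n X Y
  proof -
    have "d n X - nfrob n (X - Y) \<le> d n Y"
      unfolding d_def[of n Y]
    proof (rule cINF_greatest[OF Ane])
      fix a assume "a \<in> A n"
      then have "d n X \<le> nfrob n (X - a)" unfolding d_def using bb by (intro cINF_lower)
      also have "\<dots> \<le> nfrob n (X - Y) + nfrob n (Y - a)" by (rule nfrob_triangle)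
      finally show "d n X - nfrob n (X - Y) \<le> nfrob n (Y - a)" by simp
    qed
    then show ?thesis by simp
  qed
  \<comment> \<open>Truncation at 1 makes the function integrable under every probability law and
    keeps it 1-Lipschitz.\<close>
  define \<psi> where "\<psi> n X = min 1 (d n X)" for n X
  have \<psi>01: "0 \<le> \<psi> n X" "\<psi> n X \<le> 1" for n X using d0 by (auto simp: \<psi>_def)
  have \<psi>l: "\<bar>\<psi> n X - \<psi> n Y\<bar> \<le> nfrob n (X - Y)" for n X Y
    using dl[of n X Y] dl[of n Y X] nfrob_nonneg[of n "X - Y"] unfolding \<psi>_def nfrob_minus_commute[of n Y X]
    by linarith
  \<comment> \<open>Half of a lower bound for the mean: \<open>\<psi>\<close> is at least
    \<open>min 1 \<epsilon>\<close> on a set of mass above \<delta>. On \<open>A n\<close> it is 0,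
    so all of \<open>A n\<close> deviates by more than \<open>\<tau>\<close>.\<close>
  define \<tau> where "\<tau> = min 1 \<epsilon> * \<delta> / 2"
  have \<tau>: "\<tau> > 0" using \<epsilon> \<delta> by (simp add: \<tau>_def)
  have "(\<lambda>n. measure (\<mu> n) {X \<in> space (\<mu> n). \<bar>\<psi> n X - (\<integral>Y. \<psi> n Y \<partial>\<nu> n)\<bar> > \<tau>}) \<longlonglongrightarrow> 0"
    using \<psi>l \<tau> by (intro conc) auto
  from order_tendstoD(2)[OF this \<delta>] eventually_gt_at_top[of 0]
  have "eventually (\<lambda>n. \<not> (\<exists>A B. bad n A B)) sequentially"
  proof eventually_elim
    case (elim n)
    show ?case
    proof
      assume "\<exists>A B. bad n A B"
      from badA[OF this] obtain B where B: "A n \<in> sets (mat_space n)" "B \<in> sets (mat_space n)"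
        "\<And>X Y. X \<in> A n \<Longrightarrow> Y \<in> B \<Longrightarrow> \<epsilon> < nfrob n (X - Y)" "\<delta> \<le> measure (\<mu> n) (A n)" "\<delta> < measure (\<nu> n) B"
        by (auto simp: bad_def)
      interpret M: prob_space "\<mu> n" by (rule \<mu>)
      interpret N: prob_space "\<nu> n" by (rule \<nu>)
      have \<psi>m: "\<psi> n \<in> borel_measurable (mat_space n)"
      proof (rule measurable_pseudo_Lipschitz[OF elim(2), of 1 _ 0])
        show "\<bar>\<psi> n X - \<psi> n Y\<bar> \<le> nfrob n (X - Y) * (1 + nfrob n X ^ 0 + nfrob n Y ^ 0)" for X Y
          using \<psi>l[of n X Y] nfrob_nonneg[of n "X - Y"] by simp
      qed simp
      have \<psi>M[measurable]: "\<psi> n \<in> borel_measurable (\<mu> n)" using \<psi>m by (simp add: measurable_cong_sets[OF \<mu>(2) refl])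
      have \<psi>N[measurable]: "\<psi> n \<in> borel_measurable (\<nu> n)" using \<psi>m by (simp add: measurable_cong_sets[OF \<nu>(2) refl])
      have \<psi>B: "min 1 \<epsilon> \<le> \<psi> n Y" if "Y \<in> B" for Y
      proof -
        have "\<epsilon> \<le> d n Y" unfolding d_def
        proof (rule cINF_greatest[OF Ane])
          fix a assume "a \<in> A n"
          then show "\<epsilon> \<le> nfrob n (Y - a)" using B(3)[OF _ that, of a] by (simp add: nfrob_minus_commute[of n Y a])
        qed
        then show ?thesis by (auto simp: \<psi>_def)
      qed
      have "(\<integral>Y. min 1 \<epsilon> * indicator B Y \<partial>\<nu> n) \<le> (\<integral>Y. \<psi> n Y \<partial>\<nu> n)"
      proof (rule integral_mono)
        show "integrable (\<nu> n) (\<lambda>Y. min 1 \<epsilon> * indicator B Y)"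
          using B(2) \<nu>(2)[of n]
          by (intro integrable_mult_right integrable_real_indicator) (auto simp: N.emeasure_eq_measure)
        show "integrable (\<nu> n) (\<psi> n)" using \<psi>01 by (intro N.integrable_const_bound[where B=1]) auto
        show "min 1 \<epsilon> * indicator B Y \<le> \<psi> n Y" for Y using \<psi>B[of Y] \<psi>01[of n Y] by (simp add: indicator_def)
      qed
      moreover have "(\<integral>Y. min 1 \<epsilon> * indicator B Y \<partial>\<nu> n) = min 1 \<epsilon> * measure (\<nu> n) B" using B(2) \<nu>(2)[of n] by simp
      moreover have "min 1 \<epsilon> * \<delta> < min 1 \<epsilon> * measure (\<nu> n) B" using B(5) \<epsilon> by simp
      ultimately have big: "\<tau> < (\<integral>Y. \<psi> n Y \<partial>\<nu> n)" using \<tau> unfolding \<tau>_def by linarith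
      have "measure (\<mu> n) (A n) \<le> measure (\<mu> n) {X \<in> space (\<mu> n). \<bar>\<psi> n X - (\<integral>Y. \<psi> n Y \<partial>\<nu> n)\<bar> > \<tau>}"
      proof (rule M.finite_measure_mono)
        show "A n \<subseteq> {X \<in> space (\<mu> n). \<bar>\<psi> n X - (\<integral>Y. \<psi> n Y \<partial>\<nu> n)\<bar> > \<tau>}"
        proof
          fix X assume X: "X \<in> A n"
          have "X \<in> space (\<mu> n)" using sets.sets_into_space[OF B(1)] X sets_eq_imp_space_eq[OF \<mu>(2)] by auto
          moreover have "\<psi> n X = 0" using dA[OF X] by (simp add: \<psi>_def)
          ultimately show "X \<in> {X \<in> space (\<mu> n). \<bar>\<psi> n X - (\<integral>Y. \<psi> n Y \<partial>\<nu> n)\<bar> > \<tau>}" using big by simp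
        qed
      qed measurable
      then show False using B(4) elim(1) by linarith
    qed
  qed
  then show ?thesis
  proof (rule eventually_mono, intro ballI impI)
    fix n A B assume "\<nexists>A B. bad n A B" and "A \<in> sets (mat_space n)" "B \<in> sets (mat_space n)"
      "\<forall>X\<in>A. \<forall>Y\<in>B. \<epsilon> < nfrob n (X - Y)" "\<delta> \<le> measure (\<mu> n) A"
    then show "measure (\<nu> n) B \<le> \<delta>" unfolding bad_def not_less[symmetric] by blast
  qed
qed

text \<open>With a single cell and no edges the greedy construction is the product coupling. It
  fills in those n about which eventual statements say nothing.\<close>

lemma coupling_exists:
  assumes "prob_space \<mu>" "sets \<mu> = sets (mat_space n)" "prob_space \<nu>" "sets \<nu> = sets (mat_space n)"
  shows "\<exists>C. coupling n \<mu> \<nu> C"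
proof (rule greedy_coupling[OF assms(1,3), where c = "\<lambda>_. 0" and e = "\<lambda>_. 0" and K = 0 and E = "{}"])
  fix C assume "prob_space C" "sets C = sets (\<mu> \<Otimes>\<^sub>M \<nu>)" "distr C \<mu> fst = \<mu>" "distr C \<nu> snd = \<nu>"
  then show ?thesis using couplingI[OF _ assms(2,4)] by blast
qed simp_all

text \<open>For each n, a coupling of the best accuracy 1 / (k + 1) available with k <= n is taken.
  Every fixed accuracy is eventually available, so the chosen one tends to 0.\<close>

lemma diagonal_coupling:
  fixes \<mu> \<nu> :: "nat \<Rightarrow> (nat \<Rightarrow> real^'d) measure"
  assumes ex: "\<And>n. \<exists>C. coupling n (\<mu> n) (\<nu> n) C"
    and ev: "\<And>\<epsilon>. \<epsilon> > 0 \<Longrightarrow> eventually (\<lambda>n. \<exists>C. coupling n (\<mu> n) (\<nu> n) C \<and>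
      measure C {p \<in> space C. nfrob n (fst p - snd p) > \<epsilon>} \<le> \<epsilon>) sequentially"
  shows "\<exists>C. (\<forall>n. coupling n (\<mu> n) (\<nu> n) (C n)) \<and>
    (\<forall>\<epsilon>>0. (\<lambda>n. measure (C n) {p \<in> space (C n). nfrob n (fst p - snd p) > \<epsilon>}) \<longlonglongrightarrow> 0)"
proof -
  define P where "P n k C \<longleftrightarrow> coupling n (\<mu> n) (\<nu> n) C \<and>
    measure C {p \<in> space C. nfrob n (fst p - snd p) > 1 / Suc k} \<le> 1 / Suc k" for n k C
  \<comment> \<open>The cap \<open>k \<le> n\<close> makes the maximum exist. Level 0 is always
    attained, since its bound on the probability is 1.\<close>
  define S where "S n = {k. k \<le> n \<and> (\<exists>C. P n k C)}" for n
  have "0 \<in> S n" for n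
  proof -
    obtain C where C: "coupling n (\<mu> n) (\<nu> n) C" using ex by blast
    then interpret prob_space C by (simp add: coupling_def)
    show ?thesis using C by (auto simp: S_def P_def)
  qed
  then have S: "finite (S n)" "S n \<noteq> {}" for n by (auto simp: S_def)
  define k where "k n = Max (S n)" for n
  have "\<exists>C. P n (k n) C" for n using Max_in[OF S, of n] by (simp add: k_def S_def)
  then obtain C where C: "\<And>n. P n (k n) (C n)" by metis
  show ?thesis
  proof (intro exI[of _ C] conjI allI impI)
    show cp: "coupling n (\<mu> n) (\<nu> n) (C n)" for n using C by (simp add: P_def)
    fix \<epsilon> :: real assume \<epsilon>: "\<epsilon> > 0"
    show "(\<lambda>n. measure (C n) {p \<in> space (C n). nfrob n (fst p - snd p) > \<epsilon>}) \<longlonglongrightarrow> 0"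
    proof (rule tendstoI)
      fix r :: real assume r: "0 < r"
      obtain j where j: "1 / Suc j < min \<epsilon> r" using reals_Archimedean[of "min \<epsilon> r"] \<epsilon> r by (auto simp: inverse_eq_divide)
      have "eventually (\<lambda>n. \<exists>C. P n j C) sequentially" using ev[of "1 / Suc j"] by (simp add: P_def)
      then show "eventually (\<lambda>n. dist (measure (C n) {p \<in> space (C n). nfrob n (fst p - snd p) > \<epsilon>}) 0 < r) sequentially"
        using eventually_ge_at_top[of j]
      proof eventually_elim
        case (elim n)
        then have "j \<in> S n" by (simp add: S_def)
        then have "j \<le> k n" using S by (simp add: k_def)
        then have kj: "1 / Suc (k n) \<le> 1 / Suc j" by (intro divide_left_mono) auto
        interpret C: prob_space "C n" using cp[of n] by (simp add: coupling_def)
        have sC: "sets (C n) = sets (mat_space n \<Otimes>\<^sub>M mat_space n)" using cp[of n] by (simp add: coupling_def)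
        have [measurable]: "(\<lambda>p. nfrob n (fst p - snd p)) \<in> borel_measurable (C n)"
          by (intro measurable_nfrob_diff) (simp_all add: measurable_cong_sets[OF sC refl])
        have "measure (C n) {p \<in> space (C n). nfrob n (fst p - snd p) > \<epsilon>}
            \<le> measure (C n) {p \<in> space (C n). nfrob n (fst p - snd p) > 1 / Suc (k n)}"
          using kj j by (intro C.finite_measure_mono) auto
        also have "\<dots> \<le> 1 / Suc (k n)" using C[of n] by (simp add: P_def)
        also have "\<dots> < r" using kj j by simp
        finally show ?case by simp
      qed
    qed
  qed
qed


section \<open>The equivalence\<close>

text \<open>Replaces the real exponent by a natural one. The extra 1 for each matrix is what raises
  the constant 1 of the theorem to 3.\<close>

lemma rpow_le_one_plus_power:
  assumes "0 \<le> x" "0 \<le> a" "a \<le> real k"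
  shows "rpow x a \<le> 1 + x ^ k"
proof (cases "x \<le> 1")
  case True
  have "x powr a \<le> 1" using True assms by (intro powr_le1) auto
  then show ?thesis using assms by (auto simp: rpow_def add_increasing2)
next
  case False
  then have "x powr a \<le> x powr real k" using assms by (intro powr_mono) auto
  then show ?thesis using False assms by (auto simp: rpow_def powr_realpow)
qed

text \<open>A large deviation of \<open>\<psi>\<close> at X forces one of three events: X and Y are
  more than \<eta> apart, Y is outside the ball of radius \<open>R\<close>, or \<open>\<psi>\<close>
  at Y deviates from its mean by more than half as much. First \<open>R\<close> is fixed, then
  \<eta> in terms of \<open>R\<close>, and only then n grows.\<close>

lemma coupling_imp_concentration:
  fixes \<mu> \<nu> :: "nat \<Rightarrow> (nat \<Rightarrow> real^'d) measure" and \<Sigma> :: "nat \<Rightarrow> real^'d^'d"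
  assumes \<nu>: "\<And>n. gauss_matrix n (\<Sigma> n) (\<nu> n)" and S: "\<And>n. psd (\<Sigma> n)" "\<And>n. opnorm (\<Sigma> n) \<le> c"
    and C: "\<And>n. coupling n (\<mu> n) (\<nu> n) (C n)"
    and C0: "\<And>\<eta>. \<eta> > 0 \<Longrightarrow> (\<lambda>n. measure (C n) {p \<in> space (C n). nfrob n (fst p - snd p) > \<eta>}) \<longlonglongrightarrow> 0"
    and lip: "\<And>n X Y. X \<in> space (mat_space n) \<Longrightarrow> Y \<in> space (mat_space n) \<Longrightarrow>
      \<bar>\<psi> n X - \<psi> n Y\<bar> \<le> nfrob n (X - Y) * (3 + nfrob n X ^ k + nfrob n Y ^ k)"
    and \<epsilon>: "\<epsilon> > 0"
  shows "(\<lambda>n. measure (\<mu> n) {X \<in> space (\<mu> n). \<bar>\<psi> n X - (\<integral>Y. \<psi> n Y \<partial>\<nu> n)\<bar> > \<epsilon>}) \<longlonglongrightarrow> 0"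
proof (rule tendstoI)
  fix r :: real assume r: "r > 0"
  define H where "H = exp (c + 1 + c * CARD('d))"
  define b where "b = 2 * ((8 + fact (k + 2)) * H)"
  \<comment> \<open>Makes the errors that do not decay with n, the tail H / R and the cutoff error,
    add up to at most r / 2.\<close>
  define R where "R = max 1 ((H + 2 / \<epsilon> * b) / (r / 2))"
  define a where "a = 2 * exp c * (11 + 4 * (2 * R) ^ k)"
  have H0: "H > 0" by (simp add: H_def)
  have b0: "b > 0" unfolding b_def using H0 by (intro mult_pos_pos add_pos_nonneg) auto
  have R: "R \<ge> 1" by (simp add: R_def)
  have Rr: "(H + 2 / \<epsilon> * b) / R \<le> r / 2"
  proof -
    have "(H + 2 / \<epsilon> * b) / (r / 2) \<le> R" by (simp add: R_def)
    then show ?thesis using r R by (simp add: divide_le_eq mult.commute)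
  qed
  \<comment> \<open>The bound 1 keeps X in the ball of radius \<open>R + 1\<close>; the other bound
    then makes \<open>\<psi>\<close> change by at most \<epsilon>/2 between X and Y.\<close>
  define \<eta> where "\<eta> = min 1 (\<epsilon> / 2 / (3 + 2 * (R + 1) ^ k))"
  have pp: "3 + 2 * (R + 1) ^ k > 0" using R by (intro add_pos_nonneg) auto
  have \<eta>: "\<eta> > 0" "\<eta> \<le> 1" using \<epsilon> pp by (auto simp: \<eta>_def)
  have \<eta>\<epsilon>: "\<eta> * (3 + 2 * (R + 1) ^ k) \<le> \<epsilon> / 2"
  proof -
    have "\<eta> \<le> \<epsilon> / 2 / (3 + 2 * (R + 1) ^ k)" by (simp add: \<eta>_def)
    then show ?thesis using pp by (simp only: pos_le_divide_eq)
  qed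
  have "(\<lambda>n. 1 / sqrt (real n)) \<longlonglongrightarrow> 0"
    by (intro tendsto_divide_0[OF tendsto_const] filterlim_at_top_imp_at_infinity
        filterlim_compose[OF sqrt_at_top] filterlim_real_sequentially)
  then have "(\<lambda>n. measure (C n) {p \<in> space (C n). nfrob n (fst p - snd p) > \<eta>} + 2 / \<epsilon> * a * (1 / sqrt n)) \<longlonglongrightarrow> 0 + 2 / \<epsilon> * a * 0"
    by (intro tendsto_intros C0 \<eta>)
  then have "eventually (\<lambda>n. measure (C n) {p \<in> space (C n). nfrob n (fst p - snd p) > \<eta>} + 2 / \<epsilon> * a * (1 / sqrt n) < r / 2) sequentially"
    using r by (intro order_tendstoD(2)) auto
  then show "eventually (\<lambda>n. dist (measure (\<mu> n) {X \<in> space (\<mu> n). \<bar>\<psi> n X - (\<integral>Y. \<psi> n Y \<partial>\<nu> n)\<bar> > \<epsilon>}) 0 < r) sequentially"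
    using eventually_gt_at_top[of 0]
  proof eventually_elim
    case (elim n)
    define m where "m = (\<integral>Y. \<psi> n Y \<partial>\<nu> n)"
    interpret N: prob_space "\<nu> n" using \<nu>[of n] by (simp add: gauss_matrix_def)
    interpret C: prob_space "C n" using C[of n] by (simp add: coupling_def)
    have sN: "sets (\<nu> n) = sets (mat_space n)" using \<nu>[of n] by (simp add: gauss_matrix_def)
    have sC: "sets (C n) = sets (mat_space n \<Otimes>\<^sub>M mat_space n)" and d1: "distr (C n) (mat_space n) fst = \<mu> n"
      and d2: "distr (C n) (mat_space n) snd = \<nu> n" using C[of n] by (auto simp: coupling_def)
    have spC: "space (C n) = space (mat_space n) \<times> space (mat_space n)"
      using sets_eq_imp_space_eq[OF sC] by (simp add: space_pair_measure)
    have fs[measurable]: "fst \<in> measurable (C n) (mat_space n)" "snd \<in> measurable (C n) (mat_space n)"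
      by (simp_all add: measurable_cong_sets[OF sC refl])
    have \<psi>m[measurable]: "\<psi> n \<in> borel_measurable (mat_space n)"
      by (rule measurable_pseudo_Lipschitz[OF elim(2) _ lip]) auto
    have nm[measurable]: "nfrob n \<in> borel_measurable (mat_space n)" by (rule measurable_nfrob)
    have dm[measurable]: "(\<lambda>p. nfrob n (fst p - snd p)) \<in> borel_measurable (C n)"
      by (intro measurable_nfrob_diff fs)
    have pull1: "measure (\<mu> n) {X \<in> space (\<mu> n). P X} = measure (C n) {p \<in> space (C n). P (fst p)}"
      if "{X \<in> space (mat_space n). P X} \<in> sets (mat_space n)" for P
      unfolding d1[symmetric] using that
      by (subst measure_distr[OF fs(1)]) (auto simp: spC intro!: arg_cong[where f = "measure (C n)"])
    have pull2: "measure (\<nu> n) {X \<in> space (\<nu> n). P X} = measure (C n) {p \<in> space (C n). P (snd p)}"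
      if "{X \<in> space (mat_space n). P X} \<in> sets (mat_space n)" for P
      unfolding d2[symmetric] using that
      by (subst measure_distr[OF fs(2)]) (auto simp: spC intro!: arg_cong[where f = "measure (C n)"])
    note conc = gauss_matrix_pseudo_Lipschitz_concentration[OF \<nu> S(1) S(2) elim(2) lip R]
    note em = gauss_matrix_exp_nfrob[OF \<nu> S(1) S(2) elim(2)]
    have t1: "measure (\<nu> n) {Y \<in> space (\<nu> n). nfrob n Y > R} \<le> H / R"
    proof -
      have [measurable]: "nfrob n \<in> borel_measurable (\<nu> n)" by (simp add: measurable_cong_sets[OF sN refl])
      have "measure (\<nu> n) {Y \<in> space (\<nu> n). nfrob n Y > R} \<le> measure (\<nu> n) {Y \<in> space (\<nu> n). exp (nfrob n Y) \<ge> R}"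
      proof (rule N.finite_measure_mono)
        \<comment> \<open>Since exp t exceeds t, Markov's inequality for the exponential moment
          already gives the decay 1 / R.\<close>
        have "R \<le> exp (nfrob n Y)" if "R < nfrob n Y" for Y
          using exp_ge_add_one_self[of "nfrob n Y"] that by linarith
        then show "{Y \<in> space (\<nu> n). nfrob n Y > R} \<subseteq> {Y \<in> space (\<nu> n). exp (nfrob n Y) \<ge> R}" by auto
      qed measurable
      also have "\<dots> \<le> (\<integral>Y. exp (nfrob n Y) \<partial>\<nu> n) / R"
        using R em(1) by (intro integral_Markov_inequality_measure[where A = "{}"]) auto
      also have "\<dots> \<le> H / R" unfolding H_def using R by (intro divide_right_mono em(2)) auto
      finally show ?thesis .
    qed
    have t2: "measure (\<nu> n) {Y \<in> space (\<nu> n). \<bar>\<psi> n Y - m\<bar> > \<epsilon> / 2} \<le> 2 / \<epsilon> * (a / sqrt n + b / R)"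
    proof -
      have [measurable]: "\<psi> n \<in> borel_measurable (\<nu> n)" by (simp add: measurable_cong_sets[OF sN refl])
      have "measure (\<nu> n) {Y \<in> space (\<nu> n). \<bar>\<psi> n Y - m\<bar> > \<epsilon> / 2} \<le> measure (\<nu> n) {Y \<in> space (\<nu> n). \<bar>\<psi> n Y - m\<bar> \<ge> \<epsilon> / 2}"
        by (intro N.finite_measure_mono) auto
      also have "\<dots> \<le> (\<integral>Y. \<bar>\<psi> n Y - m\<bar> \<partial>\<nu> n) / (\<epsilon> / 2)"
        using \<epsilon> conc(1) by (intro integral_Markov_inequality_measure[where A = "{}"]) auto
      also have "\<dots> \<le> (a / sqrt n + b / R) / (\<epsilon> / 2)"
        unfolding m_def a_def b_def H_def using \<epsilon> by (intro divide_right_mono conc(2)) auto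
      finally show ?thesis by (simp add: mult.commute)
    qed
    let ?A = "{p \<in> space (C n). nfrob n (fst p - snd p) > \<eta>}"
    let ?B = "{p \<in> space (C n). nfrob n (snd p) > R}"
    let ?D = "{p \<in> space (C n). \<bar>\<psi> n (snd p) - m\<bar> > \<epsilon> / 2}"
    have "measure (\<mu> n) {X \<in> space (\<mu> n). \<bar>\<psi> n X - m\<bar> > \<epsilon>} = measure (C n) {p \<in> space (C n). \<bar>\<psi> n (fst p) - m\<bar> > \<epsilon>}"
      by (rule pull1) measurable
    also have "\<dots> \<le> measure (C n) (?A \<union> ?B \<union> ?D)"
    proof (rule C.finite_measure_mono)
      show "{p \<in> space (C n). \<bar>\<psi> n (fst p) - m\<bar> > \<epsilon>} \<subseteq> ?A \<union> ?B \<union> ?D"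
      proof (rule subsetI, rule ccontr)
        fix p assume p: "p \<in> {p \<in> space (C n). \<bar>\<psi> n (fst p) - m\<bar> > \<epsilon>}" and "p \<notin> ?A \<union> ?B \<union> ?D"
        then have le: "nfrob n (fst p - snd p) \<le> \<eta>" "nfrob n (snd p) \<le> R" "\<bar>\<psi> n (snd p) - m\<bar> \<le> \<epsilon> / 2"
          and sp: "fst p \<in> space (mat_space n)" "snd p \<in> space (mat_space n)" by (auto simp: spC)
        have "nfrob n (fst p) \<le> R + 1" using nfrob_le_add_diff[of n "fst p" "snd p"] le \<eta> by linarith
        then have pw: "nfrob n (fst p) ^ k \<le> (R + 1) ^ k" "nfrob n (snd p) ^ k \<le> (R + 1) ^ k"
          using le(2) by (intro power_mono; simp)+
        have "\<bar>\<psi> n (fst p) - \<psi> n (snd p)\<bar> \<le> \<eta> * (3 + 2 * (R + 1) ^ k)"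
          using le(1) pw \<eta> by (intro order_trans[OF lip[OF sp]] mult_mono) auto
        then have "\<bar>\<psi> n (fst p) - \<psi> n (snd p)\<bar> \<le> \<epsilon> / 2" using \<eta>\<epsilon> by linarith
        then have "\<bar>\<psi> n (fst p) - m\<bar> \<le> \<epsilon>" using le(3) by linarith
        then show False using p by simp
      qed
    qed measurable
    also have "\<dots> \<le> measure (C n) ?A + measure (C n) ?B + measure (C n) ?D"
      by (intro order_trans[OF measure_Un_le] add_right_mono measure_Un_le) measurable
    also have "measure (C n) ?B = measure (\<nu> n) {Y \<in> space (\<nu> n). nfrob n Y > R}"
      by (rule pull2[symmetric]) measurable
    also have "measure (C n) ?D = measure (\<nu> n) {Y \<in> space (\<nu> n). \<bar>\<psi> n Y - m\<bar> > \<epsilon> / 2}"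
      by (rule pull2[symmetric]) measurable
    also have "measure (C n) ?A + measure (\<nu> n) {Y \<in> space (\<nu> n). nfrob n Y > R}
        + measure (\<nu> n) {Y \<in> space (\<nu> n). \<bar>\<psi> n Y - m\<bar> > \<epsilon> / 2}
      \<le> measure (C n) ?A + H / R + 2 / \<epsilon> * (a / sqrt n + b / R)"
      using t1 t2 by linarith
    also have "\<dots> = (measure (C n) ?A + 2 / \<epsilon> * a * (1 / sqrt n)) + (H + 2 / \<epsilon> * b) / R"
      by (simp add: distrib_left add_divide_distrib)
    also have "\<dots> < r" using elim(1) Rr by linarith
    finally show ?case by (simp add: m_def)
  qed
qed

theorem theorem7:
  fixes \<mu> \<nu> :: "nat \<Rightarrow> (nat \<Rightarrow> real^'d) measure"
    and \<Sigma> :: "nat \<Rightarrow> real^'d^'d"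
  assumes X_law: "\<And>n. prob_space (\<mu> n) \<and> sets (\<mu> n) = sets (mat_space n)"
    and Y_law: "\<And>n. gauss_matrix n (\<Sigma> n) (\<nu> n)"
    and psd: "\<And>n. psd (\<Sigma> n)"
    and bdd: "bdd_above (range (\<lambda>n. opnorm (\<Sigma> n)))"
  shows "(\<exists>C. (\<forall>n. coupling n (\<mu> n) (\<nu> n) (C n)) \<and>
            (\<forall>\<epsilon>>0. (\<lambda>n. measure (C n)
                 {p \<in> space (C n). frob n (fst p - snd p) / sqrt n > \<epsilon>}) \<longlonglongrightarrow> 0))
     \<longleftrightarrow>
         (\<forall>(r::real)\<ge>1. \<forall>\<psi> :: nat \<Rightarrow> (nat \<Rightarrow> real^'d) \<Rightarrow> real.
            (\<forall>n. \<forall>X\<in>space (mat_space n). \<forall>Y\<in>space (mat_space n).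
               \<bar>\<psi> n X - \<psi> n Y\<bar> \<le> frob n (X - Y) / sqrt n *
                  (1 + rpow (frob n X / sqrt n) (r - 1) + rpow (frob n Y / sqrt n) (r - 1)))
            \<longrightarrow> (\<forall>\<epsilon>>0. (\<lambda>n. measure (\<mu> n)
                 {X \<in> space (\<mu> n). \<bar>\<psi> n X - (\<integral>Y. \<psi> n Y \<partial>\<nu> n)\<bar> > \<epsilon>}) \<longlonglongrightarrow> 0))"
  unfolding nfrob_def[symmetric]
proof
  assume "\<exists>C. (\<forall>n. coupling n (\<mu> n) (\<nu> n) (C n)) \<and>
    (\<forall>\<epsilon>>0. (\<lambda>n. measure (C n) {p \<in> space (C n). nfrob n (fst p - snd p) > \<epsilon>}) \<longlonglongrightarrow> 0)"
  then obtain C where C: "\<And>n. coupling n (\<mu> n) (\<nu> n) (C n)"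
    "\<And>\<epsilon>. \<epsilon> > 0 \<Longrightarrow> (\<lambda>n. measure (C n) {p \<in> space (C n). nfrob n (fst p - snd p) > \<epsilon>}) \<longlonglongrightarrow> 0" by auto
  obtain c where c: "\<And>n. opnorm (\<Sigma> n) \<le> c" using bdd by (auto simp: bdd_above_def)
  show "\<forall>(r::real)\<ge>1. \<forall>\<psi>. (\<forall>n. \<forall>X\<in>space (mat_space n). \<forall>Y\<in>space (mat_space n).
      \<bar>\<psi> n X - \<psi> n Y\<bar> \<le> nfrob n (X - Y) * (1 + rpow (nfrob n X) (r - 1) + rpow (nfrob n Y) (r - 1)))
    \<longrightarrow> (\<forall>\<epsilon>>0. (\<lambda>n. measure (\<mu> n) {X \<in> space (\<mu> n). \<bar>\<psi> n X - (\<integral>Y. \<psi> n Y \<partial>\<nu> n)\<bar> > \<epsilon>}) \<longlonglongrightarrow> 0)"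
  proof (intro allI impI)
    fix r \<epsilon> :: real and \<psi> :: "nat \<Rightarrow> (nat \<Rightarrow> real^'d) \<Rightarrow> real"
    assume r: "1 \<le> r" and \<epsilon>: "0 < \<epsilon>"
      and lip: "\<forall>n. \<forall>X\<in>space (mat_space n). \<forall>Y\<in>space (mat_space n).
        \<bar>\<psi> n X - \<psi> n Y\<bar> \<le> nfrob n (X - Y) * (1 + rpow (nfrob n X) (r - 1) + rpow (nfrob n Y) (r - 1))"
    obtain k where k: "r - 1 \<le> real k" using real_arch_simple by blast
    show "(\<lambda>n. measure (\<mu> n) {X \<in> space (\<mu> n). \<bar>\<psi> n X - (\<integral>Y. \<psi> n Y \<partial>\<nu> n)\<bar> > \<epsilon>}) \<longlonglongrightarrow> 0"
    proof (rule coupling_imp_concentration[OF Y_law psd c C _ \<epsilon>])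
      fix n and X Y :: "nat \<Rightarrow> real^'d" assume XY: "X \<in> space (mat_space n)" "Y \<in> space (mat_space n)"
      have "\<bar>\<psi> n X - \<psi> n Y\<bar> \<le> nfrob n (X - Y) * (1 + rpow (nfrob n X) (r - 1) + rpow (nfrob n Y) (r - 1))"
        using lip XY by blast
      also have "\<dots> \<le> nfrob n (X - Y) * (3 + nfrob n X ^ k + nfrob n Y ^ k)"
        using rpow_le_one_plus_power[of "nfrob n X" "r - 1" k] rpow_le_one_plus_power[of "nfrob n Y" "r - 1" k] r k
        by (intro mult_left_mono) auto
      finally show "\<bar>\<psi> n X - \<psi> n Y\<bar> \<le> nfrob n (X - Y) * (3 + nfrob n X ^ k + nfrob n Y ^ k)" .
    qed
  qed
next
  assume conc: "\<forall>(r::real)\<ge>1. \<forall>\<psi>. (\<forall>n. \<forall>X\<in>space (mat_space n). \<forall>Y\<in>space (mat_space n).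
      \<bar>\<psi> n X - \<psi> n Y\<bar> \<le> nfrob n (X - Y) * (1 + rpow (nfrob n X) (r - 1) + rpow (nfrob n Y) (r - 1)))
    \<longrightarrow> (\<forall>\<epsilon>>0. (\<lambda>n. measure (\<mu> n) {X \<in> space (\<mu> n). \<bar>\<psi> n X - (\<integral>Y. \<psi> n Y \<partial>\<nu> n)\<bar> > \<epsilon>}) \<longlonglongrightarrow> 0)"
  have \<mu>: "prob_space (\<mu> n)" "sets (\<mu> n) = sets (mat_space n)" for n using X_law by auto
  have \<nu>: "prob_space (\<nu> n)" "sets (\<nu> n) = sets (mat_space n)" for n using Y_law by (auto simp: gauss_matrix_def)
  have conc1: "(\<lambda>n. measure (\<mu> n) {X \<in> space (\<mu> n). \<bar>\<psi> n X - (\<integral>Y. \<psi> n Y \<partial>\<nu> n)\<bar> > \<tau>}) \<longlonglongrightarrow> 0"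
    if lip: "\<And>n X Y. X \<in> space (mat_space n) \<Longrightarrow> Y \<in> space (mat_space n) \<Longrightarrow> \<bar>\<psi> n X - \<psi> n Y\<bar> \<le> nfrob n (X - Y)"
      and \<tau>: "0 < \<tau>" for \<psi> \<tau>
  proof -
    \<comment> \<open>At r = 1 the convention for \<open>rpow\<close> makes both powers 1, so the
      allowed Lipschitz constant is 3, which covers 1-Lipschitz functions.\<close>
    have "\<forall>n. \<forall>X\<in>space (mat_space n). \<forall>Y\<in>space (mat_space n).
      \<bar>\<psi> n X - \<psi> n Y\<bar> \<le> nfrob n (X - Y) * (1 + rpow (nfrob n X) (1 - 1) + rpow (nfrob n Y) (1 - 1))"
    proof (intro allI ballI)
      fix n and X Y :: "nat \<Rightarrow> real^'d" assume "X \<in> space (mat_space n)" "Y \<in> space (mat_space n)"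
      from lip[OF this] show "\<bar>\<psi> n X - \<psi> n Y\<bar> \<le> nfrob n (X - Y) * (1 + rpow (nfrob n X) (1 - 1) + rpow (nfrob n Y) (1 - 1))"
        using nfrob_nonneg[of n "X - Y"] by (simp add: rpow_def)
    qed
    then show ?thesis using conc[rule_format, of 1 \<psi> \<tau>] \<tau> by blast
  qed
  show "\<exists>C. (\<forall>n. coupling n (\<mu> n) (\<nu> n) (C n)) \<and>
    (\<forall>\<epsilon>>0. (\<lambda>n. measure (C n) {p \<in> space (C n). nfrob n (fst p - snd p) > \<epsilon>}) \<longlonglongrightarrow> 0)"
  proof (rule diagonal_coupling)
    show "\<exists>C. coupling n (\<mu> n) (\<nu> n) C" for n by (rule coupling_exists[OF \<mu> \<nu>])
    fix \<epsilon> :: real assume "\<epsilon> > 0"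
    \<comment> \<open>Halved because the passage from expansion to couplings doubles both the
      distance and the exceptional mass.\<close>
    then have e2: "\<epsilon> / 2 > 0" by simp
    have "eventually (\<lambda>n. \<forall>A\<in>sets (mat_space n). \<forall>B\<in>sets (mat_space n).
        (\<forall>X\<in>A. \<forall>Y\<in>B. \<epsilon> / 2 < nfrob n (X - Y)) \<longrightarrow> \<epsilon> / 2 \<le> measure (\<mu> n) A \<longrightarrow>
        measure (\<nu> n) B \<le> \<epsilon> / 2) sequentially"
      by (rule Lipschitz_concentration_imp_expansion[OF \<mu> \<nu> _ e2 e2]) (rule conc1; blast)
    then show "eventually (\<lambda>n. \<exists>C. coupling n (\<mu> n) (\<nu> n) C \<and>
      measure C {p \<in> space C. nfrob n (fst p - snd p) > \<epsilon>} \<le> \<epsilon>) sequentially"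
    proof eventually_elim
      case (elim n)
      have "\<exists>C. coupling n (\<mu> n) (\<nu> n) C \<and>
        measure C {p \<in> space C. nfrob n (fst p - snd p) > 2 * (\<epsilon> / 2)} \<le> 2 * (\<epsilon> / 2)"
        by (rule expansion_imp_coupling[OF \<mu> \<nu> e2 e2]) (use elim in blast)
      then show ?case by simp
    qed
  qed
qed

end
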